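(* The theory $\mathsf{RCA}_0$ proves that $\mathsf{RT}^{!\omega}_2$ implies $\mathsf{ACA}_0^+$.
   Context: $\mathsf{RCA}_0$ is the usual base system of Reverse Mathematics. $\mathsf{ACA}_0^+$ is $\mathsf{RCA}_0$ together with $\forall X\,\exists Y\,(Y=X^{(\omega)})$, i.e. the $\omega$-th Turing jump of every set exists; "implies $\mathsf{ACA}_0^+$" over $\mathsf{RCA}_0$ means implying this axiom. A finite nonempty set $S\subseteq\mathbb{N}$ is exactly large if $\mathrm{card}(S)=\min(S)+3$. $\mathsf{RT}^{!\omega}_2$ is the statement: for every infinite $M\subseteq\mathbb{N}$ and every colouring $C$ of the exactly large subsets of $\mathbb{N}$ in two colours there is an infinite set $L\subseteq M$ such that all exactly large subsets of $L$ get the same colour under $C$. *)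

theory Defs
  imports Main
begin

section \<open>The language of second-order arithmetic\<close>

text \<open>
  Two-sorted syntax with de Bruijn indices. Number variables and set variables have independent
  index spaces: \<open>AllN\<close> binds number index 0, \<open>AllS\<close> binds set index 0. As usual in second-order
  arithmetic, equality is primitive for numbers only.
\<close>

datatype tm = Var nat | Zero | One | Add tm tm | Mul tm tm

datatype fm =
    Fls
  | Eq tm tm
  | Less tm tm
  | Mem tm nat
  | Imp fm fm
  | AllN fm
  | AllS fm

definition Neg :: "fm \<Rightarrow> fm" where "Neg p = Imp p Fls"
definition Con :: "fm \<Rightarrow> fm \<Rightarrow> fm" where "Con p q = Neg (Imp p (Neg q))"
definition Dis :: "fm \<Rightarrow> fm \<Rightarrow> fm" where "Dis p q = Imp (Neg p) q"
definition Iff :: "fm \<Rightarrow> fm \<Rightarrow> fm" where "Iff p q = Con (Imp p q) (Imp q p)"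
definition ExN :: "fm \<Rightarrow> fm" where "ExN p = Neg (AllN (Neg p))"
definition ExS :: "fm \<Rightarrow> fm" where "ExS p = Neg (AllS (Neg p))"

primrec tsub :: "(nat \<Rightarrow> tm) \<Rightarrow> tm \<Rightarrow> tm" where
  "tsub \<sigma> (Var i) = \<sigma> i"
| "tsub \<sigma> Zero = Zero"
| "tsub \<sigma> One = One"
| "tsub \<sigma> (Add s t) = Add (tsub \<sigma> s) (tsub \<sigma> t)"
| "tsub \<sigma> (Mul s t) = Mul (tsub \<sigma> s) (tsub \<sigma> t)"

definition tlift :: "tm \<Rightarrow> tm" where "tlift = tsub (\<lambda>i. Var (Suc i))"

definition upN :: "(nat \<Rightarrow> tm) \<Rightarrow> nat \<Rightarrow> tm" where
  "upN \<sigma> = case_nat (Var 0) (\<lambda>i. tlift (\<sigma> i))"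

definition upS :: "(nat \<Rightarrow> nat) \<Rightarrow> nat \<Rightarrow> nat" where
  "upS \<rho> = case_nat 0 (\<lambda>i. Suc (\<rho> i))"

text \<open>Simultaneous capture-avoiding substitution: \<open>\<sigma>\<close> acts on number variables, \<open>\<rho>\<close> on set variables.\<close>

primrec sub :: "(nat \<Rightarrow> tm) \<Rightarrow> (nat \<Rightarrow> nat) \<Rightarrow> fm \<Rightarrow> fm" where
  "sub \<sigma> \<rho> Fls = Fls"
| "sub \<sigma> \<rho> (Eq s t) = Eq (tsub \<sigma> s) (tsub \<sigma> t)"
| "sub \<sigma> \<rho> (Less s t) = Less (tsub \<sigma> s) (tsub \<sigma> t)"
| "sub \<sigma> \<rho> (Mem t X) = Mem (tsub \<sigma> t) (\<rho> X)"
| "sub \<sigma> \<rho> (Imp p q) = Imp (sub \<sigma> \<rho> p) (sub \<sigma> \<rho> q)"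
| "sub \<sigma> \<rho> (AllN p) = AllN (sub (upN \<sigma>) \<rho> p)"
| "sub \<sigma> \<rho> (AllS p) = AllS (sub \<sigma> (upS \<rho>) p)"

definition liftN :: "fm \<Rightarrow> fm" where "liftN = sub (\<lambda>i. Var (Suc i)) (\<lambda>X. X)"
definition liftS :: "fm \<Rightarrow> fm" where "liftS = sub Var Suc"
definition instN :: "tm \<Rightarrow> fm \<Rightarrow> fm" where "instN t = sub (case_nat t Var) (\<lambda>X. X)"
definition instS :: "nat \<Rightarrow> fm \<Rightarrow> fm" where "instS X = sub Var (case_nat X (\<lambda>Y. Y))"

text \<open>Strict upper bounds on the free indices, and the universal closure of a formula.\<close>

primrec tbound :: "tm \<Rightarrow> nat" where
  "tbound (Var i) = Suc i"
| "tbound Zero = 0"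
| "tbound One = 0"
| "tbound (Add s t) = max (tbound s) (tbound t)"
| "tbound (Mul s t) = max (tbound s) (tbound t)"

primrec boundN :: "fm \<Rightarrow> nat" where
  "boundN Fls = 0"
| "boundN (Eq s t) = max (tbound s) (tbound t)"
| "boundN (Less s t) = max (tbound s) (tbound t)"
| "boundN (Mem t X) = tbound t"
| "boundN (Imp p q) = max (boundN p) (boundN q)"
| "boundN (AllN p) = boundN p - 1"
| "boundN (AllS p) = boundN p"

primrec boundS :: "fm \<Rightarrow> nat" where
  "boundS Fls = 0"
| "boundS (Eq s t) = 0"
| "boundS (Less s t) = 0"
| "boundS (Mem t X) = Suc X"
| "boundS (Imp p q) = max (boundS p) (boundS q)"
| "boundS (AllN p) = boundS p"
| "boundS (AllS p) = boundS p - 1"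

definition uclosure :: "fm \<Rightarrow> fm" where
  "uclosure p = (AllS ^^ boundS p) ((AllN ^^ boundN p) p)"


section \<open>Provability\<close>

text \<open>Classical two-sorted natural deduction with equality.\<close>

inductive derives :: "fm set \<Rightarrow> fm \<Rightarrow> bool" (infix \<open>\<turnstile>\<close> 50) where
  Assm: "p \<in> \<Gamma> \<Longrightarrow> \<Gamma> \<turnstile> p"
| ImpI: "insert p \<Gamma> \<turnstile> q \<Longrightarrow> \<Gamma> \<turnstile> Imp p q"
| ImpE: "\<Gamma> \<turnstile> Imp p q \<Longrightarrow> \<Gamma> \<turnstile> p \<Longrightarrow> \<Gamma> \<turnstile> q"
| Contr: "insert (Neg p) \<Gamma> \<turnstile> Fls \<Longrightarrow> \<Gamma> \<turnstile> p"
| AllNI: "liftN ` \<Gamma> \<turnstile> p \<Longrightarrow> \<Gamma> \<turnstile> AllN p"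
| AllNE: "\<Gamma> \<turnstile> AllN p \<Longrightarrow> \<Gamma> \<turnstile> instN t p"
| AllSI: "liftS ` \<Gamma> \<turnstile> p \<Longrightarrow> \<Gamma> \<turnstile> AllS p"
| AllSE: "\<Gamma> \<turnstile> AllS p \<Longrightarrow> \<Gamma> \<turnstile> instS X p"
| EqI: "\<Gamma> \<turnstile> Eq t t"
| EqE: "\<Gamma> \<turnstile> Eq s t \<Longrightarrow> \<Gamma> \<turnstile> instN s p \<Longrightarrow> \<Gamma> \<turnstile> instN t p"


section \<open>Named binders\<close>

text \<open>
  Concrete formulas are written with ordinary bound variables. A term, set variable or formula
  is represented by a function of the numbers \<open>n\<close> and \<open>m\<close> of enclosing number and set quantifiers,
  so that a variable bound at depth \<open>k\<close> gets the de Bruijn index \<open>n - Suc k\<close> (resp. \<open>m - Suc k\<close>)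
  at each of its occurrences. A closed formula is read off at depth 0.
\<close>

type_synonym ntm = "nat \<Rightarrow> nat \<Rightarrow> tm"
type_synonym nset = "nat \<Rightarrow> nat \<Rightarrow> nat"
type_synonym nfm = "nat \<Rightarrow> nat \<Rightarrow> fm"

definition sentence :: "nfm \<Rightarrow> fm" where "sentence p = p 0 0"

definition nzero :: ntm (\<open>\<^bold>0\<close>) where "\<^bold>0 = (\<lambda>n m. Zero)"
definition nunit :: ntm (\<open>\<^bold>1\<close>) where "\<^bold>1 = (\<lambda>n m. One)"
definition nadd :: "ntm \<Rightarrow> ntm \<Rightarrow> ntm" (infixl \<open>\<^bold>+\<close> 65) where
  "s \<^bold>+ t = (\<lambda>n m. Add (s n m) (t n m))"
definition nmul :: "ntm \<Rightarrow> ntm \<Rightarrow> ntm" (infixl \<open>\<^bold>*\<close> 70) where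
  "s \<^bold>* t = (\<lambda>n m. Mul (s n m) (t n m))"

definition nfls :: nfm (\<open>\<^bold>\<bottom>\<close>) where "\<^bold>\<bottom> = (\<lambda>n m. Fls)"
definition neq :: "ntm \<Rightarrow> ntm \<Rightarrow> nfm" (infix \<open>\<^bold>=\<close> 50) where
  "s \<^bold>= t = (\<lambda>n m. Eq (s n m) (t n m))"
definition nless :: "ntm \<Rightarrow> ntm \<Rightarrow> nfm" (infix \<open>\<^bold><\<close> 50) where
  "s \<^bold>< t = (\<lambda>n m. Less (s n m) (t n m))"
definition nmem :: "ntm \<Rightarrow> nset \<Rightarrow> nfm" (infix \<open>\<^bold>\<in>\<close> 50) where
  "t \<^bold>\<in> X = (\<lambda>n m. Mem (t n m) (X n m))"
definition nneg :: "nfm \<Rightarrow> nfm" (\<open>\<^bold>\<not> _\<close> [40] 40) where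
  "(\<^bold>\<not> p) = (\<lambda>n m. Neg (p n m))"
definition ncon :: "nfm \<Rightarrow> nfm \<Rightarrow> nfm" (infixr \<open>\<^bold>\<and>\<close> 35) where
  "(p \<^bold>\<and> q) = (\<lambda>n m. Con (p n m) (q n m))"
definition ndis :: "nfm \<Rightarrow> nfm \<Rightarrow> nfm" (infixr \<open>\<^bold>\<or>\<close> 30) where
  "(p \<^bold>\<or> q) = (\<lambda>n m. Dis (p n m) (q n m))"
definition nimp :: "nfm \<Rightarrow> nfm \<Rightarrow> nfm" (infixr \<open>\<^bold>\<longrightarrow>\<close> 25) where
  "(p \<^bold>\<longrightarrow> q) = (\<lambda>n m. Imp (p n m) (q n m))"
definition niff :: "nfm \<Rightarrow> nfm \<Rightarrow> nfm" (infixr \<open>\<^bold>\<longleftrightarrow>\<close> 25) where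
  "(p \<^bold>\<longleftrightarrow> q) = (\<lambda>n m. Iff (p n m) (q n m))"

definition nallN :: "(ntm \<Rightarrow> nfm) \<Rightarrow> nfm" (binder \<open>\<^bold>\<forall>\<close> 10) where
  "nallN F = (\<lambda>n m. AllN (F (\<lambda>n' m'. Var (n' - Suc n)) (Suc n) m))"
definition nexN :: "(ntm \<Rightarrow> nfm) \<Rightarrow> nfm" (binder \<open>\<^bold>\<exists>\<close> 10) where
  "nexN F = (\<lambda>n m. ExN (F (\<lambda>n' m'. Var (n' - Suc n)) (Suc n) m))"
definition nallS :: "(nset \<Rightarrow> nfm) \<Rightarrow> nfm" (binder \<open>\<^bold>\<forall>\<^sub>S\<close> 10) where
  "nallS F = (\<lambda>n m. AllS (F (\<lambda>n' m'. m' - Suc m) n (Suc m)))"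
definition nexS :: "(nset \<Rightarrow> nfm) \<Rightarrow> nfm" (binder \<open>\<^bold>\<exists>\<^sub>S\<close> 10) where
  "nexS F = (\<lambda>n m. ExS (F (\<lambda>n' m'. m' - Suc m) n (Suc m)))"

definition nex1N :: "(ntm \<Rightarrow> nfm) \<Rightarrow> nfm" (binder \<open>\<^bold>\<exists>\<^sub>1\<close> 10) where
  "nex1N F = (\<^bold>\<exists>x. F x \<^bold>\<and> (\<^bold>\<forall>y. F y \<^bold>\<longrightarrow> y \<^bold>= x))"

definition nle :: "ntm \<Rightarrow> ntm \<Rightarrow> nfm" (infix \<open>\<^bold>\<le>\<close> 50) where
  "s \<^bold>\<le> t = (s \<^bold>< t \<^bold>\<or> s \<^bold>= t)"

primrec nnum :: "nat \<Rightarrow> ntm" where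
  "nnum 0 = \<^bold>0"
| "nnum (Suc k) = nnum k \<^bold>+ \<^bold>1"


section \<open>The theory \<open>RCA\<^sub>0\<close>\<close>

definition basic_axioms :: "fm set" where
  "basic_axioms = sentence `
    { \<^bold>\<forall>x. \<^bold>\<not> x \<^bold>+ \<^bold>1 \<^bold>= \<^bold>0,
      \<^bold>\<forall>x. \<^bold>\<forall>y. x \<^bold>+ \<^bold>1 \<^bold>= y \<^bold>+ \<^bold>1 \<^bold>\<longrightarrow> x \<^bold>= y,
      \<^bold>\<forall>x. x \<^bold>+ \<^bold>0 \<^bold>= x,
      \<^bold>\<forall>x. \<^bold>\<forall>y. x \<^bold>+ (y \<^bold>+ \<^bold>1) \<^bold>= (x \<^bold>+ y) \<^bold>+ \<^bold>1,
      \<^bold>\<forall>x. x \<^bold>* \<^bold>0 \<^bold>= \<^bold>0,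
      \<^bold>\<forall>x. \<^bold>\<forall>y. x \<^bold>* (y \<^bold>+ \<^bold>1) \<^bold>= (x \<^bold>* y) \<^bold>+ x,
      \<^bold>\<forall>x. \<^bold>\<not> x \<^bold>< \<^bold>0,
      \<^bold>\<forall>x. \<^bold>\<forall>y. x \<^bold>< y \<^bold>+ \<^bold>1 \<^bold>\<longleftrightarrow> x \<^bold>< y \<^bold>\<or> x \<^bold>= y }"

text \<open>Formulas with bounded number quantifiers; lifting the bound keeps the bound variable out of it.\<close>

inductive bounded_fm :: "fm \<Rightarrow> bool" where
  "bounded_fm Fls"
| "bounded_fm (Eq s t)"
| "bounded_fm (Less s t)"
| "bounded_fm (Mem t X)"
| "bounded_fm p \<Longrightarrow> bounded_fm q \<Longrightarrow> bounded_fm (Imp p q)"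
| "bounded_fm p \<Longrightarrow> bounded_fm (AllN (Imp (Less (Var 0) (tlift t)) p))"
| "bounded_fm p \<Longrightarrow> bounded_fm (ExN (Con (Less (Var 0) (tlift t)) p))"

definition Sigma01 :: "fm set" where "Sigma01 = {ExN p |p. bounded_fm p}"
definition Pi01 :: "fm set" where "Pi01 = {AllN p |p. bounded_fm p}"

text \<open>In both schemes the distinguished number variable has index 0; all other variables are parameters.\<close>

definition induction_ax :: "fm \<Rightarrow> fm" where
  "induction_ax p =
    Imp (Con (instN Zero p)
             (AllN (Imp p (sub (case_nat (Add (Var 0) One) (\<lambda>i. Var (Suc i))) (\<lambda>X. X) p))))
        (AllN p)"

definition comprehension_ax :: "fm \<Rightarrow> fm \<Rightarrow> fm" where
  "comprehension_ax p q =
    Imp (AllN (Iff p q)) (ExS (AllN (Iff (Mem (Var 0) 0) (liftS p))))"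

definition RCA0 :: "fm set" where
  "RCA0 = basic_axioms
    \<union> {uclosure (induction_ax p) |p. p \<in> Sigma01}
    \<union> {uclosure (comprehension_ax p q) |p q. p \<in> Sigma01 \<and> q \<in> Pi01}"


section \<open>Coding of finite sets and sequences\<close>

text \<open>
  Pairs are coded by \<open>(i + j)\<^sup>2 + i\<close>. The triple \<open>(k, (a, b))\<close> represents the finite set of all
  \<open>i < k\<close> such that \<open>a (i + 1) + 1\<close> divides \<open>b\<close>, and the code of a finite set is its least representation.
  A finite sequence is a function with domain \<open>{i. i < l}\<close>, as a finite set of pairs.
\<close>

definition npair :: "ntm \<Rightarrow> ntm \<Rightarrow> ntm" (\<open>\<^bold>\<langle>_,/ _\<^bold>\<rangle>\<close>) where
  "\<^bold>\<langle>s, t\<^bold>\<rangle> = (s \<^bold>+ t) \<^bold>* (s \<^bold>+ t) \<^bold>+ s"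

definition ndvd :: "ntm \<Rightarrow> ntm \<Rightarrow> nfm" (infix \<open>\<^bold>dvd\<close> 50) where
  "s \<^bold>dvd t = (\<^bold>\<exists>x. t \<^bold>= s \<^bold>* x)"

definition finmem :: "ntm \<Rightarrow> ntm \<Rightarrow> nfm" (infix \<open>\<^bold>\<in>\<^sub>f\<close> 50) where
  "i \<^bold>\<in>\<^sub>f s = (\<^bold>\<exists>k. \<^bold>\<exists>a. \<^bold>\<exists>b. s \<^bold>= \<^bold>\<langle>k, \<^bold>\<langle>a, b\<^bold>\<rangle>\<^bold>\<rangle> \<^bold>\<and> i \<^bold>< k \<^bold>\<and> a \<^bold>* (i \<^bold>+ \<^bold>1) \<^bold>+ \<^bold>1 \<^bold>dvd b)"

definition is_triple :: "ntm \<Rightarrow> nfm" where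
  "is_triple s = (\<^bold>\<exists>k. \<^bold>\<exists>a. \<^bold>\<exists>b. s \<^bold>= \<^bold>\<langle>k, \<^bold>\<langle>a, b\<^bold>\<rangle>\<^bold>\<rangle>)"

definition is_fin :: "ntm \<Rightarrow> nfm" where
  "is_fin s = (is_triple s \<^bold>\<and>
     \<^bold>\<not> (\<^bold>\<exists>t. t \<^bold>< s \<^bold>\<and> is_triple t \<^bold>\<and> (\<^bold>\<forall>i. i \<^bold>\<in>\<^sub>f t \<^bold>\<longleftrightarrow> i \<^bold>\<in>\<^sub>f s)))"

definition is_seq :: "ntm \<Rightarrow> ntm \<Rightarrow> nfm" where
  "is_seq s l = (is_fin s \<^bold>\<and>
     (\<^bold>\<forall>z. z \<^bold>\<in>\<^sub>f s \<^bold>\<longrightarrow> (\<^bold>\<exists>i. \<^bold>\<exists>v. z \<^bold>= \<^bold>\<langle>i, v\<^bold>\<rangle> \<^bold>\<and> i \<^bold>< l)) \<^bold>\<and>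
     (\<^bold>\<forall>i. i \<^bold>< l \<^bold>\<longrightarrow> (\<^bold>\<exists>\<^sub>1v. \<^bold>\<langle>i, v\<^bold>\<rangle> \<^bold>\<in>\<^sub>f s)))"

text \<open>Cardinality \<open>l\<close>: some finite sequence of length \<open>l\<close> enumerates the set bijectively.\<close>

definition has_card :: "ntm \<Rightarrow> ntm \<Rightarrow> nfm" where
  "has_card s l = (\<^bold>\<exists>f. is_seq f l \<^bold>\<and>
     (\<^bold>\<forall>i. \<^bold>\<forall>v. \<^bold>\<langle>i, v\<^bold>\<rangle> \<^bold>\<in>\<^sub>f f \<^bold>\<longrightarrow> v \<^bold>\<in>\<^sub>f s) \<^bold>\<and>
     (\<^bold>\<forall>v. v \<^bold>\<in>\<^sub>f s \<^bold>\<longrightarrow> (\<^bold>\<exists>\<^sub>1i. \<^bold>\<langle>i, v\<^bold>\<rangle> \<^bold>\<in>\<^sub>f f)))"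


section \<open>Ramsey's theorem for exactly large sets\<close>

definition is_min :: "ntm \<Rightarrow> ntm \<Rightarrow> nfm" where
  "is_min s x = (x \<^bold>\<in>\<^sub>f s \<^bold>\<and> (\<^bold>\<forall>y. y \<^bold>\<in>\<^sub>f s \<^bold>\<longrightarrow> x \<^bold>\<le> y))"

definition exactly_large :: "ntm \<Rightarrow> nfm" where
  "exactly_large s = (is_fin s \<^bold>\<and> (\<^bold>\<exists>x. is_min s x \<^bold>\<and> has_card s (x \<^bold>+ nnum 3)))"

definition infinite_set :: "nset \<Rightarrow> nfm" where
  "infinite_set X = (\<^bold>\<forall>x. \<^bold>\<exists>y. x \<^bold>< y \<^bold>\<and> y \<^bold>\<in> X)"

definition subset_of :: "nset \<Rightarrow> nset \<Rightarrow> nfm" where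
  "subset_of X Y = (\<^bold>\<forall>x. x \<^bold>\<in> X \<^bold>\<longrightarrow> x \<^bold>\<in> Y)"

definition fin_subset_of :: "ntm \<Rightarrow> nset \<Rightarrow> nfm" where
  "fin_subset_of s X = (\<^bold>\<forall>x. x \<^bold>\<in>\<^sub>f s \<^bold>\<longrightarrow> x \<^bold>\<in> X)"

text \<open>\<open>C\<close> is (the graph of) a function from the set of exactly large sets to \<open>{0, 1}\<close>.\<close>

definition is_colouring :: "nset \<Rightarrow> nfm" where
  "is_colouring C =
    ((\<^bold>\<forall>z. z \<^bold>\<in> C \<^bold>\<longrightarrow> (\<^bold>\<exists>s. \<^bold>\<exists>c. z \<^bold>= \<^bold>\<langle>s, c\<^bold>\<rangle> \<^bold>\<and> exactly_large s \<^bold>\<and> c \<^bold>< nnum 2)) \<^bold>\<and>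
     (\<^bold>\<forall>s. exactly_large s \<^bold>\<longrightarrow> (\<^bold>\<exists>\<^sub>1c. \<^bold>\<langle>s, c\<^bold>\<rangle> \<^bold>\<in> C)))"

definition RT_exactly_large :: nfm where
  "RT_exactly_large =
    (\<^bold>\<forall>\<^sub>SM. \<^bold>\<forall>\<^sub>SC. infinite_set M \<^bold>\<and> is_colouring C \<^bold>\<longrightarrow>
      (\<^bold>\<exists>\<^sub>SL. infinite_set L \<^bold>\<and> subset_of L M \<^bold>\<and>
        (\<^bold>\<exists>c. c \<^bold>< nnum 2 \<^bold>\<and>
          (\<^bold>\<forall>s. exactly_large s \<^bold>\<and> fin_subset_of s L \<^bold>\<longrightarrow> \<^bold>\<langle>s, c\<^bold>\<rangle> \<^bold>\<in> C))))"


section \<open>The Turing jump and its iteration\<close>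

text \<open>
  Computations relative to an oracle are those of unlimited register machines. A program is a finite
  sequence of instructions, coded as follows (\<open>R a\<close> is the content of register \<open>a\<close>, \<open>A\<close> the oracle):
  \<^item> \<open>(0, a)\<close>: \<open>R a := 0\<close>
  \<^item> \<open>(1, a)\<close>: \<open>R a := R a + 1\<close>
  \<^item> \<open>(2, (a, b))\<close>: \<open>R b := R a\<close>
  \<^item> \<open>(3, (a, (b, q)))\<close>: if \<open>R a = R b\<close> then jump to instruction \<open>q\<close>
  \<^item> \<open>(4, a)\<close>: if \<open>R a \<in> A\<close> then \<open>R a := 1\<close> else \<open>R a := 0\<close>

  The machine halts when it leaves the program. The oracle is given by a formula with a
  number argument, so that it can be a section of a set.

  The memory is coded by a finite set \<open>r\<close> of pairs; a register without entry in \<open>r\<close> contains 0.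
\<close>

definition reg :: "ntm \<Rightarrow> ntm \<Rightarrow> ntm \<Rightarrow> nfm" where
  "reg r a v = (\<^bold>\<langle>a, v\<^bold>\<rangle> \<^bold>\<in>\<^sub>f r \<^bold>\<or> (v \<^bold>= \<^bold>0 \<^bold>\<and> \<^bold>\<not> (\<^bold>\<exists>w. \<^bold>\<langle>a, w\<^bold>\<rangle> \<^bold>\<in>\<^sub>f r)))"

definition reg_update :: "ntm \<Rightarrow> ntm \<Rightarrow> ntm \<Rightarrow> ntm \<Rightarrow> nfm" where
  "reg_update r a v r' =
    (\<^bold>\<forall>b. \<^bold>\<forall>w. reg r' b w \<^bold>\<longleftrightarrow> (b \<^bold>= a \<^bold>\<and> w \<^bold>= v) \<^bold>\<or> (\<^bold>\<not> b \<^bold>= a \<^bold>\<and> reg r b w))"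

definition reg_init :: "ntm \<Rightarrow> ntm \<Rightarrow> nfm" where
  "reg_init x r = (\<^bold>\<forall>b. \<^bold>\<forall>w. reg r b w \<^bold>\<longleftrightarrow> (b \<^bold>= \<^bold>0 \<^bold>\<and> w \<^bold>= x) \<^bold>\<or> (\<^bold>\<not> b \<^bold>= \<^bold>0 \<^bold>\<and> w \<^bold>= \<^bold>0))"

text \<open>One step of program \<open>e\<close>, from instruction \<open>q\<close> and memory \<open>r\<close> to \<open>q'\<close> and \<open>r'\<close>.\<close>

definition urm_step :: "(ntm \<Rightarrow> nfm) \<Rightarrow> ntm \<Rightarrow> ntm \<Rightarrow> ntm \<Rightarrow> ntm \<Rightarrow> ntm \<Rightarrow> nfm" where
  "urm_step A e q r q' r' =
    ((\<^bold>\<exists>a. \<^bold>\<langle>q, \<^bold>\<langle>nnum 0, a\<^bold>\<rangle>\<^bold>\<rangle> \<^bold>\<in>\<^sub>f e \<^bold>\<and> q' \<^bold>= q \<^bold>+ \<^bold>1 \<^bold>\<and> reg_update r a \<^bold>0 r') \<^bold>\<or>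
     (\<^bold>\<exists>a. \<^bold>\<exists>v. \<^bold>\<langle>q, \<^bold>\<langle>nnum 1, a\<^bold>\<rangle>\<^bold>\<rangle> \<^bold>\<in>\<^sub>f e \<^bold>\<and> reg r a v \<^bold>\<and>
        q' \<^bold>= q \<^bold>+ \<^bold>1 \<^bold>\<and> reg_update r a (v \<^bold>+ \<^bold>1) r') \<^bold>\<or>
     (\<^bold>\<exists>a. \<^bold>\<exists>b. \<^bold>\<exists>v. \<^bold>\<langle>q, \<^bold>\<langle>nnum 2, \<^bold>\<langle>a, b\<^bold>\<rangle>\<^bold>\<rangle>\<^bold>\<rangle> \<^bold>\<in>\<^sub>f e \<^bold>\<and> reg r a v \<^bold>\<and>
        q' \<^bold>= q \<^bold>+ \<^bold>1 \<^bold>\<and> reg_update r b v r') \<^bold>\<or>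
     (\<^bold>\<exists>a. \<^bold>\<exists>b. \<^bold>\<exists>p. \<^bold>\<exists>v. \<^bold>\<exists>w. \<^bold>\<langle>q, \<^bold>\<langle>nnum 3, \<^bold>\<langle>a, \<^bold>\<langle>b, p\<^bold>\<rangle>\<^bold>\<rangle>\<^bold>\<rangle>\<^bold>\<rangle> \<^bold>\<in>\<^sub>f e \<^bold>\<and> reg r a v \<^bold>\<and> reg r b w \<^bold>\<and>
        ((v \<^bold>= w \<^bold>\<and> q' \<^bold>= p) \<^bold>\<or> (\<^bold>\<not> v \<^bold>= w \<^bold>\<and> q' \<^bold>= q \<^bold>+ \<^bold>1)) \<^bold>\<and> r' \<^bold>= r) \<^bold>\<or>
     (\<^bold>\<exists>a. \<^bold>\<exists>v. \<^bold>\<langle>q, \<^bold>\<langle>nnum 4, a\<^bold>\<rangle>\<^bold>\<rangle> \<^bold>\<in>\<^sub>f e \<^bold>\<and> reg r a v \<^bold>\<and> q' \<^bold>= q \<^bold>+ \<^bold>1 \<^bold>\<and>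
        ((A v \<^bold>\<and> reg_update r a \<^bold>1 r') \<^bold>\<or> (\<^bold>\<not> A v \<^bold>\<and> reg_update r a \<^bold>0 r'))))"

text \<open>\<open>{e}\<^sup>A(x)\<down>\<close>: there is a halting computation \<open>c\<close>, the sequence of its \<open>n + 1\<close> configurations.\<close>

definition urm_halts :: "(ntm \<Rightarrow> nfm) \<Rightarrow> ntm \<Rightarrow> ntm \<Rightarrow> nfm" where
  "urm_halts A e x =
    (\<^bold>\<exists>l. is_seq e l \<^bold>\<and> (\<^bold>\<exists>c. \<^bold>\<exists>n. is_seq c (n \<^bold>+ \<^bold>1) \<^bold>\<and>
       (\<^bold>\<exists>r. \<^bold>\<langle>\<^bold>0, \<^bold>\<langle>\<^bold>0, r\<^bold>\<rangle>\<^bold>\<rangle> \<^bold>\<in>\<^sub>f c \<^bold>\<and> reg_init x r) \<^bold>\<and>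
       (\<^bold>\<forall>t. t \<^bold>< n \<^bold>\<longrightarrow> (\<^bold>\<exists>q. \<^bold>\<exists>r. \<^bold>\<exists>q'. \<^bold>\<exists>r'. \<^bold>\<langle>t, \<^bold>\<langle>q, r\<^bold>\<rangle>\<^bold>\<rangle> \<^bold>\<in>\<^sub>f c \<^bold>\<and> \<^bold>\<langle>t \<^bold>+ \<^bold>1, \<^bold>\<langle>q', r'\<^bold>\<rangle>\<^bold>\<rangle> \<^bold>\<in>\<^sub>f c \<^bold>\<and>
          urm_step A e q r q' r')) \<^bold>\<and>
       (\<^bold>\<exists>q. \<^bold>\<exists>r. \<^bold>\<langle>n, \<^bold>\<langle>q, r\<^bold>\<rangle>\<^bold>\<rangle> \<^bold>\<in>\<^sub>f c \<^bold>\<and> l \<^bold>\<le> q)))"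

definition in_jump :: "(ntm \<Rightarrow> nfm) \<Rightarrow> ntm \<Rightarrow> nfm" where
  "in_jump A e = urm_halts A e e"

text \<open>
  \<open>Y\<close> is the \<open>\<omega>\<close>-th Turing jump of \<open>X\<close>, that is, the set of all \<open>(x, i)\<close> with \<open>x\<close> in the \<open>i\<close>-th
  jump of \<open>X\<close>. The sections \<open>Y\<^sub>i = {x. (x, i) \<in> Y}\<close> satisfy \<open>Y\<^sub>0 = X\<close> and \<open>Y\<^sub>i\<^sub>+\<^sub>1 = (Y\<^sub>i)'\<close>.
\<close>

definition is_omega_jump :: "nset \<Rightarrow> nset \<Rightarrow> nfm" where
  "is_omega_jump X Y =
    ((\<^bold>\<forall>z. z \<^bold>\<in> Y \<^bold>\<longrightarrow> (\<^bold>\<exists>x. \<^bold>\<exists>i. z \<^bold>= \<^bold>\<langle>x, i\<^bold>\<rangle>)) \<^bold>\<and>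
     (\<^bold>\<forall>x. \<^bold>\<langle>x, \<^bold>0\<^bold>\<rangle> \<^bold>\<in> Y \<^bold>\<longleftrightarrow> x \<^bold>\<in> X) \<^bold>\<and>
     (\<^bold>\<forall>i. \<^bold>\<forall>x. \<^bold>\<langle>x, i \<^bold>+ \<^bold>1\<^bold>\<rangle> \<^bold>\<in> Y \<^bold>\<longleftrightarrow> in_jump (\<lambda>y. \<^bold>\<langle>y, i\<^bold>\<rangle> \<^bold>\<in> Y) x))"

definition omega_jumps_exist :: nfm where
  "omega_jumps_exist = (\<^bold>\<forall>\<^sub>SX. \<^bold>\<exists>\<^sub>SY. is_omega_jump X Y)"

end

theory Submission
  imports Defs "HOL-Library.Countable_Set"
begin

text \<open>
  By completeness it suffices to argue in a countable model of \<open>RCA\<^sub>0\<close>. Fix \<open>X\<close> and let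
  \<open>J()\<close> be \<open>X\<close> and \<open>J(x\<^sub>1, \<dots>, x\<^sub>i\<^sub>+\<^sub>1)\<close> the set of all \<open>e\<close> such that some number below \<open>x\<^sub>1\<close> codes a
  halting computation of \<open>{e}(e)\<close> with oracle \<open>J(x\<^sub>2, \<dots>, x\<^sub>i\<^sub>+\<^sub>1)\<close>. Colour an exactly large set
  \<open>s\<^sub>0 < \<dots> < s\<^sub>2\<^sub>k\<close> (where \<open>s\<^sub>0 = 2 k - 2\<close>) by whether \<open>J(s\<^sub>1, \<dots>, s\<^sub>i)\<close> and
  \<open>J(s\<^sub>k\<^sub>+\<^sub>1, \<dots>, s\<^sub>k\<^sub>+\<^sub>i)\<close> agree below \<open>s\<^sub>0\<close> for all \<open>i \<le> k\<close>. On a homogeneous set of even numbers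
  they always agree, since among sufficiently many blocks of length \<open>k\<close> two realise the same
  pattern. Hence \<open>J(x\<^sub>1, \<dots>, x\<^sub>i)\<close> for consecutive elements \<open>x\<^sub>1, \<dots>, x\<^sub>i\<close> of the homogeneous set
  does not depend below \<open>p\<close> on the choice of \<open>x\<^sub>1\<close>, provided \<open>x\<^sub>1\<close> is large compared with \<open>p\<close> and
  \<open>i\<close>. This stable value is the \<open>i\<close>-th jump: a halting computation is found below \<open>x\<^sub>1\<close> as soon as
  \<open>x\<^sub>1\<close> is large enough, and a computation below \<open>x\<^sub>1\<close> queries the oracle only below \<open>x\<^sub>1\<close>. No
  induction on \<open>i\<close> is used.
\<close>

section \<open>Substitution\<close>

text \<open>The obstacle is that the base theory has induction for Sigma^0_1 formulas only, whereas
  membership in the i-th jump is not such a condition, and both i and the length of a block may be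
  nonstandard. Bounding every quantifier over computations by an element of the block removes it:
  the approximations become computable from X, uniformly in i, by one recursion inside the model,
  and homogeneity then shows that the bounds are already large enough. The omega-th jump is thus
  obtained by Delta^0_1 comprehension from X and the homogeneous set. Parity explains the even
  numbers: an exactly large set with minimum 2 j has 2 j + 3 = 1 + 2 (j + 1) elements, which leaves
  two blocks of equal length after the minimum. Completeness trades formal derivations for semantic
  arguments; the price is that finite sets, recursion, counting and register machines must be
  rebuilt in the model from Sigma^0_1 induction.\<close>

lemma tsub_tsub: "tsub \<sigma> (tsub \<tau> t) = tsub (\<lambda>i. tsub \<sigma> (\<tau> i)) t"
  by (induction t) auto

lemma tsub_Var [simp]: "tsub Var t = t"
  by (induction t) auto

lemma tsub_tlift [simp]: "tsub (case_nat s \<sigma>) (tlift t) = tsub \<sigma> t"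
  by (simp add: tlift_def tsub_tsub)

lemma upN_simps [simp]: "upN \<sigma> 0 = Var 0" "upN \<sigma> (Suc i) = tlift (\<sigma> i)"
  by (simp_all add: upN_def)

lemma upS_simps [simp]: "upS \<rho> 0 = 0" "upS \<rho> (Suc i) = Suc (\<rho> i)"
  by (simp_all add: upS_def)

lemma tsub_upN_tlift: "tsub (upN \<sigma>) (tlift t) = tlift (tsub \<sigma> t)"
  by (simp add: tlift_def tsub_tsub)

lemma upN_comp: "(\<lambda>i. tsub (upN \<sigma>) (upN \<tau> i)) = upN (\<lambda>i. tsub \<sigma> (\<tau> i))"
proof
  show "tsub (upN \<sigma>) (upN \<tau> i) = upN (\<lambda>i. tsub \<sigma> (\<tau> i)) i" for i
    by (cases i) (simp_all add: tsub_upN_tlift)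
qed

lemma upS_comp: "(\<lambda>i. upS \<rho> (upS \<pi> i)) = upS (\<lambda>i. \<rho> (\<pi> i))"
proof
  show "upS \<rho> (upS \<pi> i) = upS (\<lambda>i. \<rho> (\<pi> i)) i" for i
    by (cases i) simp_all
qed

lemma sub_sub: "sub \<sigma> \<rho> (sub \<tau> \<pi> p) = sub (\<lambda>i. tsub \<sigma> (\<tau> i)) (\<lambda>X. \<rho> (\<pi> X)) p"
  by (induction p arbitrary: \<sigma> \<rho> \<tau> \<pi>) (simp_all add: tsub_tsub upN_comp upS_comp)

lemma tlift_Var [simp]: "tlift (Var i) = Var (Suc i)"
  by (simp add: tlift_def)

lemma upN_Var [simp]: "upN Var = Var"
proof
  show "upN Var i = Var i" for i by (cases i) simp_all
qed

lemma upS_id [simp]: "upS (\<lambda>X. X) = (\<lambda>X. X)"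
proof
  show "upS (\<lambda>X. X) i = i" for i by (cases i) simp_all
qed

lemma sub_id [simp]: "sub Var (\<lambda>X. X) p = p"
  by (induction p) simp_all

lemma sub_Neg [simp]: "sub \<sigma> \<rho> (Neg p) = Neg (sub \<sigma> \<rho> p)"
  by (simp add: Neg_def)

lemma sub_upN_liftN: "sub (upN \<sigma>) \<rho> (liftN p) = liftN (sub \<sigma> \<rho> p)"
  by (simp add: liftN_def sub_sub) (simp add: tlift_def)

lemma sub_upS_liftS: "sub \<sigma> (upS \<rho>) (liftS p) = liftS (sub \<sigma> \<rho> p)"
  by (simp add: liftS_def sub_sub)

lemma instN_sub_upN: "instN t (sub (upN \<sigma>) \<rho> p) = sub (case_nat t \<sigma>) \<rho> p"
proof -
  have "(\<lambda>i. tsub (case_nat t Var) (upN \<sigma> i)) = case_nat t \<sigma>"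
  proof
    show "tsub (case_nat t Var) (upN \<sigma> i) = case_nat t \<sigma> i" for i by (cases i) simp_all
  qed
  then show ?thesis by (simp add: instN_def sub_sub)
qed

lemma instS_sub_upS: "instS X (sub \<sigma> (upS \<rho>) p) = sub \<sigma> (case_nat X \<rho>) p"
proof -
  have "(\<lambda>i. case_nat X (\<lambda>Y. Y) (upS \<rho> i)) = case_nat X \<rho>"
  proof
    show "case_nat X (\<lambda>Y. Y) (upS \<rho> i) = case_nat X \<rho> i" for i by (cases i) simp_all
  qed
  then show ?thesis by (simp add: instS_def sub_sub)
qed

lemma sub_instN: "sub \<sigma> \<rho> (instN t p) = instN (tsub \<sigma> t) (sub (upN \<sigma>) \<rho> p)"
proof -
  have "(\<lambda>i. tsub \<sigma> (case_nat t Var i)) = case_nat (tsub \<sigma> t) \<sigma>"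
    by (rule ext) (simp split: nat.split)
  then show ?thesis by (simp add: instN_sub_upN) (simp add: instN_def sub_sub)
qed

lemma sub_instS: "sub \<sigma> \<rho> (instS X p) = instS (\<rho> X) (sub \<sigma> (upS \<rho>) p)"
proof -
  have "(\<lambda>i. \<rho> (case_nat X (\<lambda>Y. Y) i)) = case_nat (\<rho> X) \<rho>"
    by (rule ext) (simp split: nat.split)
  then show ?thesis by (simp add: instS_sub_upS) (simp add: instS_def sub_sub)
qed

lemma tsub_cong: "(\<And>i. i < tbound t \<Longrightarrow> \<sigma> i = \<tau> i) \<Longrightarrow> tsub \<sigma> t = tsub \<tau> t"
  by (induction t) auto

lemma sub_cong:
  "(\<And>i. i < boundN p \<Longrightarrow> \<sigma> i = \<tau> i) \<Longrightarrow> (\<And>X. X < boundS p \<Longrightarrow> \<rho> X = \<pi> X) \<Longrightarrow>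
    sub \<sigma> \<rho> p = sub \<tau> \<pi> p"
proof (induction p arbitrary: \<sigma> \<tau> \<rho> \<pi>)
  case (AllN p)
  have "sub (upN \<sigma>) \<rho> p = sub (upN \<tau>) \<pi> p"
  proof (rule AllN.IH)
    show "upN \<sigma> i = upN \<tau> i" if "i < boundN p" for i
      using that AllN.prems(1) by (cases i) auto
  qed (use AllN.prems in auto)
  then show ?case by simp
next
  case (AllS p)
  have "sub \<sigma> (upS \<rho>) p = sub \<tau> (upS \<pi>) p"
  proof (rule AllS.IH)
    show "upS \<rho> i = upS \<pi> i" if "i < boundS p" for i
      using that AllS.prems(2) by (cases i) auto
  qed (use AllS.prems in auto)
  then show ?case by simp
next
  case (Imp p q)
  have "sub \<sigma> \<rho> p = sub \<tau> \<pi> p" using Imp.prems by (intro Imp.IH) simp_all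
  moreover have "sub \<sigma> \<rho> q = sub \<tau> \<pi> q" using Imp.prems by (intro Imp.IH) simp_all
  ultimately show ?case by simp
qed (simp_all, (blast intro: tsub_cong less_max_iff_disj[THEN iffD2])+)


section \<open>Completeness of natural deduction\<close>

lemma derives_mono: "\<Gamma> \<turnstile> p \<Longrightarrow> \<Gamma> \<subseteq> \<Delta> \<Longrightarrow> \<Delta> \<turnstile> p"
proof (induction arbitrary: \<Delta> rule: derives.induct)
  case (Assm p \<Gamma>)
  then show ?case by (intro derives.Assm) blast
next
  case (ImpI p \<Gamma> q)
  then show ?case by (intro derives.ImpI) blast
next
  case (ImpE \<Gamma> p q)
  show ?case by (rule derives.ImpE[OF ImpE.IH[OF ImpE.prems]])
next
  case (Contr p \<Gamma>)
  show ?case by (rule derives.Contr[OF Contr.IH]) (use Contr.prems in blast)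
next
  case (AllNI \<Gamma> p)
  then show ?case by (intro derives.AllNI) blast
next
  case (AllNE \<Gamma> p t)
  show ?case by (rule derives.AllNE[OF AllNE.IH[OF AllNE.prems]])
next
  case (AllSI \<Gamma> p)
  then show ?case by (intro derives.AllSI) blast
next
  case (AllSE \<Gamma> p X)
  show ?case by (rule derives.AllSE[OF AllSE.IH[OF AllSE.prems]])
next
  case (EqI \<Gamma> t)
  show ?case by (rule derives.EqI)
next
  case (EqE \<Gamma> s t p)
  show ?case by (rule derives.EqE[OF EqE.IH[OF EqE.prems]])
qed

text \<open>Admissible substitution is what lets a fresh variable be renamed to the index that
  \<open>AllNI\<close> and \<open>AllSI\<close> generalise. The quantifier cases work because
  substitution under a binder commutes with lifting.\<close>

lemma derives_sub: "\<Gamma> \<turnstile> p \<Longrightarrow> sub \<sigma> \<rho> ` \<Gamma> \<turnstile> sub \<sigma> \<rho> p"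
proof (induction arbitrary: \<sigma> \<rho> rule: derives.induct)
  case (ImpI p \<Gamma> q)
  then show ?case by (auto intro: derives.ImpI)
next
  case (ImpE \<Gamma> p q)
  show ?case
    using derives.ImpE[of _ "sub \<sigma> \<rho> p" "sub \<sigma> \<rho> q"] ImpE.IH[of \<sigma> \<rho>] by simp
next
  case (Contr p \<Gamma>)
  have "insert (Neg (sub \<sigma> \<rho> p)) (sub \<sigma> \<rho> ` \<Gamma>) \<turnstile> Fls"
    using Contr.IH[of \<sigma> \<rho>] by simp
  then show ?case by (rule derives.Contr)
next
  case (AllNI \<Gamma> p)
  have "liftN ` sub \<sigma> \<rho> ` \<Gamma> \<turnstile> sub (upN \<sigma>) \<rho> p"
    using AllNI.IH[of "upN \<sigma>" \<rho>] by (simp add: image_image sub_upN_liftN)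
  then show ?case by (simp add: derives.AllNI)
next
  case (AllNE \<Gamma> p t)
  have "sub \<sigma> \<rho> ` \<Gamma> \<turnstile> AllN (sub (upN \<sigma>) \<rho> p)"
    using AllNE.IH[of \<sigma> \<rho>] by simp
  then show ?case unfolding sub_instN by (rule derives.AllNE)
next
  case (AllSI \<Gamma> p)
  have "liftS ` sub \<sigma> \<rho> ` \<Gamma> \<turnstile> sub \<sigma> (upS \<rho>) p"
    using AllSI.IH[of \<sigma> "upS \<rho>"] by (simp add: image_image sub_upS_liftS)
  then show ?case by (simp add: derives.AllSI)
next
  case (AllSE \<Gamma> p X)
  have "sub \<sigma> \<rho> ` \<Gamma> \<turnstile> AllS (sub \<sigma> (upS \<rho>) p)"
    using AllSE.IH[of \<sigma> \<rho>] by simp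
  then show ?case unfolding sub_instS by (rule derives.AllSE)
next
  case (EqE \<Gamma> s t p)
  show ?case
    using derives.EqE[of _ "tsub \<sigma> s" "tsub \<sigma> t"] EqE.IH[of \<sigma> \<rho>] unfolding sub_instN by simp
qed (auto intro: derives.Assm derives.EqI)

text \<open>Compactness, needed for the union of the Henkin chain. In the \<open>AllNI\<close> and
  \<open>AllSI\<close> cases a finite part of the lifted context is pulled back to a finite part of
  the context.\<close>

lemma derives_finite: "\<Gamma> \<turnstile> p \<Longrightarrow> \<exists>\<Delta>. finite \<Delta> \<and> \<Delta> \<subseteq> \<Gamma> \<and> \<Delta> \<turnstile> p"
proof (induction rule: derives.induct)
  case (Assm p \<Gamma>)
  then show ?case by (intro exI[of _ "{p}"]) (auto intro: derives.Assm)
next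
  case (ImpI p \<Gamma> q)
  then obtain \<Delta> where "finite \<Delta>" "\<Delta> \<subseteq> insert p \<Gamma>" "\<Delta> \<turnstile> q" by blast
  then show ?case
    by (intro exI[of _ "\<Delta> - {p}"]) (auto intro!: derives.ImpI elim: derives_mono)
next
  case (ImpE \<Gamma> p q)
  then obtain \<Delta> \<Delta>' where "finite \<Delta>" "\<Delta> \<subseteq> \<Gamma>" "\<Delta> \<turnstile> Imp p q" "finite \<Delta>'" "\<Delta>' \<subseteq> \<Gamma>" "\<Delta>' \<turnstile> p"
    by blast
  then show ?case
    by (intro exI[of _ "\<Delta> \<union> \<Delta>'"] conjI derives.ImpE[of _ p q]) (auto elim: derives_mono)
next
  case (Contr p \<Gamma>)
  then obtain \<Delta> where "finite \<Delta>" "\<Delta> \<subseteq> insert (Neg p) \<Gamma>" "\<Delta> \<turnstile> Fls" by blast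
  then show ?case
    by (intro exI[of _ "\<Delta> - {Neg p}"]) (auto intro: derives.Contr[OF derives_mono])
next
  case (AllNI \<Gamma> p)
  then obtain \<Delta> where "finite \<Delta>" "\<Delta> \<subseteq> liftN ` \<Gamma>" "\<Delta> \<turnstile> p" by blast
  then show ?case
    using finite_subset_image[of \<Delta> liftN \<Gamma>] derives.AllNI by blast
next
  case (AllNE \<Gamma> p t)
  then show ?case by (blast intro: derives.AllNE[where p = p])
next
  case (AllSI \<Gamma> p)
  then obtain \<Delta> where "finite \<Delta>" "\<Delta> \<subseteq> liftS ` \<Gamma>" "\<Delta> \<turnstile> p" by blast
  then show ?case
    using finite_subset_image[of \<Delta> liftS \<Gamma>] derives.AllSI by blast
next
  case (AllSE \<Gamma> p X)
  then show ?case by (blast intro: derives.AllSE[where p = p])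
next
  case (EqI \<Gamma> t)
  then show ?case by (intro exI[of _ "{}"]) (auto intro: derives.EqI)
next
  case (EqE \<Gamma> s t p)
  then obtain \<Delta> \<Delta>' where "finite \<Delta>" "\<Delta> \<subseteq> \<Gamma>" "\<Delta> \<turnstile> Eq s t" "finite \<Delta>'" "\<Delta>' \<subseteq> \<Gamma>"
    "\<Delta>' \<turnstile> instN s p"
    by blast
  then show ?case
    by (intro exI[of _ "\<Delta> \<union> \<Delta>'"] conjI derives.EqE[of _ s t p]) (auto elim: derives_mono)
qed

lemma derives_cut: "\<Gamma> \<turnstile> p \<Longrightarrow> insert p \<Gamma> \<turnstile> q \<Longrightarrow> \<Gamma> \<turnstile> q"
  by (rule derives.ImpE[OF derives.ImpI])

text \<open>Under this bound n is a fresh index of either sort. Closed axioms with finitely many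
  additions always have such a bound, so variables can serve as Henkin constants.\<close>

definition bdd_free :: "nat \<Rightarrow> fm set \<Rightarrow> bool" where
  "bdd_free n \<Gamma> \<longleftrightarrow> (\<forall>p\<in>\<Gamma>. boundN p \<le> n \<and> boundS p \<le> n)"

text \<open>Coincides with lifting on the indices below n and sends the fresh index n to 0, the
  index that lifting leaves vacant.\<close>

definition shiftN :: "nat \<Rightarrow> nat \<Rightarrow> tm" where
  "shiftN n i = (if i = n then Var 0 else Var (Suc i))"

definition shiftS :: "nat \<Rightarrow> nat \<Rightarrow> nat" where
  "shiftS n i = (if i = n then 0 else Suc i)"

text \<open>Since rule \<open>AllNI\<close> works by lifting, a fresh variable is renamed to index 0 first.\<close>

lemma generalizeN:
  assumes "bdd_free n \<Gamma>" "boundN p \<le> Suc n" "\<Gamma> \<turnstile> instN (Var n) p"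
  shows "\<Gamma> \<turnstile> AllN p"
proof -
  have "sub (shiftN n) (\<lambda>X. X) q = liftN q" if "q \<in> \<Gamma>" for q
    unfolding liftN_def using that assms(1) by (intro sub_cong) (auto simp: bdd_free_def shiftN_def)
  then have "sub (shiftN n) (\<lambda>X. X) ` \<Gamma> = liftN ` \<Gamma>"
    by (rule image_cong[OF refl])
  moreover have "sub (shiftN n) (\<lambda>X. X) (instN (Var n) p) = p"
  proof -
    have "sub (shiftN n) (\<lambda>X. X) (instN (Var n) p) = sub Var (\<lambda>X. X) p"
      unfolding instN_def sub_sub
    proof (rule sub_cong)
      fix i assume "i < boundN p"
      then show "tsub (shiftN n) (case_nat (Var n) Var i) = Var i"
        using assms(2) by (cases i) (auto simp: shiftN_def)
    qed auto
    then show ?thesis by simp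
  qed
  ultimately show ?thesis
    using derives_sub[OF assms(3), of "shiftN n" "\<lambda>X. X"] by (simp add: derives.AllNI)
qed

lemma generalizeS:
  assumes "bdd_free n \<Gamma>" "boundS p \<le> Suc n" "\<Gamma> \<turnstile> instS n p"
  shows "\<Gamma> \<turnstile> AllS p"
proof -
  have "sub Var (shiftS n) q = liftS q" if "q \<in> \<Gamma>" for q
    unfolding liftS_def using that assms(1) by (intro sub_cong) (auto simp: bdd_free_def shiftS_def)
  then have "sub Var (shiftS n) ` \<Gamma> = liftS ` \<Gamma>"
    by (rule image_cong[OF refl])
  moreover have "sub Var (shiftS n) (instS n p) = p"
  proof -
    have "sub Var (shiftS n) (instS n p) = sub Var (\<lambda>X. X) p"
      unfolding instS_def sub_sub
    proof (rule sub_cong)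
      fix i assume "i < boundS p"
      then show "shiftS n (case_nat n (\<lambda>Y. Y) i) = i"
        using assms(2) by (cases i) (auto simp: shiftS_def)
    qed auto
    then show ?thesis by simp
  qed
  ultimately show ?thesis
    using derives_sub[OF assms(3), of Var "shiftS n"] by (simp add: derives.AllSI)
qed

lemma bdd_free_insert:
  assumes "bdd_free n \<Gamma>" obtains m where "n \<le> m" "bdd_free m (insert p \<Gamma>)"
proof
  show "n \<le> max n (max (boundN p) (boundS p))" by simp
  then show "bdd_free (max n (max (boundN p) (boundS p))) (insert p \<Gamma>)"
    using assms by (auto simp: bdd_free_def)
qed

definition witnessed :: "fm \<Rightarrow> fm set \<Rightarrow> bool" where
  "witnessed q \<Gamma> \<longleftrightarrow>
    (\<forall>p. q = Neg (AllN p) \<longrightarrow> (\<exists>t. Neg (instN t p) \<in> \<Gamma>)) \<and>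
    (\<forall>p. q = Neg (AllS p) \<longrightarrow> (\<exists>X. Neg (instS X p) \<in> \<Gamma>))"

text \<open>If q is consistent with \<open>\<Gamma>\<close>, it is added, together with a fresh
  variable as counterexample when q refutes a universal formula. Were the counterexample
  inconsistent, \<open>generalizeN\<close> or \<open>generalizeS\<close> would derive that universal
  formula, against q.\<close>

lemma henkin_step:
  assumes "\<not> \<Gamma> \<turnstile> Fls" "bdd_free n \<Gamma>"
  obtains \<Gamma>' m where "\<Gamma> \<subseteq> \<Gamma>'" "\<not> \<Gamma>' \<turnstile> Fls" "bdd_free m \<Gamma>'"
    "insert q \<Gamma> \<turnstile> Fls \<or> q \<in> \<Gamma>' \<and> witnessed q \<Gamma>'"
proof (cases "insert q \<Gamma> \<turnstile> Fls")
  case True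
  then show ?thesis using assms that by blast
next
  case False
  note extend = that
  let ?\<Delta> = "insert q \<Gamma>"
  obtain k where k: "bdd_free k ?\<Delta>" by (rule bdd_free_insert[OF assms(2)])
  have qk: "boundN q \<le> k" "boundS q \<le> k" using k by (auto simp: bdd_free_def)
  have wit: ?thesis if r: "insert r ?\<Delta> \<turnstile> Fls \<Longrightarrow> ?\<Delta> \<turnstile> Fls" "witnessed q (insert r ?\<Delta>)" for r
  proof -
    obtain m where "bdd_free m (insert r ?\<Delta>)" by (rule bdd_free_insert[OF k])
    then show ?thesis using r False by (intro extend[of "insert r ?\<Delta>" m]) auto
  qed
  consider (N) p where "q = Neg (AllN p)" | (S) p where "q = Neg (AllS p)"
    | (other) "\<And>p. q \<noteq> Neg (AllN p)" "\<And>p. q \<noteq> Neg (AllS p)" by blast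
  then show ?thesis
  proof cases
    case N
    show ?thesis
    proof (rule wit[of "Neg (instN (Var k) p)"])
      assume "insert (Neg (instN (Var k) p)) ?\<Delta> \<turnstile> Fls"
      then have "?\<Delta> \<turnstile> instN (Var k) p" by (rule derives.Contr)
      then have "?\<Delta> \<turnstile> AllN p"
        by (rule generalizeN[OF k, rotated]) (use qk N in \<open>auto simp: Neg_def\<close>)
      moreover have "?\<Delta> \<turnstile> Neg (AllN p)" using N by (auto intro: derives.Assm)
      ultimately show "?\<Delta> \<turnstile> Fls" unfolding Neg_def by (rule derives.ImpE[rotated])
    qed (use N in \<open>auto simp: witnessed_def Neg_def\<close>)
  next
    case S
    show ?thesis
    proof (rule wit[of "Neg (instS k p)"])
      assume "insert (Neg (instS k p)) ?\<Delta> \<turnstile> Fls"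
      then have "?\<Delta> \<turnstile> instS k p" by (rule derives.Contr)
      then have "?\<Delta> \<turnstile> AllS p"
        by (rule generalizeS[OF k, rotated]) (use qk S in \<open>auto simp: Neg_def\<close>)
      moreover have "?\<Delta> \<turnstile> Neg (AllS p)" using S by (auto intro: derives.Assm)
      ultimately show "?\<Delta> \<turnstile> Fls" unfolding Neg_def by (rule derives.ImpE[rotated])
    qed (use S in \<open>auto simp: witnessed_def Neg_def\<close>)
  next
    case other
    then show ?thesis using False k by (intro that[of ?\<Delta> k]) (auto simp: witnessed_def)
  qed
qed

section \<open>Complete consistent sets with witnesses\<close>

instance tm :: countable by countable_datatype
instance fm :: countable by countable_datatype

locale henkin =
  fixes H :: "fm set"
  assumes closed: "H \<turnstile> p \<Longrightarrow> p \<in> H"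
    and consistent: "Fls \<notin> H"
    and complete: "p \<in> H \<or> Neg p \<in> H"
    and witN: "Neg (AllN p) \<in> H \<Longrightarrow> \<exists>t. Neg (instN t p) \<in> H"
    and witS: "Neg (AllS p) \<in> H \<Longrightarrow> \<exists>X. Neg (instS X p) \<in> H"

text \<open>Lindenbaum's construction: every formula p is treated at stage \<open>to_nat p\<close>.
  The ascending union is consistent by compactness, and what is consistent with the union was
  consistent with its stage, hence was added there with its witness.\<close>

lemma henkin_extension:
  assumes "\<not> \<Gamma> \<turnstile> Fls" "bdd_free n \<Gamma>"
  obtains H where "\<Gamma> \<subseteq> H" "henkin H"
proof -
  let ?ok = "\<lambda>\<Gamma>. \<not> \<Gamma> \<turnstile> Fls \<and> (\<exists>n. bdd_free n \<Gamma>)"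
  let ?step = "\<lambda>i \<Gamma> \<Gamma>'. \<Gamma> \<subseteq> \<Gamma>' \<and>
    (insert (from_nat i) \<Gamma> \<turnstile> Fls \<or> from_nat i \<in> \<Gamma>' \<and> witnessed (from_nat i) \<Gamma>')"
  let ?P = "\<lambda>i \<Delta>. (i = 0 \<longrightarrow> \<Delta> = \<Gamma>) \<and> ?ok \<Delta>"
  have "\<exists>\<Delta>. ?P 0 \<Delta>" using assms by blast
  moreover have "\<exists>\<Delta>'. ?P (Suc i) \<Delta>' \<and> ?step i \<Delta> \<Delta>'" if P: "?P i \<Delta>" for i \<Delta>
  proof -
    obtain k where k: "\<not> \<Delta> \<turnstile> Fls" "bdd_free k \<Delta>" using P by blast
    obtain \<Delta>' m where "\<Delta> \<subseteq> \<Delta>'" "\<not> \<Delta>' \<turnstile> Fls" "bdd_free m \<Delta>'"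
      "insert (from_nat i) \<Delta> \<turnstile> Fls \<or> from_nat i \<in> \<Delta>' \<and> witnessed (from_nat i) \<Delta>'"
      by (rule henkin_step[OF k])
    then show ?thesis by (intro exI[of _ \<Delta>']) auto
  qed
  ultimately have "\<exists>f. \<forall>i. ?P i (f i) \<and> ?step i (f i) (f (Suc i))"
    by (rule dependent_nat_choice[where P = ?P and Q = ?step])
  then obtain f where "\<And>i. ?P i (f i)" and step: "\<And>i. ?step i (f i) (f (Suc i))" by blast
  then have f: "f 0 = \<Gamma>" "\<And>i. ?ok (f i)" by simp_all
  let ?H = "\<Union>i. f i"
  have mono: "f i \<subseteq> f j" if "i \<le> j" for i j
    by (rule lift_Suc_mono_le[OF _ that]) (use step in blast)
  have con: "\<not> ?H \<turnstile> Fls"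
  proof
    assume "?H \<turnstile> Fls"
    then obtain \<Delta> where \<Delta>: "finite \<Delta>" "\<Delta> \<subseteq> ?H" "\<Delta> \<turnstile> Fls" using derives_finite by blast
    have "\<exists>i. \<Delta> \<subseteq> f i"
      using \<Delta>(1,2)
    proof (induction \<Delta>)
      case (insert p \<Delta>)
      then obtain i j where "\<Delta> \<subseteq> f i" "p \<in> f j" by auto
      then have "insert p \<Delta> \<subseteq> f (max i j)" using mono[of i "max i j"] mono[of j "max i j"] by auto
      then show ?case ..
    qed simp
    then show False using \<Delta>(3) f(2) derives_mono by blast
  qed
  have max: "p \<in> ?H \<and> witnessed p ?H" if "\<not> insert p ?H \<turnstile> Fls" for p
  proof -
    have "insert (from_nat (to_nat p)) (f (to_nat p)) \<subseteq> insert p ?H" by auto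
    then have "\<not> insert (from_nat (to_nat p)) (f (to_nat p)) \<turnstile> Fls"
      using that derives_mono by blast
    with step[of "to_nat p"] have "p \<in> f (Suc (to_nat p)) \<and> witnessed p (f (Suc (to_nat p)))"
      by simp
    then show ?thesis unfolding witnessed_def by blast
  qed
  have closed: "p \<in> ?H" if "?H \<turnstile> p" for p
    using that max[of p] con derives_cut[OF that, of Fls] by blast
  have mem: "\<not> insert p ?H \<turnstile> Fls" if "p \<in> ?H" for p
    using that con by (simp add: insert_absorb)
  show ?thesis
  proof
    show "\<Gamma> \<subseteq> ?H" using f(1) by blast
    show "henkin ?H"
    proof
      show "Fls \<notin> ?H" using con derives.Assm by blast
      show "p \<in> ?H \<or> Neg p \<in> ?H" for p
        unfolding Neg_def using max[of p] closed[OF derives.ImpI[of p ?H Fls]] by blast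
      show "\<exists>t. Neg (instN t p) \<in> ?H" if "Neg (AllN p) \<in> ?H" for p
        using max[OF mem[OF that]] by (auto simp: witnessed_def)
      show "\<exists>X. Neg (instS X p) \<in> ?H" if "Neg (AllS p) \<in> ?H" for p
        using max[OF mem[OF that]] by (auto simp: witnessed_def)
    qed (rule closed)
  qed
qed

context henkin
begin

lemma mem_mp: "Imp p q \<in> H \<Longrightarrow> p \<in> H \<Longrightarrow> q \<in> H"
  using closed[OF derives.ImpE[OF derives.Assm derives.Assm]] by blast

lemma mem_Neg: "Neg p \<in> H \<longleftrightarrow> p \<notin> H"
  using complete consistent mem_mp unfolding Neg_def by blast

lemma mem_Imp: "Imp p q \<in> H \<longleftrightarrow> (p \<in> H \<longrightarrow> q \<in> H)"
proof
  assume r: "p \<in> H \<longrightarrow> q \<in> H"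
  show "Imp p q \<in> H"
  proof (cases "q \<in> H")
    case True
    then show ?thesis by (intro closed derives.ImpI derives.Assm) simp
  next
    case False
    then have "Imp p Fls \<in> H" using r mem_Neg unfolding Neg_def by blast
    then have "insert p H \<turnstile> Fls"
      using derives.ImpE[OF derives.Assm derives.Assm, of p Fls "insert p H"] by blast
    then have "insert (Neg q) (insert p H) \<turnstile> Fls" by (rule derives_mono) blast
    then have "insert p H \<turnstile> q" by (rule derives.Contr)
    then show ?thesis by (intro closed derives.ImpI)
  qed
qed (use mem_mp in blast)

lemma mem_AllN: "AllN p \<in> H \<longleftrightarrow> (\<forall>t. instN t p \<in> H)"
  using closed[OF derives.AllNE[OF derives.Assm]] mem_Neg witN by blast

lemma mem_AllS: "AllS p \<in> H \<longleftrightarrow> (\<forall>X. instS X p \<in> H)"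
  using closed[OF derives.AllSE[OF derives.Assm]] mem_Neg witS by blast

lemma mem_refl: "Eq t t \<in> H"
  by (intro closed derives.EqI)

lemma mem_subst: "Eq s t \<in> H \<Longrightarrow> instN s p \<in> H \<Longrightarrow> instN t p \<in> H"
  using closed[OF derives.EqE[OF derives.Assm derives.Assm]] by blast

text \<open>This law and the following ones substitute equals in an atomic formula whose variable 0
  marks the place to be replaced; \<open>tlift\<close> protects the other terms.\<close>

lemma mem_sym: "Eq s t \<in> H \<Longrightarrow> Eq t s \<in> H"
  using mem_subst[of s t "Eq (Var 0) (tlift s)"] mem_refl by (simp add: instN_def)

lemma mem_trans: "Eq s t \<in> H \<Longrightarrow> Eq t u \<in> H \<Longrightarrow> Eq s u \<in> H"
  using mem_subst[of t u "Eq (tlift s) (Var 0)"] by (simp add: instN_def)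

lemma mem_Add: "Eq s s' \<in> H \<Longrightarrow> Eq t t' \<in> H \<Longrightarrow> Eq (Add s t) (Add s' t') \<in> H"
  using mem_subst[of s s' "Eq (tlift (Add s t)) (Add (Var 0) (tlift t))"]
    mem_subst[of t t' "Eq (tlift (Add s t)) (Add (tlift s') (Var 0))"] mem_refl
  by (simp add: instN_def)

lemma mem_Mul: "Eq s s' \<in> H \<Longrightarrow> Eq t t' \<in> H \<Longrightarrow> Eq (Mul s t) (Mul s' t') \<in> H"
  using mem_subst[of s s' "Eq (tlift (Mul s t)) (Mul (Var 0) (tlift t))"]
    mem_subst[of t t' "Eq (tlift (Mul s t)) (Mul (tlift s') (Var 0))"] mem_refl
  by (simp add: instN_def)

lemma mem_Less: "Eq s s' \<in> H \<Longrightarrow> Eq t t' \<in> H \<Longrightarrow> Less s t \<in> H \<Longrightarrow> Less s' t' \<in> H"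
  using mem_subst[of s s' "Less (Var 0) (tlift t)"] mem_subst[of t t' "Less (tlift s') (Var 0)"]
  by (simp add: instN_def)

lemma mem_Mem: "Eq s s' \<in> H \<Longrightarrow> Mem s X \<in> H \<Longrightarrow> Mem s' X \<in> H"
  using mem_subst[of s s' "Mem (Var 0) X"] by (simp add: instN_def)

end


section \<open>Structures\<close>

text \<open>
  The second-order part of a structure is given by an enumeration \<open>sets\<close>, so that set variables
  are interpreted by indices.
\<close>

record 'a str =
  zer :: 'a
  unt :: 'a
  add :: "'a \<Rightarrow> 'a \<Rightarrow> 'a"
  mul :: "'a \<Rightarrow> 'a \<Rightarrow> 'a"
  less :: "'a \<Rightarrow> 'a \<Rightarrow> bool"
  sets :: "nat \<Rightarrow> 'a set"

primrec tval :: "'a str \<Rightarrow> (nat \<Rightarrow> 'a) \<Rightarrow> tm \<Rightarrow> 'a" where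
  "tval M e (Var i) = e i"
| "tval M e Zero = zer M"
| "tval M e One = unt M"
| "tval M e (Add s t) = add M (tval M e s) (tval M e t)"
| "tval M e (Mul s t) = mul M (tval M e s) (tval M e t)"

primrec sat :: "'a str \<Rightarrow> (nat \<Rightarrow> 'a) \<Rightarrow> (nat \<Rightarrow> nat) \<Rightarrow> fm \<Rightarrow> bool" where
  "sat M e w Fls \<longleftrightarrow> False"
| "sat M e w (Eq s t) \<longleftrightarrow> tval M e s = tval M e t"
| "sat M e w (Less s t) \<longleftrightarrow> less M (tval M e s) (tval M e t)"
| "sat M e w (Mem t X) \<longleftrightarrow> tval M e t \<in> sets M (w X)"
| "sat M e w (Imp p q) \<longleftrightarrow> (sat M e w p \<longrightarrow> sat M e w q)"
| "sat M e w (AllN p) \<longleftrightarrow> (\<forall>x. sat M (case_nat x e) w p)"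
| "sat M e w (AllS p) \<longleftrightarrow> (\<forall>X. sat M e (case_nat X w) p)"

lemma sat_connectives [simp]:
  "sat M e w (Neg p) \<longleftrightarrow> \<not> sat M e w p"
  "sat M e w (Con p q) \<longleftrightarrow> sat M e w p \<and> sat M e w q"
  "sat M e w (Dis p q) \<longleftrightarrow> sat M e w p \<or> sat M e w q"
  "sat M e w (Iff p q) \<longleftrightarrow> (sat M e w p \<longleftrightarrow> sat M e w q)"
  "sat M e w (ExN p) \<longleftrightarrow> (\<exists>x. sat M (case_nat x e) w p)"
  "sat M e w (ExS p) \<longleftrightarrow> (\<exists>X. sat M e (case_nat X w) p)"
  by (auto simp: Neg_def Con_def Dis_def Iff_def ExN_def ExS_def)

lemma tval_tsub: "tval M e (tsub \<sigma> t) = tval M (\<lambda>i. tval M e (\<sigma> i)) t"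
  by (induction t) auto

lemma tval_tlift [simp]: "tval M (case_nat x e) (tlift t) = tval M e t"
  by (simp add: tlift_def tval_tsub)

lemma sat_sub: "sat M e w (sub \<sigma> \<rho> p) \<longleftrightarrow> sat M (\<lambda>i. tval M e (\<sigma> i)) (\<lambda>X. w (\<rho> X)) p"
proof (induction p arbitrary: \<sigma> \<rho> e w)
  case (AllN p)
  have "(\<lambda>i. tval M (case_nat x e) (upN \<sigma> i)) = case_nat x (\<lambda>i. tval M e (\<sigma> i))" for x
    by (rule ext) (simp add: upN_def split: nat.split)
  then show ?case by (simp add: AllN)
next
  case (AllS p)
  have "(\<lambda>i. case_nat X w (upS \<rho> i)) = case_nat X (\<lambda>i. w (\<rho> i))" for X
    by (rule ext) (simp add: upS_def split: nat.split)
  then show ?case by (simp add: AllS)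
qed (simp_all add: tval_tsub)

lemma sat_uclosure:
  assumes "\<And>e w. sat M e w (uclosure p)"
  shows "sat M e w p"
proof -
  \<comment> \<open>Every assignment arises from its tail by prefixing its own value at 0, so
    validity of a universal formula gives back validity of its body.\<close>
  have N: "\<forall>e w. sat M e w p" if "\<forall>e w. sat M e w ((AllN ^^ k) p)" for k p
    using that
  proof (induction k arbitrary: p)
    case (Suc k)
    have "\<forall>e w. sat M e w (AllN p)"
      using Suc.IH[of "AllN p"] Suc.prems by (simp del: sat.simps funpow.simps add: funpow_Suc_right)
    then have "sat M (case_nat (e 0) (\<lambda>i. e (Suc i))) w p" for e w by simp
    moreover have "case_nat (e 0) (\<lambda>i. e (Suc i)) = e" for e :: "nat \<Rightarrow> 'a"
      by (rule ext) (simp split: nat.split)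
    ultimately show ?case by simp
  qed simp
  have S: "\<forall>e w. sat M e w p" if "\<forall>e w. sat M e w ((AllS ^^ k) p)" for k p
    using that
  proof (induction k arbitrary: p)
    case (Suc k)
    have "\<forall>e w. sat M e w (AllS p)"
      using Suc.IH[of "AllS p"] Suc.prems by (simp del: sat.simps funpow.simps add: funpow_Suc_right)
    then have "sat M e (case_nat (w 0) (\<lambda>i. w (Suc i))) p" for e w by simp
    moreover have "case_nat (w 0) (\<lambda>i. w (Suc i)) = w" for w :: "nat \<Rightarrow> nat"
      by (rule ext) (simp split: nat.split)
    ultimately show ?case by simp
  qed simp
  have "\<forall>e w. sat M e w ((AllS ^^ boundS p) ((AllN ^^ boundN p) p))"
    using assms unfolding uclosure_def by blast
  from N[OF S[OF this]] show ?thesis by blast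
qed

lemma bound_funpow:
  "boundN ((AllN ^^ k) p) = boundN p - k" "boundS ((AllN ^^ k) p) = boundS p"
  "boundN ((AllS ^^ k) p) = boundN p" "boundS ((AllS ^^ k) p) = boundS p - k"
  by (induction k) auto

lemma uclosure_closed [simp]: "boundN (uclosure p) = 0" "boundS (uclosure p) = 0"
  by (simp_all add: uclosure_def bound_funpow)

context henkin
begin

text \<open>With h as assumed below, this is the quotient of the terms by equality in
  \<open>H\<close>, carried over to a carrier chosen in advance; \<open>inv h\<close> selects
  representatives. A set variable denotes the set with its own index.\<close>

definition term_model :: "(tm \<Rightarrow> 'a) \<Rightarrow> 'a str" where
  "term_model h = (let g = inv h in
    \<lparr>zer = h Zero, unt = h One,
     add = (\<lambda>x y. h (Add (g x) (g y))), mul = (\<lambda>x y. h (Mul (g x) (g y))),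
     less = (\<lambda>x y. Less (g x) (g y) \<in> H), sets = (\<lambda>X. {x. Mem (g x) X \<in> H})\<rparr>)"

context
  fixes h :: "tm \<Rightarrow> 'a"
  assumes h: "h s = h t \<longleftrightarrow> Eq s t \<in> H" and surj_h: "surj h"
begin

lemma Eq_inv: "Eq (inv h (h t)) t \<in> H"
  using h surj_h by (metis f_inv_into_f rangeI)

lemma tval_term_model: "tval (term_model h) (\<lambda>i. h (\<sigma> i)) t = h (tsub \<sigma> t)"
  by (induction t) (auto simp: term_model_def Let_def h intro: mem_Add mem_Mul Eq_inv)

text \<open>The truth lemma. Assignments are given as h composed with a substitution
  \<open>\<sigma>\<close>, so the quantifier step extends \<open>\<sigma>\<close> by a term instead
  of choosing representatives.\<close>

lemma sat_term_model: "sat (term_model h) (\<lambda>i. h (\<sigma> i)) \<rho> p \<longleftrightarrow> sub \<sigma> \<rho> p \<in> H"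
proof (induction p arbitrary: \<sigma> \<rho>)
  case Fls
  then show ?case by (simp add: consistent)
next
  case (Less s t)
  show ?case
    using mem_Less[of "inv h (h (tsub \<sigma> s))" "tsub \<sigma> s" "inv h (h (tsub \<sigma> t))" "tsub \<sigma> t"]
      mem_Less[of "tsub \<sigma> s" "inv h (h (tsub \<sigma> s))" "tsub \<sigma> t" "inv h (h (tsub \<sigma> t))"]
    by (auto simp: tval_term_model Eq_inv mem_sym)
      (auto simp: term_model_def Let_def)
next
  case (Mem t X)
  show ?case
    using mem_Mem[of "inv h (h (tsub \<sigma> t))" "tsub \<sigma> t"] mem_Mem[of "tsub \<sigma> t" "inv h (h (tsub \<sigma> t))"]
    by (auto simp: tval_term_model Eq_inv mem_sym)
      (auto simp: term_model_def Let_def)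
next
  case (AllN p)
  have c: "case_nat (h t) (\<lambda>i. h (\<sigma> i)) = (\<lambda>i. h (case_nat t \<sigma> i))" for t
    by (rule ext) (simp split: nat.split)
  have "sat (term_model h) (\<lambda>i. h (\<sigma> i)) \<rho> (AllN p) \<longleftrightarrow>
      (\<forall>t. sat (term_model h) (case_nat (h t) (\<lambda>i. h (\<sigma> i))) \<rho> p)"
    using surj_h by (metis sat.simps(6) surj_def)
  then show ?case by (simp add: c AllN mem_AllN instN_sub_upN)
qed (simp_all add: tval_term_model h mem_Imp mem_AllS instS_sub_upS)

end

end

section \<open>Arithmetic in models of \<open>RCA\<^sub>0\<close>\<close>

lemma bounded_fm_connectives:
  "bounded_fm p \<Longrightarrow> bounded_fm (Neg p)"
  "bounded_fm p \<Longrightarrow> bounded_fm q \<Longrightarrow> bounded_fm (Con p q)"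
  "bounded_fm p \<Longrightarrow> bounded_fm q \<Longrightarrow> bounded_fm (Dis p q)"
  by (auto simp: Neg_def Con_def Dis_def intro!: bounded_fm.intros)

text \<open>The nonnegative part of a discretely ordered ring, with the order determined by
  addition. The type class instance below draws on these laws.\<close>

definition arith_laws :: "'a str \<Rightarrow> bool" where
  "arith_laws M \<longleftrightarrow>
    (\<forall>x y z. add M (add M x y) z = add M x (add M y z)) \<and>
    (\<forall>x y. add M x y = add M y x) \<and>
    (\<forall>x. add M x (zer M) = x) \<and>
    (\<forall>x y z. add M x z = add M y z \<longrightarrow> x = y) \<and>
    (\<forall>x y z. mul M (mul M x y) z = mul M x (mul M y z)) \<and>
    (\<forall>x y. mul M x y = mul M y x) \<and>
    (\<forall>x. mul M x (unt M) = x) \<and>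
    (\<forall>x y z. mul M x (add M y z) = add M (mul M x y) (mul M x z)) \<and>
    (\<forall>x. mul M x (zer M) = zer M) \<and>
    (\<forall>x. add M x (unt M) \<noteq> zer M) \<and>
    (\<forall>x. x = zer M \<or> (\<exists>z. x = add M z (unt M))) \<and>
    (\<forall>x y. less M x y \<longleftrightarrow> (\<exists>z. y = add M x (add M z (unt M)))) \<and>
    (\<forall>x y. less M x y \<or> x = y \<or> less M y x)"

definition models_RCA0 :: "'a str \<Rightarrow> bool" where
  "models_RCA0 M \<longleftrightarrow> (\<forall>p\<in>RCA0. \<forall>e w. sat M e w p)"

text \<open>Convention for the matrix p: index 0 is the existential witness, index 1 the induction
  variable, and the parameters e start at index 2.\<close>

lemma models_induction:
  assumes "models_RCA0 M" "bounded_fm p"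
    and P: "\<And>x. P x \<longleftrightarrow> (\<exists>y. sat M (case_nat y (case_nat x e)) w p)"
    and "P (zer M)" "\<And>x. P x \<Longrightarrow> P (add M x (unt M))"
  shows "P x"
proof -
  have R: "uclosure (induction_ax (ExN p)) \<in> RCA0"
    using assms(2) unfolding RCA0_def Sigma01_def by blast
  have "sat M e w (induction_ax (ExN p))"
    by (rule sat_uclosure) (use R assms(1) in \<open>simp add: models_RCA0_def\<close>)
  note ax = this[unfolded induction_ax_def instN_def]
  have zero: "(\<lambda>i. tval M e (case_nat Zero Var i)) = case_nat (zer M) e"
    by (rule ext) (simp split: nat.split)
  have succ: "(\<lambda>i. tval M (case_nat x e) (case_nat (Add (Var 0) One) (\<lambda>i. Var (Suc i)) i)) =
      case_nat (add M x (unt M)) e" for x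
    by (rule ext) (simp split: nat.split)
  have "P (zer M) \<and> (\<forall>x. P x \<longrightarrow> P (add M x (unt M))) \<longrightarrow> (\<forall>x. P x)"
    using ax unfolding sat.simps(5,6) sat_connectives sat_sub zero succ P .
  then show ?thesis using assms(4,5) by blast
qed

lemma models_comprehension:
  assumes "models_RCA0 M" "bounded_fm p" "bounded_fm q"
    and "\<And>x. (\<exists>y. sat M (case_nat y (case_nat x e)) w p) \<longleftrightarrow>
      (\<forall>y. sat M (case_nat y (case_nat x e)) w q)"
  shows "\<exists>X. sets M X = {x. \<exists>y. sat M (case_nat y (case_nat x e)) w p}"
proof -
  have R: "uclosure (comprehension_ax (ExN p) (AllN q)) \<in> RCA0"
    using assms(2,3) unfolding RCA0_def Sigma01_def Pi01_def by blast
  have "sat M e w (comprehension_ax (ExN p) (AllN q))"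
    by (rule sat_uclosure) (use R assms(1) in \<open>simp add: models_RCA0_def\<close>)
  then have "\<exists>X. \<forall>x. x \<in> sets M X \<longleftrightarrow> (\<exists>y. sat M (case_nat y (case_nat x e)) w p)"
    unfolding comprehension_ax_def liftS_def sat.simps(5,6) sat_connectives sat_sub
    using assms(4) by simp
  then show ?thesis by blast
qed

section \<open>Ordered semiring laws from the basic axioms and induction\<close>

context
  fixes M :: "'a str" assumes M: "models_RCA0 M"
begin

private abbreviation zero' (\<open>\<zero>\<close>) where "\<zero> \<equiv> zer M"
private abbreviation one' (\<open>\<one>\<close>) where "\<one> \<equiv> unt M"
private abbreviation add' (infixl \<open>\<oplus>\<close> 65) where "x \<oplus> y \<equiv> add M x y"
private abbreviation mul' (infixl \<open>\<otimes>\<close> 70) where "x \<otimes> y \<equiv> mul M x y"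
private abbreviation less' (infix \<open>\<prec>\<close> 50) where "x \<prec> y \<equiv> less M x y"

private lemma basic:
  "x \<oplus> \<one> \<noteq> \<zero>"
  "x \<oplus> \<one> = y \<oplus> \<one> \<Longrightarrow> x = y"
  "x \<oplus> \<zero> = x"
  "x \<oplus> (y \<oplus> \<one>) = (x \<oplus> y) \<oplus> \<one>"
  "x \<otimes> \<zero> = \<zero>"
  "x \<otimes> (y \<oplus> \<one>) = (x \<otimes> y) \<oplus> x"
  "\<not> x \<prec> \<zero>"
  "x \<prec> y \<oplus> \<one> \<longleftrightarrow> x \<prec> y \<or> x = y"
proof -
  have "\<forall>p\<in>basic_axioms. sat M (\<lambda>_. \<zero>) (\<lambda>_. 0) p"
    using M by (auto simp: models_RCA0_def RCA0_def)
  note * = this[unfolded basic_axioms_def sentence_def nallN_def nneg_def neq_def nadd_def nmul_def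
      nzero_def nunit_def nimp_def niff_def ndis_def nless_def, simplified]
  show "x \<oplus> \<one> \<noteq> \<zero>"
    "x \<oplus> \<one> = y \<oplus> \<one> \<Longrightarrow> x = y"
    "x \<oplus> \<zero> = x"
    "x \<oplus> (y \<oplus> \<one>) = (x \<oplus> y) \<oplus> \<one>"
    "x \<otimes> \<zero> = \<zero>"
    "x \<otimes> (y \<oplus> \<one>) = (x \<otimes> y) \<oplus> x"
    "\<not> x \<prec> \<zero>"
    "x \<prec> y \<oplus> \<one> \<longleftrightarrow> x \<prec> y \<or> x = y"
    using * by blast+
qed

private lemmas induct_fm = models_induction[OF M, where w = "\<lambda>_. 0"]
private lemmas bounded_intros = bounded_fm.intros(1-5) bounded_fm_connectives

text \<open>The predecessor is the existential witness of the induction formula, hence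
  \<open>Var 0\<close>.\<close>

private lemma zero_or_succ: "x = \<zero> \<or> (\<exists>z. x = z \<oplus> \<one>)"
  by (rule induct_fm[where p = "Dis (Eq (Var 1) Zero) (Eq (Var 1) (Add (Var 0) One))"
        and e = "\<lambda>_. \<zero>"])
    (auto intro: bounded_intros)

private lemma add_0_left: "\<zero> \<oplus> x = x"
  by (rule induct_fm[where p = "Eq (Add Zero (Var 1)) (Var 1)" and e = "\<lambda>_. \<zero>"])
    (auto intro: bounded_intros simp: basic(3,4))

private lemma add_1_left: "(x \<oplus> \<one>) \<oplus> y = (x \<oplus> y) \<oplus> \<one>"
  by (rule induct_fm[where p = "Eq (Add (Add (Var 2) One) (Var 1)) (Add (Add (Var 2) (Var 1)) One)"
        and e = "\<lambda>_. x"])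
    (auto intro: bounded_intros simp: basic(3,4) numeral_2_eq_2)

private lemma add_comm: "x \<oplus> y = y \<oplus> x"
  by (rule induct_fm[where p = "Eq (Add (Var 2) (Var 1)) (Add (Var 1) (Var 2))" and e = "\<lambda>_. x"])
    (auto intro: bounded_intros simp: basic(3,4) numeral_2_eq_2 add_0_left add_1_left)

private lemma add_assoc: "(x \<oplus> y) \<oplus> z = x \<oplus> (y \<oplus> z)"
  by (rule induct_fm[where p = "Eq (Add (Add (Var 2) (Var 3)) (Var 1)) (Add (Var 2) (Add (Var 3) (Var 1)))"
        and e = "case_nat x (\<lambda>_. y)"])
    (auto intro: bounded_intros simp: basic(3,4) numeral_2_eq_2 numeral_3_eq_3)

private lemma add_cancel: "x \<oplus> z = y \<oplus> z \<Longrightarrow> x = y"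
proof -
  have "x \<oplus> z = y \<oplus> z \<longrightarrow> x = y"
    by (rule induct_fm[where p = "Imp (Eq (Add (Var 2) (Var 1)) (Add (Var 3) (Var 1))) (Eq (Var 2) (Var 3))"
          and e = "case_nat x (\<lambda>_. y)"])
      (auto intro: bounded_intros simp: basic(3,4) numeral_2_eq_2 numeral_3_eq_3 dest: basic(2))
  then show "x \<oplus> z = y \<oplus> z \<Longrightarrow> x = y" by blast
qed

private lemma add_left_comm: "x \<oplus> (y \<oplus> z) = y \<oplus> (x \<oplus> z)"
  by (metis add_assoc add_comm)

private lemma mul_0_left: "\<zero> \<otimes> x = \<zero>"
  by (rule induct_fm[where p = "Eq (Mul Zero (Var 1)) Zero" and e = "\<lambda>_. \<zero>"])
    (auto intro: bounded_intros simp: basic(3,5,6))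

private lemma mul_1_left: "(x \<oplus> \<one>) \<otimes> y = (x \<otimes> y) \<oplus> y"
  by (rule induct_fm[where p = "Eq (Mul (Add (Var 2) One) (Var 1)) (Add (Mul (Var 2) (Var 1)) (Var 1))"
        and e = "\<lambda>_. x"])
    (auto intro: bounded_intros simp: basic(3,5,6) numeral_2_eq_2 add_assoc add_left_comm)

private lemma mul_comm: "x \<otimes> y = y \<otimes> x"
  by (rule induct_fm[where p = "Eq (Mul (Var 2) (Var 1)) (Mul (Var 1) (Var 2))" and e = "\<lambda>_. x"])
    (auto intro: bounded_intros simp: basic(5,6) numeral_2_eq_2 mul_0_left mul_1_left)

private lemma mul_add_1: "x \<otimes> (y \<oplus> (z \<oplus> \<one>)) = x \<otimes> (y \<oplus> z) \<oplus> x"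
  unfolding basic(4) basic(6) ..

private lemma distrib: "x \<otimes> (y \<oplus> z) = x \<otimes> y \<oplus> x \<otimes> z"
  by (rule induct_fm[where p = "Eq (Mul (Var 2) (Add (Var 3) (Var 1)))
        (Add (Mul (Var 2) (Var 3)) (Mul (Var 2) (Var 1)))" and e = "case_nat x (\<lambda>_. y)"])
    (auto intro: bounded_intros simp: basic(3,5,6) mul_add_1 numeral_2_eq_2 numeral_3_eq_3 add_assoc)

private lemma mul_1: "x \<otimes> \<one> = x"
  using basic(6)[of x \<zero>] by (simp add: add_0_left basic(5))

private lemma mul_assoc: "(x \<otimes> y) \<otimes> z = x \<otimes> (y \<otimes> z)"
  by (rule induct_fm[where p = "Eq (Mul (Mul (Var 2) (Var 3)) (Var 1)) (Mul (Var 2) (Mul (Var 3) (Var 1)))"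
        and e = "case_nat x (\<lambda>_. y)"
        and P = "\<lambda>z. (x \<otimes> y) \<otimes> z = x \<otimes> (y \<otimes> z)"])
    (auto intro: bounded_intros simp: basic(5,6) numeral_2_eq_2 numeral_3_eq_3 distrib mul_1)

text \<open>The difference is produced as witness in a Sigma^0_1 induction on y; where the order
  starts to hold, at y = x + 1, the witness z is 0.\<close>

private lemma less_imp_add: "\<exists>z. x \<prec> y \<longrightarrow> y = x \<oplus> (z \<oplus> \<one>)"
proof (rule induct_fm[where p = "Imp (Less (Var 2) (Var 1)) (Eq (Var 1) (Add (Var 2) (Add (Var 0) One)))"
        and e = "\<lambda>_. x" and P = "\<lambda>y. \<exists>z. x \<prec> y \<longrightarrow> y = x \<oplus> (z \<oplus> \<one>)"])
  show "\<exists>z. x \<prec> y \<oplus> \<one> \<longrightarrow> y \<oplus> \<one> = x \<oplus> (z \<oplus> \<one>)"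
    if "\<exists>z. x \<prec> y \<longrightarrow> y = x \<oplus> (z \<oplus> \<one>)" for y
    using that add_0_left add_assoc[of x _ \<one>] unfolding basic(8) by metis
qed (auto intro: bounded_intros simp: basic(7) numeral_2_eq_2)

private lemma less_add: "x \<prec> x \<oplus> (z \<oplus> \<one>)"
  by (rule induct_fm[where p = "Less (Var 2) (Add (Var 2) (Add (Var 1) One))" and e = "\<lambda>_. x"])
    (auto intro: bounded_intros simp: basic(4,8) numeral_2_eq_2 add_0_left)

private lemma less_iff: "x \<prec> y \<longleftrightarrow> (\<exists>z. y = x \<oplus> (z \<oplus> \<one>))"
  using less_imp_add less_add by blast

private lemma trichotomy: "x \<prec> y \<or> x = y \<or> y \<prec> x"
proof (rule induct_fm[where p = "Dis (Less (Var 2) (Var 1)) (Dis (Eq (Var 2) (Var 1)) (Less (Var 1) (Var 2)))"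
        and e = "\<lambda>_. x" and P = "\<lambda>y. x \<prec> y \<or> x = y \<or> y \<prec> x"])
  show "x \<prec> \<zero> \<or> x = \<zero> \<or> \<zero> \<prec> x"
  proof (cases "x = \<zero>")
    case False
    then obtain z where "x = z \<oplus> \<one>" using zero_or_succ by blast
    then have "\<zero> \<prec> x" using less_add[of \<zero> z] by (simp add: add_0_left)
    then show ?thesis by blast
  qed simp
  have "y \<oplus> \<one> \<prec> x \<or> x = y \<oplus> \<one>" if yx: "y \<prec> x" for y
  proof -
    obtain z where z: "x = y \<oplus> (z \<oplus> \<one>)" using yx less_imp_add by blast
    show ?thesis
    proof (cases "z = \<zero>")
      case True
      then show ?thesis using z by (simp add: add_0_left)
    next
      case False
      then obtain u where "z = u \<oplus> \<one>" using zero_or_succ by blast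
      then have "x = (y \<oplus> \<one>) \<oplus> (u \<oplus> \<one>)" using z by (simp add: add_assoc add_left_comm)
      then show ?thesis using less_add[of "y \<oplus> \<one>" u] by simp
    qed
  qed
  then show "x \<prec> y \<oplus> \<one> \<or> x = y \<oplus> \<one> \<or> y \<oplus> \<one> \<prec> x" if "x \<prec> y \<or> x = y \<or> y \<prec> x" for y
    using that by (auto simp: basic(8))
qed (auto intro: bounded_intros simp: numeral_2_eq_2)

lemma models_RCA0_arith_laws: "arith_laws M"
  unfolding arith_laws_def
  using basic(1,3,5) add_assoc add_comm add_cancel mul_assoc mul_comm distrib zero_or_succ less_iff
    trichotomy mul_1_left[of \<zero>]
  by (simp add: add_0_left mul_0_left)

end

section \<open>A fixed model as a type class instance\<close>

text \<open>
  A type class instance cannot depend on a local assumption, so a countermodel (if there is one) on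
  a copy of the natural numbers is fixed once and for all.
\<close>

typedef mnum = "UNIV :: nat set" ..

class arith = discrete_linordered_semidom + ordered_cancel_comm_monoid_diff

definition arith_str :: "(nat \<Rightarrow> 'a::arith set) \<Rightarrow> 'a str" where
  "arith_str S = \<lparr>zer = 0, unt = 1, add = (+), mul = (*), less = (<), sets = S\<rparr>"

text \<open>The instance needs the laws for \<open>the_model\<close> unconditionally; the standard
  numbers supply them in case no countermodel exists.\<close>

lemma arith_laws_mnum: "\<exists>M :: mnum str. arith_laws M"
proof -
  let ?A = Abs_mnum and ?R = Rep_mnum
  let ?M = "\<lparr>zer = ?A 0, unt = ?A 1, add = \<lambda>x y. ?A (?R x + ?R y), mul = \<lambda>x y. ?A (?R x * ?R y),
    less = \<lambda>x y. ?R x < ?R y, sets = \<lambda>_. {}\<rparr>"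
  have [simp]: "?R (?A n) = n" for n by (simp add: Abs_mnum_inverse)
  have [simp]: "?A n = ?A m \<longleftrightarrow> n = m" for n m by (simp add: Abs_mnum_inject)
  have [simp]: "?A n = x \<longleftrightarrow> n = ?R x" "x = ?A n \<longleftrightarrow> ?R x = n" for n x
    by (auto simp: Rep_mnum_inverse)
  have ex: "(\<exists>x. P (?R x)) \<longleftrightarrow> (\<exists>n. P n)" for P
    by (metis \<open>\<And>n. ?R (?A n) = n\<close>)
  have "(\<exists>z. ?R y = ?R x + (?R z + 1)) \<longleftrightarrow> ?R x < ?R y" for x y
    unfolding ex[of "\<lambda>z. ?R y = ?R x + (z + 1)"] by presburger
  moreover have "?R x = 0 \<or> (\<exists>z. ?R x = ?R z + 1)" for x
    unfolding ex[of "\<lambda>z. ?R x = z + 1"] by presburger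
  moreover have "?R x < ?R y \<or> x = y \<or> ?R y < ?R x" for x y
    using Rep_mnum_inject by (metis linorder_neqE_nat)
  ultimately have "arith_laws ?M"
    by (simp add: arith_laws_def Rep_mnum_inject algebra_simps Rep_mnum_inverse)
  then show ?thesis by blast
qed

definition countermodel :: "fm \<Rightarrow> mnum str \<Rightarrow> bool" where
  "countermodel p M \<longleftrightarrow> models_RCA0 M \<and> \<not> (\<forall>e w. sat M e w p)"

definition the_model :: "mnum str" where
  "the_model = (SOME M. arith_laws M \<and>
    (Ex (countermodel (sentence (RT_exactly_large \<^bold>\<longrightarrow> omega_jumps_exist))) \<longrightarrow>
      countermodel (sentence (RT_exactly_large \<^bold>\<longrightarrow> omega_jumps_exist)) M))"

lemma the_model:
  "arith_laws the_model"
  "countermodel (sentence (RT_exactly_large \<^bold>\<longrightarrow> omega_jumps_exist)) M \<Longrightarrow>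
    countermodel (sentence (RT_exactly_large \<^bold>\<longrightarrow> omega_jumps_exist)) the_model"
proof -
  let ?c = "countermodel (sentence (RT_exactly_large \<^bold>\<longrightarrow> omega_jumps_exist))"
  have "\<exists>M. arith_laws M \<and> (Ex ?c \<longrightarrow> ?c M)"
    using arith_laws_mnum models_RCA0_arith_laws by (metis countermodel_def)
  then have "arith_laws the_model \<and> (Ex ?c \<longrightarrow> ?c the_model)"
    unfolding the_model_def by (rule someI_ex)
  then show "arith_laws the_model" "?c M \<Longrightarrow> ?c the_model" by blast+
qed

instantiation mnum :: arith
begin

definition "0 = zer the_model"
definition "1 = unt the_model"
definition "x + y = add the_model x y"
definition "x * y = mul the_model x y"
definition "(x::mnum) < y \<longleftrightarrow> less the_model x y"
definition "(x::mnum) \<le> y \<longleftrightarrow> x = y \<or> less the_model x y"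
definition "(x::mnum) - y = (if y \<le> x then THE z. y + z = x else 0)"

lemma the_model_laws:
  fixes x y z :: mnum
  shows "(x + y) + z = x + (y + z)" "x + y = y + x" "x + 0 = x" "x + z = y + z \<Longrightarrow> x = y"
    "(x * y) * z = x * (y * z)" "x * y = y * x" "x * 1 = x" "x * (y + z) = x * y + x * z"
    "x * 0 = 0" "x + 1 \<noteq> 0" "x = 0 \<or> (\<exists>z. x = z + 1)"
    "x < y \<longleftrightarrow> (\<exists>z. y = x + (z + 1))" "x < y \<or> x = y \<or> y < x"
  using the_model(1) unfolding arith_laws_def zero_mnum_def one_mnum_def plus_mnum_def
    times_mnum_def less_mnum_def by metis+

lemma le_mnum_iff: "(x::mnum) \<le> y \<longleftrightarrow> (\<exists>z. y = x + z)"
  unfolding less_eq_mnum_def less_mnum_def[symmetric] the_model_laws(12)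
  using the_model_laws(3,11) by metis

lemma add_left_cancel_mnum: "(x::mnum) + y = x + z \<longleftrightarrow> y = z"
  by (metis the_model_laws(2,4))

lemma diff_add_mnum: "(x::mnum) + z - x = z"
proof -
  have "x \<le> x + z" using le_mnum_iff by blast
  then show ?thesis by (simp add: minus_mnum_def add_left_cancel_mnum)
qed

lemma add_eq_0_mnum: "(x::mnum) + y = 0 \<longleftrightarrow> x = 0 \<and> y = 0"
  by (metis the_model_laws(1,3,10,11))

lemma diff_not_le_mnum: "\<not> (y::mnum) \<le> x \<Longrightarrow> x - y = 0"
  by (simp add: minus_mnum_def)

lemma less_le_not_le_mnum: "(x::mnum) < y \<longleftrightarrow> x \<le> y \<and> \<not> y \<le> x"
  unfolding le_mnum_iff the_model_laws(12)
  by (metis add_left_cancel_mnum the_model_laws(1,3,10,11))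

lemma linear_mnum: "(x::mnum) \<le> y \<or> y \<le> x"
  using the_model_laws(13)[of x y] by (auto simp: less_eq_mnum_def less_mnum_def)

lemma diff_diff_mnum: "(a::mnum) - b - c = a - (b + c)"
proof (cases "b + c \<le> a")
  case True
  then show ?thesis by (metis diff_add_mnum le_mnum_iff the_model_laws(1))
next
  case False
  have "a - b - c = 0"
  proof (cases "b \<le> a")
    case True
    then obtain d where d: "a = b + d" using le_mnum_iff by blast
    then have "\<not> c \<le> d" using False by (metis le_mnum_iff the_model_laws(1))
    then show ?thesis using d by (simp add: diff_add_mnum diff_not_le_mnum)
  next
    case False
    then have "a - b = 0" by (rule diff_not_le_mnum)
    then show ?thesis
      by (metis add_eq_0_mnum diff_add_mnum diff_not_le_mnum le_mnum_iff)
  qed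
  then show ?thesis using False by (simp add: diff_not_le_mnum)
qed

instance
proof
  fix a b c d :: mnum
  show "a + b + c = a + (b + c)" "a + b = b + a" "a * b * c = a * (b * c)" "a * b = b * a"
    "0 + a = a" "1 * a = a"
    by (metis the_model_laws(1-7))+
  show "(a + b) * c = a * c + b * c" by (metis the_model_laws(6,8))
  show "a + b - a = b" by (rule diff_add_mnum)
  show "a - b - c = a - (b + c)" by (rule diff_diff_mnum)
  show "0 * a = 0" "a * 0 = 0" by (metis the_model_laws(6,9))+
  show "(0::mnum) \<noteq> 1" by (metis the_model_laws(2,3,10))
  show "0 - a = 0"
  proof (cases "a \<le> 0")
    case True
    then have "a = 0" by (metis add_eq_0_mnum le_mnum_iff)
    then show ?thesis by (metis diff_add_mnum the_model_laws(3))
  qed (rule diff_not_le_mnum)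
  show "a * (b - c) = a * b - a * c"
  proof (cases "c \<le> b")
    case True
    then obtain d where "b = c + d" using le_mnum_iff by blast
    then show ?thesis by (simp add: diff_add_mnum the_model_laws(8))
  next
    case False
    then obtain d where d: "c = b + (d + 1)"
      using linear_mnum less_le_not_le_mnum the_model_laws(12) by metis
    have "a * b - (a * b + e) = 0" for e
    proof (cases "a * b + e \<le> a * b")
      case True
      then obtain f where "a * b = a * b + (e + f)" by (metis le_mnum_iff the_model_laws(1))
      then have "e = 0" by (metis add_eq_0_mnum add_left_cancel_mnum the_model_laws(3))
      then show ?thesis by (metis diff_add_mnum the_model_laws(3))
    qed (rule diff_not_le_mnum)
    then have "a * b - a * c = 0" by (simp add: d the_model_laws(8))
    moreover have "b - c = 0" using False by (rule diff_not_le_mnum)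
    ultimately show ?thesis by (simp add: the_model_laws(9))
  qed
  show nz: "a * b \<noteq> 0" if "a \<noteq> 0" "b \<noteq> 0"
    using that by (metis add_eq_0_mnum the_model_laws(7,8,11))
  show "a < b \<longleftrightarrow> a \<le> b \<and> \<not> b \<le> a" by (rule less_le_not_le_mnum)
  show "a \<le> a" by (simp add: less_eq_mnum_def)
  show "a \<le> b \<Longrightarrow> b \<le> c \<Longrightarrow> a \<le> c" by (metis le_mnum_iff the_model_laws(1))
  show "a \<le> b \<Longrightarrow> b \<le> a \<Longrightarrow> a = b"
    by (metis less_eq_mnum_def less_le_not_le_mnum less_mnum_def)
  show "a \<le> b \<or> b \<le> a" by (rule linear_mnum)
  show "a \<le> b \<longleftrightarrow> (\<exists>c. b = a + c)" by (rule le_mnum_iff)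
  show "a \<le> b \<Longrightarrow> c + a \<le> c + b" by (metis le_mnum_iff the_model_laws(1,2))
  show "a < b \<Longrightarrow> 0 < c \<Longrightarrow> c * a < c * b"
  proof -
    assume "a < b" "0 < c"
    then obtain x y where "b = a + (x + 1)" "c = y + 1"
      using the_model_laws(12) by (metis the_model_laws(2,3))
    then have "c * b = c * a + ((c * x + y) + 1)" by (simp add: the_model_laws(1,7,8))
    then show ?thesis unfolding the_model_laws(12) by blast
  qed
  show "(0::mnum) < 1" unfolding the_model_laws(12) by (metis the_model_laws(2,3))
  show "a \<le> b \<Longrightarrow> b - a + a = b" by (metis diff_add_mnum le_mnum_iff the_model_laws(2))
  show "a < b \<longleftrightarrow> a + 1 \<le> b"
    unfolding the_model_laws(12) le_mnum_iff by (metis the_model_laws(1,2))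
  show "c + a \<le> c + b \<Longrightarrow> a \<le> b"
    unfolding le_mnum_iff the_model_laws(1) add_left_cancel_mnum .
  show "a * (b + c) = a * b + a * c" by (rule the_model_laws(8))
qed

end

text \<open>Brings the chosen structure into the form over which the locale \<open>rca\<close> is
  stated, with the operations of the type class.\<close>

lemma the_model_eq: "the_model = arith_str (sets the_model)"
  by (simp add: arith_str_def zero_mnum_def one_mnum_def plus_mnum_def[abs_def]
      times_mnum_def[abs_def] less_mnum_def[abs_def])

section \<open>Pairs\<close>

context arith
begin

definition pair :: "'a \<Rightarrow> 'a \<Rightarrow> 'a" where
  "pair x y = (x + y) * (x + y) + x"

text \<open>Pairing is not surjective: the codes of pairs with sum s fill only the numbers from s *
  s to s * s + s. The default 0 makes the projections total, as the coding of binary predicates by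
  unary ones requires.\<close>

definition pfst :: "'a \<Rightarrow> 'a" where
  "pfst z = (if \<exists>x y. z = pair x y then THE x. \<exists>y. z = pair x y else 0)"

definition psnd :: "'a \<Rightarrow> 'a" where
  "psnd z = (if \<exists>x y. z = pair x y then THE y. \<exists>x. z = pair x y else 0)"

end

lemma less_succ_iff [simp]: "(x::'a::arith) < y + 1 \<longleftrightarrow> x \<le> y"
  by (simp add: less_iff_succ_less_eq)

lemma succ_le_iff [simp]: "(x::'a::arith) + 1 \<le> y \<longleftrightarrow> x < y"
  by (simp add: less_iff_succ_less_eq)

lemma one_le_iff [simp]: "1 \<le> (x::'a::arith) \<longleftrightarrow> x \<noteq> 0"
  using succ_le_iff[of 0 x] by (simp add: zero_less_iff_neq_zero del: succ_le_iff)

lemma mult_le_self: "(y::'a::arith) \<noteq> 0 \<Longrightarrow> x \<le> x * y"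
  using mult_left_mono[of 1 y x] by simp

lemma le_square: "(x::'a::arith) \<le> x * x"
  by (cases "x = 0") (auto intro: mult_le_self)

text \<open>By discreteness a < b already forces 2 * a + 2 <= 2 * b. Parity will let the last binary
  digit of a number be read off.\<close>

lemma arith_parity: "2 * a + 1 \<noteq> 2 * (b::'a::arith)"
proof
  assume eq: "2 * a + 1 = 2 * b"
  show False
  proof (cases "a < b")
    case True
    then have "2 * (a + 1) \<le> 2 * b" by (intro mult_left_mono) auto
    then have "2 * a + (1 + 1) \<le> 2 * a + 1" unfolding eq by (simp add: algebra_simps)
    then show False by (simp only: add_le_cancel_left) simp
  next
    case False
    then have "2 * b \<le> 2 * a" by (intro mult_left_mono) auto
    then show False unfolding eq[symmetric] by simp
  qed
qed

lemma less_add_nonzero: "x \<le> y \<Longrightarrow> z \<noteq> 0 \<Longrightarrow> x < y + (z::'a::arith)"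
  by (erule le_less_trans) (simp add: zero_less_iff_neq_zero)

lemma double_le_iff [simp]: "2 * a \<le> 2 * b \<longleftrightarrow> a \<le> (b::'a::arith)"
proof
  show "2 * a \<le> 2 * b" if "a \<le> b" using that by (intro mult_left_mono) simp_all
  show "a \<le> b" if "2 * a \<le> 2 * b"
  proof (rule ccontr)
    assume "\<not> a \<le> b"
    then have "2 * b < 2 * a" by (intro mult_strict_left_mono) simp_all
    then show False using that by simp
  qed
qed

lemma double_eq_iff [simp]: "2 * a = 2 * b \<longleftrightarrow> a = (b::'a::arith)"
  by (metis double_le_iff order.antisym order.refl)

lemma pair_ge: "(x::'a::arith) \<le> pair x y" "y \<le> pair x y"
proof -
  show "x \<le> pair x y" by (simp add: pair_def)
  have "y \<le> x + y" by simp
  also have "\<dots> \<le> (x + y) * (x + y)" by (rule le_square)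
  also have "\<dots> \<le> pair x y" by (simp add: pair_def)
  finally show "y \<le> pair x y" .
qed

text \<open>The code of a pair with sum s lies between s * s and s * s + s, hence below the next
  square.\<close>

lemma pair_sum_less:
  assumes "x + y < x' + (y'::'a::arith)"
  shows "pair x y < pair x' y'"
proof -
  let ?s = "x + y"
  have "pair x y \<le> ?s * ?s + ?s" by (simp add: pair_def)
  also have "\<dots> \<le> ?s * ?s + ?s + ?s" by simp
  also have "\<dots> < (?s + 1) * (?s + 1)" by (simp add: algebra_simps add_strict_increasing)
  also have "\<dots> \<le> (x' + y') * (x' + y')" using assms by (intro mult_mono) auto
  also have "\<dots> \<le> pair x' y'" by (simp add: pair_def)
  finally show ?thesis .
qed

lemma pair_inject [simp]: "pair x y = pair x' (y'::'a::arith) \<longleftrightarrow> x = x' \<and> y = y'"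
proof
  assume eq: "pair x y = pair x' y'"
  then have s: "x + y = x' + y'"
    using pair_sum_less[of x y x' y'] pair_sum_less[of x' y' x y] by (metis less_irrefl linorder_cases)
  then have "x = x'" using eq by (simp add: pair_def)
  then show "x = x' \<and> y = y'" using s by simp
qed simp

lemma pfst_pair [simp]: "pfst (pair x (y::'a::arith)) = x"
  by (auto simp: pfst_def)

lemma psnd_pair [simp]: "psnd (pair x (y::'a::arith)) = y"
  by (auto simp: psnd_def)

lemma not_pair: "\<not> (\<exists>x y. z = pair x (y::'a::arith)) \<Longrightarrow> pfst z = 0 \<and> psnd z = 0"
  by (simp add: pfst_def psnd_def)

lemma pair_exhaust:
  obtains (pair) x y where "z = pair x y" "pfst z = x" "psnd z = (y::'a::arith)"
  | (junk) "\<And>x y. z \<noteq> pair x y" "pfst z = 0" "psnd z = 0"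
  using not_pair[of z] by (metis pfst_pair psnd_pair)


section \<open>Decidable and recursively enumerable predicates\<close>

text \<open>
  A predicate \<open>P y x\<close> with parameter \<open>x\<close> is treated as the unary predicate
  \<open>\<lambda>z. P (pfst z) (psnd z)\<close>. With this convention the rules in \<open>eff\<close> prove effectiveness
  by structural decomposition, also under binders.
\<close>

named_theorems eff

locale rca =
  fixes S :: "nat \<Rightarrow> 'a::arith set"
  assumes models: "models_RCA0 (arith_str S)"
begin

abbreviation sats :: "(nat \<Rightarrow> 'a) \<Rightarrow> fm \<Rightarrow> bool" where
  "sats e p \<equiv> sat (arith_str S) e (\<lambda>X. X) p"

definition tdef :: "((nat \<Rightarrow> 'a) \<Rightarrow> 'a) \<Rightarrow> bool" where
  "tdef f \<longleftrightarrow> (\<exists>t. \<forall>e. f e = tval (arith_str S) e t)"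

text \<open>A semantic notion of definability, closed under rules that build the de Bruijn formula
  silently. Set variable X denotes \<open>S X\<close> here, so every set of the model may occur as a
  parameter.\<close>

definition bdef :: "((nat \<Rightarrow> 'a) \<Rightarrow> bool) \<Rightarrow> bool" where
  "bdef P \<longleftrightarrow> (\<exists>p. bounded_fm p \<and> (\<forall>e. P e \<longleftrightarrow> sats e p))"

lemma tdefI: "(\<And>e. f e = tval (arith_str S) e t) \<Longrightarrow> tdef f"
  unfolding tdef_def by blast

lemma bdefI: "bounded_fm p \<Longrightarrow> (\<And>e. P e \<longleftrightarrow> sats e p) \<Longrightarrow> bdef P"
  unfolding bdef_def by blast

lemma tdef_var: "tdef (\<lambda>e. e i)"
  by (rule tdefI[of _ "Var i"]) simp

lemma tdef_0: "tdef (\<lambda>e. 0)"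
  by (rule tdefI[of _ Zero]) (simp add: arith_str_def)

lemma tdef_1: "tdef (\<lambda>e. 1)"
  by (rule tdefI[of _ One]) (simp add: arith_str_def)

lemma tdef_add:
  assumes "tdef f" "tdef g" shows "tdef (\<lambda>e. f e + g e)"
proof -
  obtain s t where "\<forall>e. f e = tval (arith_str S) e s" "\<forall>e. g e = tval (arith_str S) e t"
    using assms unfolding tdef_def by blast
  then show ?thesis by (intro tdefI[of _ "Add s t"]) (simp add: arith_str_def)
qed

lemma tdef_mul:
  assumes "tdef f" "tdef g" shows "tdef (\<lambda>e. f e * g e)"
proof -
  obtain s t where "\<forall>e. f e = tval (arith_str S) e s" "\<forall>e. g e = tval (arith_str S) e t"
    using assms unfolding tdef_def by blast
  then show ?thesis by (intro tdefI[of _ "Mul s t"]) (simp add: arith_str_def)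
qed

lemma tdef_pair: "tdef f \<Longrightarrow> tdef g \<Longrightarrow> tdef (\<lambda>e. pair (f e) (g e))"
  unfolding pair_def by (intro tdef_add tdef_mul)

lemma bdef_eq:
  assumes "tdef f" "tdef g" shows "bdef (\<lambda>e. f e = g e)"
proof -
  obtain s t where "\<forall>e. f e = tval (arith_str S) e s" "\<forall>e. g e = tval (arith_str S) e t"
    using assms unfolding tdef_def by blast
  then show ?thesis by (intro bdefI[of "Eq s t"]) (auto intro: bounded_fm.intros)
qed

lemma bdef_less:
  assumes "tdef f" "tdef g" shows "bdef (\<lambda>e. f e < g e)"
proof -
  obtain s t where "\<forall>e. f e = tval (arith_str S) e s" "\<forall>e. g e = tval (arith_str S) e t"
    using assms unfolding tdef_def by blast
  then show ?thesis
    by (intro bdefI[of "Less s t"]) (auto intro: bounded_fm.intros simp: arith_str_def)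
qed

lemma bdef_mem:
  assumes "X \<in> range S" "tdef f" shows "bdef (\<lambda>e. f e \<in> X)"
proof -
  obtain t i where "\<forall>e. f e = tval (arith_str S) e t" "X = S i"
    using assms unfolding tdef_def by blast
  then show ?thesis
    by (intro bdefI[of "Mem t i"]) (auto intro: bounded_fm.intros simp: arith_str_def)
qed

lemma bdef_imp:
  assumes "bdef P" "bdef Q" shows "bdef (\<lambda>e. P e \<longrightarrow> Q e)"
proof -
  obtain p q where "bounded_fm p" "\<forall>e. P e \<longleftrightarrow> sats e p" "bounded_fm q" "\<forall>e. Q e \<longleftrightarrow> sats e q"
    using assms unfolding bdef_def by blast
  then show ?thesis by (intro bdefI[of "Imp p q"]) (auto intro: bounded_fm.intros)
qed

lemma bdef_not: "bdef P \<Longrightarrow> bdef (\<lambda>e. \<not> P e)"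
  using bdef_imp[of P "\<lambda>e. False"] bdefI[of Fls "\<lambda>e. False"] by (simp add: bounded_fm.intros)

lemma bdef_conj: "bdef P \<Longrightarrow> bdef Q \<Longrightarrow> bdef (\<lambda>e. P e \<and> Q e)"
  using bdef_not[OF bdef_imp[of P "\<lambda>e. \<not> Q e"]] bdef_not[of Q] by simp

lemma bdef_disj: "bdef P \<Longrightarrow> bdef Q \<Longrightarrow> bdef (\<lambda>e. P e \<or> Q e)"
  using bdef_imp[of "\<lambda>e. \<not> P e" Q] bdef_not[of P] by (simp add: disj_imp)

lemma bdef_ball:
  assumes "tdef f" "bdef (\<lambda>e. P (e 0) (\<lambda>i. e (Suc i)))"
  shows "bdef (\<lambda>e. \<forall>x<f e. P x e)"
proof -
  obtain t where t: "\<forall>e. f e = tval (arith_str S) e t" using assms(1) unfolding tdef_def by blast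
  obtain p where p: "bounded_fm p" "\<forall>e. P (e 0) (\<lambda>i. e (Suc i)) \<longleftrightarrow> sats e p"
    using assms(2) unfolding bdef_def by blast
  have "P x e \<longleftrightarrow> sats (case_nat x e) p" for x e
    using p(2)[rule_format, of "case_nat x e"] by simp
  then show ?thesis
    using p(1) t by (intro bdefI[of "AllN (Imp (Less (Var 0) (tlift t)) p)"])
      (auto intro: bounded_fm.intros simp: arith_str_def tval_tlift[of "arith_str S", unfolded arith_str_def])
qed

lemma bdef_bex:
  assumes "tdef f" "bdef (\<lambda>e. P (e 0) (\<lambda>i. e (Suc i)))"
  shows "bdef (\<lambda>e. \<exists>x<f e. P x e)"
  using bdef_not[OF bdef_ball[of f "\<lambda>x e. \<not> P x e"]] bdef_not[OF assms(2)] assms(1) by simp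

lemma bdef_ball_le: "tdef f \<Longrightarrow> bdef (\<lambda>e. P (e 0) (\<lambda>i. e (Suc i))) \<Longrightarrow> bdef (\<lambda>e. \<forall>x\<le>f e. P x e)"
  using bdef_ball[of "\<lambda>e. f e + 1" P] by (simp add: tdef_add tdef_1)

lemma bdef_bex_le: "tdef f \<Longrightarrow> bdef (\<lambda>e. P (e 0) (\<lambda>i. e (Suc i))) \<Longrightarrow> bdef (\<lambda>e. \<exists>x\<le>f e. P x e)"
  using bdef_bex[of "\<lambda>e. f e + 1" P] by (simp add: tdef_add tdef_1)

lemmas bdefs = tdef_0 tdef_1 tdef_var tdef_pair tdef_add tdef_mul bdef_ball bdef_bex bdef_ball_le
  bdef_bex_le bdef_eq bdef_less bdef_not bdef_conj bdef_disj bdef_imp bdef_mem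

text \<open>Index 0 is the unbounded quantifier, index 1 the element and index 2 the number
  parameter c. The third premise says that the set is Delta^0_1.\<close>

lemma comprehension:
  assumes "bdef (\<lambda>e. P (e 0) (e 1) (e 2))" "bdef (\<lambda>e. Q (e 0) (e 1) (e 2))"
    and "\<And>x. (\<exists>y. P y x c) \<longleftrightarrow> (\<forall>y. Q y x c)"
  shows "{x. \<exists>y. P y x c} \<in> range S"
proof -
  obtain p q where p: "bounded_fm p" "\<forall>e. P (e 0) (e 1) (e 2) \<longleftrightarrow> sats e p"
    and q: "bounded_fm q" "\<forall>e. Q (e 0) (e 1) (e 2) \<longleftrightarrow> sats e q"
    using assms unfolding bdef_def by blast
  have p2: "P y x c \<longleftrightarrow> sats (case_nat y (case_nat x (\<lambda>_. c))) p" for x y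
    using p(2)[rule_format, of "case_nat y (case_nat x (\<lambda>_. c))"] by (simp add: numeral_2_eq_2)
  have q2: "Q y x c \<longleftrightarrow> sats (case_nat y (case_nat x (\<lambda>_. c))) q" for x y
    using q(2)[rule_format, of "case_nat y (case_nat x (\<lambda>_. c))"] by (simp add: numeral_2_eq_2)
  have "\<exists>X. sets (arith_str S) X = {x. \<exists>y. P y x c}"
    unfolding p2 by (rule models_comprehension[OF models p(1) q(1)])
      (use assms(3) in \<open>simp add: p2 q2\<close>)
  then show ?thesis by (auto simp: arith_str_def)
qed

text \<open>Being recursive in sets of the model is expressed as being a set of the model, which
  amounts to the same by Delta^0_1 comprehension.\<close>

definition dec :: "('a \<Rightarrow> bool) \<Rightarrow> bool" where
  "dec P \<longleftrightarrow> {x. P x} \<in> range S"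

definition sig :: "('a \<Rightarrow> bool) \<Rightarrow> bool" where
  "sig P \<longleftrightarrow> (\<exists>Q. dec Q \<and> (\<forall>x. P x \<longleftrightarrow> (\<exists>y. Q (pair y x))))"

definition comp :: "('a \<Rightarrow> 'a) \<Rightarrow> bool" where
  "comp f \<longleftrightarrow> {pair x (f x) |x. True} \<in> range S"

lemma dec_bdef: "bdef (\<lambda>e. P (e 1) (e 2)) \<Longrightarrow> dec (\<lambda>x. P x c)"
  using comprehension[of "\<lambda>y. P" "\<lambda>y. P" c] by (simp add: dec_def)

lemma dec_bdef0: "bdef (\<lambda>e. P (e 1)) \<Longrightarrow> dec P"
  by (rule dec_bdef)

text \<open>The parameter \<open>c\<close>, index 2 in \<open>dec_bdef\<close>, moves to 4 below the quantifiers over \<open>x\<close> and \<open>y\<close>.\<close>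

lemma comp_bdef:
  assumes "bdef (\<lambda>e. P (e 0) (e (Suc 0)) (e (Suc (Suc (Suc (Suc 0))))))" "\<And>x y. P y x c \<longleftrightarrow> y = f x"
  shows "comp f"
proof -
  have "dec (\<lambda>z. \<exists>x\<le>z. \<exists>y\<le>z. z = pair x y \<and> P y x c)"
    by (rule dec_bdef) (intro bdefs, use assms(1) in \<open>simp add: eval_nat_numeral\<close>)
  moreover have "{z. \<exists>x\<le>z. \<exists>y\<le>z. z = pair x y \<and> P y x c} = {pair x (f x) |x. True}"
    using pair_ge by (auto simp: assms(2))
  ultimately show ?thesis by (simp add: dec_def comp_def)
qed

lemma comp_id [eff]: "comp (\<lambda>x. x)"
  by (rule comp_bdef[where P = "\<lambda>y x c. y = x"]) (intro bdefs refl)+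

lemma comp_const [eff]: "comp (\<lambda>x. c)"
  by (rule comp_bdef[where P = "\<lambda>y x c. y = c" and c = c]) (intro bdefs refl)+

lemma pair_mem_graph: "pair x y \<in> {pair x (f x) |x. True} \<longleftrightarrow> y = f x"
  by auto

text \<open>P (f x) has a Sigma and a Pi form over the graph of f: some y with y = f x satisfies P,
  and all such y do.\<close>

lemma dec_compose:
  assumes "dec P" "comp f" shows "dec (\<lambda>x. P (f x))"
proof -
  define F where "F = {pair x (f x) |x. True}"
  define X where "X = {x. P x}"
  have FX: "F \<in> range S" "X \<in> range S" using assms by (auto simp: F_def X_def dec_def comp_def)
  have "{x. \<exists>y. pair x y \<in> F \<and> y \<in> X} \<in> range S"
    by (rule comprehension[where Q = "\<lambda>y x c. pair x y \<in> F \<longrightarrow> y \<in> X"])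
      (intro bdefs FX, intro bdefs FX, simp add: F_def pair_mem_graph)
  moreover have "{x. \<exists>y. pair x y \<in> F \<and> y \<in> X} = {x. P (f x)}"
    by (simp add: F_def pair_mem_graph X_def)
  ultimately show ?thesis by (simp add: dec_def)
qed

lemma comp_pair [eff]:
  assumes "comp f" "comp g" shows "comp (\<lambda>x. pair (f x) (g x))"
proof -
  define F where "F = {pair x (f x) |x. True}"
  define G where "G = {pair x (g x) |x. True}"
  have FG: "F \<in> range S" "G \<in> range S" using assms by (auto simp: F_def G_def comp_def)
  show ?thesis
  proof (rule comp_bdef)
    show "bdef (\<lambda>e. \<exists>a\<le>e 0. \<exists>b\<le>e 0. e 0 = pair a b \<and> pair (e (Suc 0)) a \<in> F \<and> pair (e (Suc 0)) b \<in> G)"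
      by (intro bdefs FG)
    show "(\<exists>a\<le>y. \<exists>b\<le>y. y = pair a b \<and> pair x a \<in> F \<and> pair x b \<in> G) \<longleftrightarrow> y = pair (f x) (g x)"
      for x y unfolding F_def G_def pair_mem_graph using pair_ge by blast
  qed
qed

lemma comp_compose:
  assumes "comp g" "comp f" shows "comp (\<lambda>x. g (f x))"
proof -
  define F where "F = {pair x (f x) |x. True}"
  define G where "G = {pair x (g x) |x. True}"
  have FG: "F \<in> range S" "G \<in> range S" using assms by (auto simp: F_def G_def comp_def)
  have "{z. \<exists>y. \<exists>x\<le>z. \<exists>v\<le>z. z = pair x v \<and> pair x y \<in> F \<and> pair y v \<in> G} \<in> range S"
  proof (rule comprehension)
    show "bdef (\<lambda>e. \<exists>x\<le>e 1. \<exists>v\<le>e 1. e 1 = pair x v \<and> pair x (e 0) \<in> F \<and> pair (e 0) v \<in> G)"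
      "bdef (\<lambda>e. \<exists>x\<le>e 1. \<exists>v\<le>e 1. e 1 = pair x v \<and> (pair x (e 0) \<in> F \<longrightarrow> pair (e 0) v \<in> G))"
      by (intro bdefs FG)+
    show "(\<exists>y. \<exists>x\<le>z. \<exists>v\<le>z. z = pair x v \<and> pair x y \<in> F \<and> pair y v \<in> G) \<longleftrightarrow>
        (\<forall>y. \<exists>x\<le>z. \<exists>v\<le>z. z = pair x v \<and> (pair x y \<in> F \<longrightarrow> pair y v \<in> G))" for z
    proof (cases "\<exists>x v. z = pair x v")
      case True
      then obtain x v where z: "z = pair x v" by blast
      have "x \<le> z" "v \<le> z" using z pair_ge by auto
      then show ?thesis unfolding F_def G_def pair_mem_graph using z by (auto simp del: ex_simps)
    qed blast
  qed
  moreover have "{z. \<exists>y. \<exists>x\<le>z. \<exists>v\<le>z. z = pair x v \<and> pair x y \<in> F \<and> pair y v \<in> G} =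
      {pair x (g (f x)) |x. True}"
    unfolding F_def G_def pair_mem_graph using pair_ge by blast
  ultimately show ?thesis by (simp add: comp_def)
qed

lemma comp_pfst [eff]:
  assumes "comp f" shows "comp (\<lambda>x. pfst (f x))"
proof (rule comp_compose[OF comp_bdef assms])
  show "bdef (\<lambda>e. (\<exists>y\<le>e (Suc 0). e (Suc 0) = pair (e 0) y) \<or>
      (e 0 = 0 \<and> \<not> (\<exists>a\<le>e (Suc 0). \<exists>b\<le>e (Suc 0). e (Suc 0) = pair a b)))"
    by (intro bdefs)
  show "(\<exists>y\<le>x. x = pair v y) \<or> (v = 0 \<and> \<not> (\<exists>a\<le>x. \<exists>b\<le>x. x = pair a b)) \<longleftrightarrow> v = pfst x" for x v
    by (cases x rule: pair_exhaust) (use pair_ge in auto)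
qed

lemma comp_psnd [eff]:
  assumes "comp f" shows "comp (\<lambda>x. psnd (f x))"
proof (rule comp_compose[OF comp_bdef assms])
  show "bdef (\<lambda>e. (\<exists>y\<le>e (Suc 0). e (Suc 0) = pair y (e 0)) \<or>
      (e 0 = 0 \<and> \<not> (\<exists>a\<le>e (Suc 0). \<exists>b\<le>e (Suc 0). e (Suc 0) = pair a b)))"
    by (intro bdefs)
  show "(\<exists>y\<le>x. x = pair y v) \<or> (v = 0 \<and> \<not> (\<exists>a\<le>x. \<exists>b\<le>x. x = pair a b)) \<longleftrightarrow> v = psnd x" for x v
    by (cases x rule: pair_exhaust) (use pair_ge in auto)
qed

definition dec2 :: "('a \<Rightarrow> 'a \<Rightarrow> bool) \<Rightarrow> bool" where
  "dec2 P \<longleftrightarrow> dec (\<lambda>z. P (pfst z) (psnd z))"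

definition comp2 :: "('a \<Rightarrow> 'a \<Rightarrow> 'a) \<Rightarrow> bool" where
  "comp2 f \<longleftrightarrow> comp (\<lambda>z. f (pfst z) (psnd z))"

lemma dec2_compose: "dec2 P \<Longrightarrow> comp f \<Longrightarrow> comp g \<Longrightarrow> dec (\<lambda>x. P (f x) (g x))"
  unfolding dec2_def using dec_compose[of "\<lambda>z. P (pfst z) (psnd z)" "\<lambda>x. pair (f x) (g x)"]
  by (simp add: comp_pair)

lemma comp2_compose: "comp2 h \<Longrightarrow> comp f \<Longrightarrow> comp g \<Longrightarrow> comp (\<lambda>x. h (f x) (g x))"
  unfolding comp2_def using comp_compose[of "\<lambda>z. h (pfst z) (psnd z)" "\<lambda>x. pair (f x) (g x)"]
  by (simp add: comp_pair)

lemma dec2_bdef: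
  assumes "bdef (\<lambda>e. P (e 1) (e 0))" shows "dec2 P"
proof -
  have "dec (\<lambda>z. z \<in> {z. P (pfst z) (psnd z)})"
  proof -
    \<comment> \<open>\<open>assms\<close> speaks of P only at two quantified positions. Hence the
      value P 0 0, taken at numbers that code no pair, is written with quantifiers bounded by the
      parameter c = 0.\<close>
    have 2: "dec (\<lambda>z. (\<exists>y\<le>z. \<exists>x\<le>z. z = pair y x \<and> P y x) \<or>
        (\<not> (\<exists>y\<le>z. \<exists>x\<le>z. z = pair y x)) \<and> (\<exists>y\<le>c. \<exists>x\<le>c. P y x))" if "c = 0" for c
      by (rule dec_bdef) (intro bdefs | use assms in simp)+
    have "(\<exists>y\<le>z. \<exists>x\<le>z. z = pair y x \<and> P y x) \<or>
        (\<not> (\<exists>y\<le>z. \<exists>x\<le>z. z = pair y x)) \<and> (\<exists>y\<le>0. \<exists>x\<le>0. P y x) \<longleftrightarrow> P (pfst z) (psnd z)" for z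
      by (cases z rule: pair_exhaust) (use pair_ge in auto)
    with 2[OF refl] show ?thesis by simp
  qed
  then show ?thesis by (simp add: dec2_def)
qed

lemma dec_eq [eff]: "comp f \<Longrightarrow> comp g \<Longrightarrow> dec (\<lambda>x. f x = g x)"
  by (rule dec2_compose[of "\<lambda>x y. x = y"]) (rule dec2_bdef, intro bdefs)

lemma dec_less [eff]: "comp f \<Longrightarrow> comp g \<Longrightarrow> dec (\<lambda>x. f x < g x)"
  by (rule dec2_compose[of "\<lambda>x y. x < y"]) (rule dec2_bdef, intro bdefs)

lemma dec_mem [eff]: "X \<in> range S \<Longrightarrow> comp f \<Longrightarrow> dec (\<lambda>x. f x \<in> X)"
  by (rule dec_compose[of "\<lambda>x. x \<in> X"]) (simp add: dec_def)

lemma bdef_dec: "dec P \<Longrightarrow> tdef f \<Longrightarrow> bdef (\<lambda>e. P (f e))"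
  using bdef_mem[of "{x. P x}" f] by (simp add: dec_def)

lemma dec_not [eff]: "dec P \<Longrightarrow> dec (\<lambda>x. \<not> P x)"
  by (rule dec_bdef0) (intro bdefs bdef_dec)

lemma dec_conj [eff]: "dec P \<Longrightarrow> dec Q \<Longrightarrow> dec (\<lambda>x. P x \<and> Q x)"
  by (rule dec_bdef0) (intro bdefs bdef_dec)

lemma dec_disj [eff]: "dec P \<Longrightarrow> dec Q \<Longrightarrow> dec (\<lambda>x. P x \<or> Q x)"
  by (rule dec_bdef0) (intro bdefs bdef_dec)

lemma dec_imp [eff]: "dec P \<Longrightarrow> dec Q \<Longrightarrow> dec (\<lambda>x. P x \<longrightarrow> Q x)"
  by (rule dec_bdef0) (intro bdefs bdef_dec)

lemma dec_iff [eff]: "dec P \<Longrightarrow> dec Q \<Longrightarrow> dec (\<lambda>x. P x \<longleftrightarrow> Q x)"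
  unfolding iff_conv_conj_imp by (intro dec_conj dec_imp)

lemma dec_le [eff]: "comp f \<Longrightarrow> comp g \<Longrightarrow> dec (\<lambda>x. f x \<le> g x)"
  unfolding not_less[symmetric] by (intro eff)

lemma comp_add [eff]: "comp f \<Longrightarrow> comp g \<Longrightarrow> comp (\<lambda>x. f x + g x)"
proof (rule comp2_compose[of "(+)"])
  show "comp2 (+)"
    unfolding comp2_def
  proof (rule comp_bdef)
    show "bdef (\<lambda>e. (\<exists>a\<le>e (Suc 0). \<exists>b\<le>e (Suc 0). e (Suc 0) = pair a b \<and> e 0 = a + b) \<or>
      (e 0 = 0 \<and> \<not> (\<exists>a\<le>e (Suc 0). \<exists>b\<le>e (Suc 0). e (Suc 0) = pair a b)))"
      by (intro bdefs)
    show "(\<exists>a\<le>x. \<exists>b\<le>x. x = pair a b \<and> v = a + b) \<or>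
      (v = 0 \<and> \<not> (\<exists>a\<le>x. \<exists>b\<le>x. x = pair a b)) \<longleftrightarrow> v = pfst x + psnd x" for x v
      by (cases x rule: pair_exhaust) (use pair_ge in auto)
  qed
qed

lemma comp_mul [eff]: "comp f \<Longrightarrow> comp g \<Longrightarrow> comp (\<lambda>x. f x * g x)"
proof (rule comp2_compose[of "(*)"])
  show "comp2 (*)"
    unfolding comp2_def
  proof (rule comp_bdef)
    show "bdef (\<lambda>e. (\<exists>a\<le>e (Suc 0). \<exists>b\<le>e (Suc 0). e (Suc 0) = pair a b \<and> e 0 = a * b) \<or>
      (e 0 = 0 \<and> \<not> (\<exists>a\<le>e (Suc 0). \<exists>b\<le>e (Suc 0). e (Suc 0) = pair a b)))"
      by (intro bdefs)
    show "(\<exists>a\<le>x. \<exists>b\<le>x. x = pair a b \<and> v = a * b) \<or>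
      (v = 0 \<and> \<not> (\<exists>a\<le>x. \<exists>b\<le>x. x = pair a b)) \<longleftrightarrow> v = pfst x * psnd x" for x v
      by (cases x rule: pair_exhaust) (use pair_ge in auto)
  qed
qed

lemma dec_bex [eff]:
  assumes "dec (\<lambda>z. P (pfst z) (psnd z))" "comp f"
  shows "dec (\<lambda>x. \<exists>y<f x. P y x)"
proof -
  let ?Q = "\<lambda>b x. \<exists>y<b. (\<lambda>z. P (pfst z) (psnd z)) (pair y x)"
  have "dec2 ?Q" by (rule dec2_bdef) (intro bdefs bdef_dec[OF assms(1)])
  from dec2_compose[OF this assms(2) comp_id] show ?thesis by simp
qed

lemma dec_ball [eff]:
  assumes "dec (\<lambda>z. P (pfst z) (psnd z))" "comp f"
  shows "dec (\<lambda>x. \<forall>y<f x. P y x)"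
  using dec_not[OF dec_bex[of "\<lambda>y x. \<not> P y x" f]] dec_not[OF assms(1)] assms(2) by simp

lemma dec_bex_le [eff]:
  "dec (\<lambda>z. P (pfst z) (psnd z)) \<Longrightarrow> comp f \<Longrightarrow> dec (\<lambda>x. \<exists>y\<le>f x. P y x)"
  using dec_bex[of P "\<lambda>x. f x + 1"] comp_add[OF _ comp_const] by simp

lemma dec_ball_le [eff]:
  "dec (\<lambda>z. P (pfst z) (psnd z)) \<Longrightarrow> comp f \<Longrightarrow> dec (\<lambda>x. \<forall>y\<le>f x. P y x)"
  using dec_ball[of P "\<lambda>x. f x + 1"] comp_add[OF _ comp_const] by simp

lemma sig_dec: assumes "dec P" shows "sig P"
  unfolding sig_def
proof (intro exI conjI allI)
  show "dec (\<lambda>z. P (psnd z))" by (intro dec_compose[OF assms] eff)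
qed simp

lemma sig_conj [eff]:
  assumes "sig P" "sig Q" shows "sig (\<lambda>x. P x \<and> Q x)"
proof -
  obtain P' Q' where P': "dec P'" "\<forall>x. P x \<longleftrightarrow> (\<exists>y. P' (pair y x))"
    and Q': "dec Q'" "\<forall>x. Q x \<longleftrightarrow> (\<exists>y. Q' (pair y x))"
    using assms unfolding sig_def by blast
  show ?thesis
    unfolding sig_def
  proof (intro exI conjI allI)
    show "dec (\<lambda>z. P' (pair (pfst (pfst z)) (psnd z)) \<and> Q' (pair (psnd (pfst z)) (psnd z)))"
      by (intro dec_conj dec_compose[OF P'(1)] dec_compose[OF Q'(1)] eff)
    show "P x \<and> Q x \<longleftrightarrow> (\<exists>y. P' (pair (pfst (pfst (pair y x))) (psnd (pair y x))) \<and>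
        Q' (pair (psnd (pfst (pair y x))) (psnd (pair y x))))" for x
      using P'(2) Q'(2) by (metis pfst_pair psnd_pair)
  qed
qed

lemma sig_disj [eff]:
  assumes "sig P" "sig Q" shows "sig (\<lambda>x. P x \<or> Q x)"
proof -
  obtain P' Q' where P': "dec P'" "\<forall>x. P x \<longleftrightarrow> (\<exists>y. P' (pair y x))"
    and Q': "dec Q'" "\<forall>x. Q x \<longleftrightarrow> (\<exists>y. Q' (pair y x))"
    using assms unfolding sig_def by blast
  then show ?thesis
    unfolding sig_def by (intro exI[of _ "\<lambda>z. P' z \<or> Q' z"] conjI dec_disj) auto
qed

lemma sig_ex [eff]:
  assumes "sig (\<lambda>z. P (pfst z) (psnd z))" shows "sig (\<lambda>x. \<exists>y. P y x)"
proof -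
  obtain Q where Q: "dec Q" "\<forall>z. P (pfst z) (psnd z) \<longleftrightarrow> (\<exists>y. Q (pair y z))"
    using assms unfolding sig_def by blast
  have P: "P y x \<longleftrightarrow> (\<exists>w. Q (pair w (pair y x)))" for x y
    using Q(2)[rule_format, of "pair y x"] by simp
  show ?thesis
    unfolding sig_def
  proof (intro exI conjI allI)
    show "dec (\<lambda>z. Q (pair (pfst (pfst z)) (pair (psnd (pfst z)) (psnd z))))"
      by (intro dec_compose[OF Q(1)] eff)
    show "(\<exists>y. P y x) \<longleftrightarrow> (\<exists>u. Q (pair (pfst (pfst (pair u x))) (pair (psnd (pfst (pair u x))) (psnd (pair u x)))))" for x
      unfolding P by (metis pfst_pair psnd_pair)
  qed
qed

lemma sig_compose:
  assumes "sig P" "comp f" shows "sig (\<lambda>x. P (f x))"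
proof -
  obtain Q where Q: "dec Q" "\<forall>z. P z \<longleftrightarrow> (\<exists>y. Q (pair y z))"
    using assms unfolding sig_def by blast
  show ?thesis
    unfolding sig_def
  proof (intro exI conjI allI)
    show "dec (\<lambda>z. Q (pair (pfst z) (f (psnd z))))"
      by (intro dec_compose[OF Q(1)] comp_compose[OF assms(2)] eff)
  qed (simp add: Q(2))
qed

text \<open>Post's theorem, which is Delta^0_1 comprehension in this setting.\<close>

lemma dec_sig_cosig:
  assumes "sig P" "sig (\<lambda>x. \<not> P x)" shows "dec P"
proof -
  obtain Q where Q: "dec Q" "\<forall>z. P z \<longleftrightarrow> (\<exists>y. Q (pair y z))" using assms unfolding sig_def by blast
  obtain R where R: "dec R" "\<forall>z. \<not> P z \<longleftrightarrow> (\<exists>y. R (pair y z))" using assms unfolding sig_def by blast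
  have "{z. \<exists>y. Q (pair y z)} \<in> range S"
    by (rule comprehension[where Q = "\<lambda>y z c. \<not> R (pair y z)"])
      (intro bdefs bdef_dec[OF Q(1)], intro bdefs bdef_dec[OF R(1)], use Q(2) R(2) in blast)
  then show ?thesis using Q(2) by (simp add: dec_def)
qed

text \<open>Totality makes the complement of a Sigma graph Sigma as well: y differs from f x iff
  some v other than y is f x.\<close>

lemma comp_graph:
  assumes "sig (\<lambda>z. psnd z = f (pfst z))" shows "comp f"
proof -
  have "dec (\<lambda>z. \<exists>x y. z = pair x y \<and> y = f x)"
  proof (rule dec_sig_cosig)
    have *: "(\<exists>x y. z = pair x y \<and> y = f x) \<longleftrightarrow> (\<exists>x\<le>z. \<exists>y\<le>z. z = pair x y) \<and> psnd z = f (pfst z)" for z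
      using pair_ge by (cases z rule: pair_exhaust) auto
    show "sig (\<lambda>z. \<exists>x y. z = pair x y \<and> y = f x)"
      unfolding * by (intro sig_conj[OF sig_dec assms] eff)
    have **: "(\<not> (\<exists>x y. z = pair x y \<and> y = f x)) \<longleftrightarrow>
        \<not> (\<exists>x\<le>z. \<exists>y\<le>z. z = pair x y) \<or> (\<exists>v. psnd z \<noteq> v \<and> psnd (pair (pfst z) v) = f (pfst (pair (pfst z) v)))" for z
      unfolding * by auto
    show "sig (\<lambda>z. \<not> (\<exists>x y. z = pair x y \<and> y = f x))"
      unfolding ** by (intro sig_disj sig_ex sig_conj sig_compose[OF assms, where f = "\<lambda>z. pair (F z) (G z)" for F G]; (intro sig_dec)?; intro eff)
  qed
  then show ?thesis by (simp add: dec_def comp_def Collect_conv_if)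
qed

text \<open>Later inductions are cast in this form or its decidable special case, which is why
  quantifiers are bounded so carefully below.\<close>

lemma sig_induct [consumes 1, case_names zero succ]:
  assumes "sig P" "P 0" "\<And>x. P x \<Longrightarrow> P (x + 1)"
  shows "P x"
proof -
  obtain Q where Q: "dec Q" "\<forall>x. P x \<longleftrightarrow> (\<exists>y. Q (pair y x))" using assms(1) unfolding sig_def by blast
  have "bdef (\<lambda>e. Q (pair (e 0) (e 1)))" by (intro bdef_dec[OF Q(1)] bdefs)
  then obtain p where p: "bounded_fm p" "\<forall>e. Q (pair (e 0) (e 1)) \<longleftrightarrow> sats e p"
    unfolding bdef_def by blast
  show ?thesis
  proof (rule models_induction[OF models p(1)])
    show "P x \<longleftrightarrow> (\<exists>y. sats (case_nat y (case_nat x (\<lambda>_. 0))) p)" for x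
      unfolding p(2)[rule_format, symmetric] using Q(2) by simp
  qed (use assms(2,3) in \<open>simp_all add: arith_str_def\<close>)
qed

lemma dec_induct [consumes 1, case_names zero succ]:
  assumes "dec P" "P 0" "\<And>x. P x \<Longrightarrow> P (x + 1)"
  shows "P x"
  using assms(2,3) by (rule sig_induct[OF sig_dec[OF assms(1)]])

lemma dec_less_induct [consumes 1, case_names less]:
  assumes "dec P" "\<And>x. (\<And>y. y < x \<Longrightarrow> P y) \<Longrightarrow> P x"
  shows "P x"
proof -
  have "dec (\<lambda>x. \<forall>y<x. P y)" by (intro eff dec_compose[OF assms(1)])
  then have "\<forall>y<x. P y"
  proof (induction x rule: dec_induct)
    case (succ x)
    then show ?case by (metis assms(2) le_less less_succ_iff)
  qed simp
  then show ?thesis using assms(2) by blast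
qed

lemma dec_least:
  assumes "dec P" "P x" obtains y where "P y" "\<And>z. P z \<Longrightarrow> y \<le> z"
proof -
  have "\<exists>y. P y \<and> (\<forall>z. P z \<longrightarrow> y \<le> z)"
  proof (rule ccontr)
    assume neg: "\<not> ?thesis"
    have "\<not> P x" for x
      using dec_not[OF assms(1)] by (induction x rule: dec_less_induct) (metis neg not_le)
    then show False using assms(2) by blast
  qed
  then show ?thesis using that by blast
qed

text \<open>The order of the model need not be well founded, so \<open>LEAST\<close> has no content
  in general; decidability supplies the minimum.\<close>

lemma Least_dec:
  assumes "dec P" "P x" shows "P (LEAST x. P x)" "(LEAST x. P x) \<le> x"
proof -
  obtain y where y: "P y" "\<And>z. P z \<Longrightarrow> y \<le> z" using dec_least[OF assms] by blast
  then have "(LEAST x. P x) = y" by (intro Least_equality)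
  then show "P (LEAST x. P x)" "(LEAST x. P x) \<le> x" using y assms(2) by auto
qed

lemma dec_section: "dec (\<lambda>z. P (pfst z) (psnd z)) \<Longrightarrow> dec (\<lambda>y. P y x)"
  using dec2_compose[of P "\<lambda>y. y" "\<lambda>y. x"] by (simp add: dec2_def comp_id comp_const)

lemma comp_graph_dec: "dec (\<lambda>z. psnd z = f (pfst z)) \<Longrightarrow> comp f"
  by (intro comp_graph sig_dec)

lemma comp_Least [eff]:
  assumes P: "dec (\<lambda>z. P (pfst z) (psnd z))" and ex: "\<And>x. \<exists>y. P y x"
  shows "comp (\<lambda>x. LEAST y. P y x)"
proof (rule comp_graph_dec)
  have "y = (LEAST y. P y x) \<longleftrightarrow> P y x \<and> \<not> (\<exists>y'<y. P y' x)" for x y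
  proof -
    obtain z where "P z x" using ex by blast
    note L = Least_dec[OF dec_section[OF P]]
    show ?thesis
    proof
      assume "y = (LEAST y. P y x)"
      then show "P y x \<and> \<not> (\<exists>y'<y. P y' x)" using L \<open>P z x\<close> by (metis not_le)
    next
      assume "P y x \<and> \<not> (\<exists>y'<y. P y' x)"
      then show "y = (LEAST y. P y x)" by (intro Least_equality[symmetric]) (auto simp: not_less)
    qed
  qed
  then show "dec (\<lambda>z. psnd z = (LEAST y. P y (pfst z)))"
    using P[folded dec2_def] by (simp, intro eff dec2_compose[OF P[folded dec2_def]])
qed

lemma comp_if [eff]:
  assumes "dec P" "comp f" "comp g" shows "comp (\<lambda>x. if P x then f x else g x)"
proof (rule comp_graph_dec)
  have "psnd z = (if P (pfst z) then f (pfst z) else g (pfst z)) \<longleftrightarrow>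
    P (pfst z) \<and> psnd z = f (pfst z) \<or> \<not> P (pfst z) \<and> psnd z = g (pfst z)" for z by simp
  then show "dec (\<lambda>z. psnd z = (if P (pfst z) then f (pfst z) else g (pfst z)))"
    by (simp only:) (intro eff dec_compose[OF assms(1)] comp_compose[OF assms(2)]
        comp_compose[OF assms(3)])
qed

lemma comp_minus [eff]:
  assumes "comp f" "comp g" shows "comp (\<lambda>x. f x - g x)"
proof -
  have "a - b = (LEAST c. a \<le> b + c)" for a b :: 'a
  proof (rule Least_equality[symmetric])
    show "a \<le> b + (a - b)"
      by (metis add_diff_inverse le_less linear not_less zero_le add_increasing2)
    show "a - b \<le> c" if "a \<le> b + c" for c
    proof (cases "b \<le> a")
      case True
      then show ?thesis using that by (metis add_le_cancel_left add_diff_inverse not_le)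
    next
      case False
      then obtain d where "b = a + d" using le_iff_add linear by metis
      then show ?thesis by simp
    qed
  qed
  moreover have "comp2 (\<lambda>a b. LEAST c. a \<le> b + c)"
    unfolding comp2_def by (intro eff) (metis add.commute le_iff_add linear)
  ultimately have "comp2 (\<lambda>a b. a - b)" by simp
  from comp2_compose[OF this assms] show ?thesis .
qed

text \<open>Collection for computable functions: the bound is existentially quantified in front of a
  decidable matrix, so Sigma^0_1 induction on n applies.\<close>

lemma comp_bounded:
  assumes "comp f" shows "\<exists>b. \<forall>i<n. f i < b"
proof -
  have "sig (\<lambda>n. \<exists>b. \<forall>i<n. f i < b)" by (intro sig_ex sig_dec eff comp_compose[OF assms])
  then show ?thesis
  proof (induction n rule: sig_induct)
    case (succ n)
    then obtain b where b: "\<forall>i<n. f i < b" by blast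
    have "f i < max b (f n + 1)" if "i < n + 1" for i
      using b that by (cases "i = n") (auto simp: less_max_iff_disj)
    then show ?case by blast
  qed simp
qed


section \<open>Codes of finite sets\<close>

definition fmem :: "'a \<Rightarrow> 'a \<Rightarrow> bool" where
  "fmem i s \<longleftrightarrow> (\<exists>k a b. s = pair k (pair a b) \<and> i < k \<and> a * (i + 1) + 1 dvd b)"

definition triple :: "'a \<Rightarrow> bool" where
  "triple s \<longleftrightarrow> (\<exists>k a b. s = pair k (pair a b))"

definition fin :: "'a \<Rightarrow> bool" where
  "fin s \<longleftrightarrow> triple s \<and> \<not> (\<exists>t. t < s \<and> triple t \<and> (\<forall>i. fmem i t \<longleftrightarrow> fmem i s))"

lemma fmem_less: "fmem i s \<Longrightarrow> i < s"
  unfolding fmem_def using pair_ge(1) less_le_trans by blast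

lemma fmem_pair_less: "fmem (pair i j) s \<Longrightarrow> i < s" "fmem (pair i j) s \<Longrightarrow> j < s"
  by (erule le_less_trans[OF pair_ge(1) fmem_less], erule le_less_trans[OF pair_ge(2) fmem_less])

lemma triple_bounds: "pair k (pair a b) = s \<Longrightarrow> k \<le> s \<and> a \<le> s \<and> b \<le> s"
  using pair_ge(1)[of k "pair a b"] pair_ge(2)[of "pair a b" k] pair_ge(1)[of a b] pair_ge(2)[of b a]
  by auto

lemma dec_triple [eff]: "comp f \<Longrightarrow> dec (\<lambda>x. triple (f x))"
proof (rule dec_compose[of triple])
  have *: "triple = (\<lambda>s. \<exists>k\<le>s. \<exists>a\<le>s. \<exists>b\<le>s. s = pair k (pair a b))"
    by (rule ext) (unfold triple_def, metis triple_bounds)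
  show "dec triple" unfolding * by (intro eff)
qed

lemma dec_dvd [eff]: "comp f \<Longrightarrow> comp g \<Longrightarrow> dec (\<lambda>x. f x dvd g x)"
proof (rule dec2_compose[of "(dvd)"])
  have "a dvd b \<longleftrightarrow> (\<exists>c\<le>b. b = a * c)" for a b :: 'a
  proof
    assume "a dvd b"
    then obtain c where c: "b = a * c" ..
    show "\<exists>c\<le>b. b = a * c"
    proof (cases "a = 0")
      case False
      then show ?thesis using c mult_le_self[of a c] by (auto simp: mult.commute)
    qed (use c in auto)
  qed auto
  then show "dec2 (dvd)" unfolding dec2_def by (simp only:) (intro eff)
qed

lemma dec_fmem [eff]: "comp f \<Longrightarrow> comp g \<Longrightarrow> dec (\<lambda>x. fmem (f x) (g x))"
proof (rule dec2_compose[of fmem])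
  have "fmem i s \<longleftrightarrow> (\<exists>k\<le>s. \<exists>a\<le>s. \<exists>b\<le>s. s = pair k (pair a b) \<and> i < k \<and> a * (i + 1) + 1 dvd b)" for i s
    unfolding fmem_def using triple_bounds by metis
  then show "dec2 fmem" unfolding dec2_def by (simp only:) (intro eff)
qed

text \<open>Stands in for the factorial of n, since recursion becomes available only once finite
  sequences can be coded.\<close>

lemma common_multiple: "\<exists>a::'a. a \<noteq> 0 \<and> (\<forall>d\<le>n. d \<noteq> 0 \<longrightarrow> d dvd a)"
proof -
  have "sig (\<lambda>n. \<exists>a::'a. a \<noteq> 0 \<and> (\<forall>d\<le>n. d \<noteq> 0 \<longrightarrow> d dvd a))" by (intro sig_ex sig_dec eff)
  then show ?thesis
  proof (induction n rule: sig_induct)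
    case zero
    show ?case by (intro exI[of _ 1]) auto
  next
    case (succ n)
    then obtain a where a: "a \<noteq> 0" "\<forall>d\<le>n. d \<noteq> 0 \<longrightarrow> d dvd a" by blast
    have "d dvd a * (n + 1)" if "d \<le> n + 1" "d \<noteq> 0" for d
      using a that by (cases "d = n + 1") (auto simp: order.order_iff_strict)
    then show ?case using a(1) by (intro exI[of _ "a * (n + 1)"]) auto
  qed
qed

text \<open>
  The moduli \<open>a (i + 1) + 1\<close> are pairwise coprime; this is the only consequence that is needed.
\<close>

lemma modulus_dvd_mult:
  fixes a b i j n :: 'a
  assumes a: "\<And>d. d \<le> n \<Longrightarrow> d \<noteq> 0 \<Longrightarrow> d dvd a" and ij: "i \<le> n" "j \<le> n" "i \<noteq> j"
    and dvd: "a * (i + 1) + 1 dvd b * (a * (j + 1) + 1)"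
  shows "a * (i + 1) + 1 dvd b"
proof -
  let ?u = "a * (i + 1) + 1" and ?v = "a * (j + 1) + 1"
  \<comment> \<open>d is the distance between i and j. Since (i + 1) * \<open>?v\<close> and (j + 1)
    * \<open>?u\<close> differ by exactly d, \<open>?u\<close> divides b * d. As d divides a, it
    also divides b * a, and therefore b, the difference of b * \<open>?u\<close> and b * a * (i +
    1).\<close>
  obtain d where d: "?u dvd b * d" "d \<noteq> 0" "d \<le> n"
  proof (cases i j rule: linorder_cases)
    case less
    then obtain d where d: "j = i + d" using le_iff_add less_imp_le by metis
    have "b * ?u * (j + 1) = b * ?v * (i + 1) + b * d" by (simp add: d algebra_simps)
    moreover have "?u dvd b * ?u * (j + 1)" "?u dvd b * ?v * (i + 1)" using dvd by auto
    ultimately have "?u dvd b * d" by (metis dvd_add_right_iff)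
    then show ?thesis using that[of d] ij less by (simp add: d) (metis add.commute le_add_same_cancel1 order_trans zero_le)
  next
    case greater
    then obtain d where d: "i = j + d" using le_iff_add less_imp_le by metis
    have "b * ?v * (i + 1) = b * ?u * (j + 1) + b * d" by (simp add: d algebra_simps)
    moreover have "?u dvd b * ?u * (j + 1)" "?u dvd b * ?v * (i + 1)" using dvd by auto
    ultimately have "?u dvd b * d" by (metis dvd_add_right_iff)
    then show ?thesis using that[of d] ij greater by (simp add: d) (metis add.commute le_add_same_cancel1 order_trans zero_le)
  qed (use ij in simp)
  then have "b * d dvd b * a" using a by (intro mult_dvd_mono) auto
  then have "?u dvd b * a * (i + 1)" using d(1) dvd_trans by (metis dvd_mult2)
  moreover have "b * ?u = b * a * (i + 1) + b" by (simp add: algebra_simps)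
  ultimately show ?thesis by (metis dvd_add_right_iff dvd_triv_right)
qed

text \<open>The number b is the product of the moduli a * (i + 1) + 1 over the members i, built up
  candidate by candidate. The empty product 1 codes the empty set because a is nonzero.\<close>

lemma code_exists:
  assumes "dec P" shows "\<exists>s. triple s \<and> (\<forall>i. fmem i s \<longleftrightarrow> i < n \<and> P i)"
proof -
  obtain a where a: "a \<noteq> 0" "\<And>d. d \<le> n \<Longrightarrow> d \<noteq> 0 \<Longrightarrow> d dvd a" using common_multiple by blast
  let ?R = "\<lambda>j. \<exists>b. \<forall>i<n. a * (i + 1) + 1 dvd b \<longleftrightarrow> i < j \<and> P i"
  have "sig ?R" by (intro sig_ex sig_dec eff dec_compose[OF assms])
  then have "?R n"
  proof (induction n rule: sig_induct)
    case zero
    have "\<not> a * (i + 1) + 1 dvd 1" for i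
    proof
      assume "a * (i + 1) + 1 dvd 1"
      then obtain c where c: "1 = (a * (i + 1) + 1) * c" ..
      then have "c \<noteq> 0" by (metis mult_zero_right zero_neq_one)
      then have "a * (i + 1) + 1 \<le> 1" using mult_le_self[of c "a * (i + 1) + 1"] c by simp
      then show False using a(1) by (simp add: add_eq_0_iff_both_eq_0)
    qed
    then show ?case by auto
  next
    case (succ j)
    then obtain b where b: "\<forall>i<n. a * (i + 1) + 1 dvd b \<longleftrightarrow> i < j \<and> P i" by blast
    show ?case
    proof (cases "j < n \<and> P j")
      case True
      have "a * (i + 1) + 1 dvd b * (a * (j + 1) + 1) \<longleftrightarrow> i < j + 1 \<and> P i" if "i < n" for i
      proof (cases "i = j")
        case False
        then have "a * (i + 1) + 1 dvd b * (a * (j + 1) + 1) \<longleftrightarrow> a * (i + 1) + 1 dvd b"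
          using modulus_dvd_mult[of n a i j b] a(2) that True by auto
        then show ?thesis using b that False by auto
      qed (use True in auto)
      then show ?thesis by blast
    next
      case False
      then have "i < j + 1 \<and> P i \<longleftrightarrow> i < j \<and> P i" if "i < n" for i using that by (auto simp: le_less)
      then show ?thesis using b by (intro exI[of _ b]) simp
    qed
  qed
  then obtain b where "\<forall>i<n. a * (i + 1) + 1 dvd b \<longleftrightarrow> i < n \<and> P i" by blast
  then show ?thesis
    by (intro exI[of _ "pair n (pair a b)"]) (auto simp: fmem_def triple_def)
qed

definition code :: "'a \<Rightarrow> ('a \<Rightarrow> bool) \<Rightarrow> 'a" where
  "code n P = (LEAST s. triple s \<and> (\<forall>i. fmem i s \<longleftrightarrow> i < n \<and> P i))"

text \<open>Above s + n both sides are false, so equality of the two sets becomes a decidable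
  condition.\<close>

lemma fmem_all_bounded:
  "(\<forall>i. fmem i s \<longleftrightarrow> i < n \<and> P i) \<longleftrightarrow> (\<forall>i\<le>s + n. fmem i s \<longleftrightarrow> i < n \<and> P i)"
  using fmem_less by (metis add_increasing add_increasing2 less_imp_le zero_le)

lemma dec_code_rep:
  assumes "dec P" shows "dec (\<lambda>s. triple s \<and> (\<forall>i. fmem i s \<longleftrightarrow> i < n \<and> P i))"
  unfolding fmem_all_bounded by (intro eff dec_compose[OF assms])

lemma comp_code [eff]:
  assumes P: "dec (\<lambda>z. P (pfst z) (psnd z))" and f: "comp f"
  shows "comp (\<lambda>x. code (f x) (\<lambda>i. P i x))"
proof -
  have ex: "\<exists>s. triple s \<and> (\<forall>i\<le>s + f x. fmem i s \<longleftrightarrow> i < f x \<and> P i x)" for x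
    using code_exists[OF dec_section[OF P], of "f x" x] unfolding fmem_all_bounded .
  have "comp (\<lambda>x. LEAST s. triple s \<and> (\<forall>i\<le>s + f x. fmem i s \<longleftrightarrow> i < f x \<and> P i x))"
    by (rule comp_Least[OF _ ex]) (intro eff comp_compose[OF f] dec2_compose[OF P[folded dec2_def]])
  then show ?thesis unfolding code_def fmem_all_bounded .
qed

lemma code:
  assumes "dec P" shows "fmem i (code n P) \<longleftrightarrow> i < n \<and> P i" "fin (code n P)"
proof -
  let ?Q = "\<lambda>s. triple s \<and> (\<forall>i. fmem i s \<longleftrightarrow> i < n \<and> P i)"
  obtain s where s: "?Q s" using code_exists[OF assms] by blast
  note L = Least_dec[of ?Q, OF dec_code_rep[OF assms], folded code_def]
  show "fmem i (code n P) \<longleftrightarrow> i < n \<and> P i" using L(1)[OF s] by blast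
  show "fin (code n P)" unfolding fin_def using L(1)[OF s] L(2) by (metis not_le)
qed

lemma dec_fin [eff]: "comp f \<Longrightarrow> dec (\<lambda>x. fin (f x))"
proof (rule dec_compose[of fin])
  have *: "fin = (\<lambda>s. triple s \<and> \<not> (\<exists>t<s. triple t \<and> (\<forall>i<s. fmem i t \<longleftrightarrow> fmem i s)))"
    by (rule ext) (unfold fin_def, use fmem_less less_trans in blast)
  show "dec fin" unfolding * by (intro eff)
qed


section \<open>Primitive recursion and counting\<close>

text \<open>The alternative v = u makes the search total. Entries of u are smaller than u, so an
  existing entry takes precedence.\<close>

definition at :: "'a \<Rightarrow> 'a \<Rightarrow> 'a" where
  "at u i = (LEAST v. fmem (pair i v) u \<or> v = u)"

lemma comp_at [eff]: "comp f \<Longrightarrow> comp g \<Longrightarrow> comp (\<lambda>x. at (f x) (g x))"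
  by (rule comp2_compose[of at]) (unfold comp2_def at_def, intro eff, blast)

lemma code_seq_exists:
  assumes "comp f" shows "\<exists>u. fin u \<and> (\<forall>z. fmem z u \<longleftrightarrow> (\<exists>i<n. z = pair i (f i)))"
proof -
  obtain b where b: "\<forall>i<n. pair i (f i) < b"
    using comp_bounded[OF comp_pair[OF comp_id assms]] by blast
  have "dec (\<lambda>z. \<exists>i<n. z = pair i (f i))" by (intro eff comp_compose[OF assms])
  note c = code[OF this, where n = b]
  show ?thesis using c b by blast
qed

lemma at_seq:
  assumes "\<forall>z. fmem z u \<longleftrightarrow> (\<exists>i<n. z = pair i (f i))" "i < n"
  shows "at u i = f i"
  unfolding at_def
proof (rule Least_equality)
  show "fmem (pair i (f i)) u \<or> f i = u" using assms by blast
  have "f i < u" using assms fmem_pair_less by blast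
  then show "f i \<le> v" if "fmem (pair i v) u \<or> v = u" for v using that assms by auto
qed

definition rec_seq :: "'a \<Rightarrow> ('a \<Rightarrow> 'a \<Rightarrow> 'a) \<Rightarrow> 'a \<Rightarrow> 'a \<Rightarrow> bool" where
  "rec_seq a G n u \<longleftrightarrow> at u 0 = a \<and> (\<forall>i<n. at u (i + 1) = G i (at u i))"

text \<open>Recursion has to run inside the model, along a possibly nonstandard n; its value is
  therefore read off from a coded course of values.\<close>

definition prec :: "'a \<Rightarrow> ('a \<Rightarrow> 'a \<Rightarrow> 'a) \<Rightarrow> 'a \<Rightarrow> 'a" where
  "prec a G n = (THE y. \<exists>u. rec_seq a G n u \<and> at u n = y)"

lemma rec_seq_unique:
  assumes "rec_seq a G n u" "rec_seq a G m v" "i \<le> n" "i \<le> m"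
  shows "at u i = at v i"
proof -
  have "dec (\<lambda>i. i \<le> n \<and> i \<le> m \<longrightarrow> at u i = at v i)" by (intro eff)
  then have "i \<le> n \<and> i \<le> m \<longrightarrow> at u i = at v i"
  proof (induction i rule: dec_induct)
    case (succ i)
    then show ?case using assms(1,2) by (auto simp: rec_seq_def)
  qed (use assms in \<open>simp add: rec_seq_def\<close>)
  then show ?thesis using assms by blast
qed

lemma rec_seq_exists:
  assumes "comp2 G" shows "\<exists>u. rec_seq a G n u"
proof -
  have "sig (\<lambda>n. \<exists>u. rec_seq a G n u)"
    unfolding rec_seq_def by (intro sig_ex sig_dec eff comp2_compose[OF assms])
  then show ?thesis
  proof (induction n rule: sig_induct)
    case zero
    obtain u where "\<forall>z. fmem z u \<longleftrightarrow> (\<exists>i<1. z = pair i a)"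
      using code_seq_exists[of "\<lambda>_. a"] comp_const by blast
    then have "at u 0 = a" by (rule at_seq) (rule zero_less_one)
    then show ?case by (auto simp: rec_seq_def)
  next
    case (succ n)
    then obtain u where u: "rec_seq a G n u" by blast
    \<comment> \<open>Instead of appending an entry to the code u, the extended course of values is
      coded afresh as the range of a computable function; positions 0 to n + 1 are needed.\<close>
    define f where "f i = (if i \<le> n then at u i else G n (at u n))" for i
    have "comp f" unfolding f_def by (intro eff comp2_compose[OF assms])
    then obtain v where "\<forall>z. fmem z v \<longleftrightarrow> (\<exists>i<n + 1 + 1. z = pair i (f i))"
      using code_seq_exists by blast
    note v = at_seq[OF this, unfolded less_succ_iff]
    have "rec_seq a G (n + 1) v"
      unfolding rec_seq_def
    proof (intro conjI allI impI)
      show "at v 0 = a" using u by (simp add: v f_def rec_seq_def)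
      fix i assume "i < n + 1"
      then have i: "i \<le> n" by simp
      then have "at v i = at u i" "at v (i + 1) = f (i + 1)" by (simp_all add: v f_def add_increasing2)
      moreover have "f (i + 1) = G i (at u i)"
        using u i by (cases "i < n") (auto simp: f_def rec_seq_def not_less dest: order_antisym)
      ultimately show "at v (i + 1) = G i (at v i)" by simp
    qed
    then show ?case by blast
  qed
qed

lemma prec_eq: "rec_seq a G n u \<Longrightarrow> i \<le> n \<Longrightarrow> prec a G i = at u i"
  unfolding prec_def
proof (rule the_equality)
  assume u: "rec_seq a G n u" "i \<le> n"
  then show "\<exists>v. rec_seq a G i v \<and> at v i = at u i"
    by (intro exI[of _ u]) (simp add: rec_seq_def)
  show "y = at u i" if "\<exists>v. rec_seq a G i v \<and> at v i = y" for y
    using that rec_seq_unique[OF _ u(1)] u(2) by blast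
qed

lemma prec:
  assumes "comp2 G"
  shows "prec a G 0 = a" "prec a G (n + 1) = G n (prec a G n)"
proof -
  obtain u where u: "rec_seq a G (n + 1) u" using rec_seq_exists[OF assms] by blast
  note * = prec_eq[OF u]
  have "n \<le> n + 1" by simp
  then show "prec a G 0 = a" "prec a G (n + 1) = G n (prec a G n)"
    using u by (simp_all add: * rec_seq_def)
qed

definition comp3 :: "('a \<Rightarrow> 'a \<Rightarrow> 'a \<Rightarrow> 'a) \<Rightarrow> bool" where
  "comp3 G \<longleftrightarrow> comp (\<lambda>z. G (pfst (pfst z)) (psnd (pfst z)) (psnd z))"

lemma comp3_compose:
  "comp3 G \<Longrightarrow> comp f \<Longrightarrow> comp g \<Longrightarrow> comp h \<Longrightarrow> comp (\<lambda>x. G (f x) (g x) (h x))"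
  unfolding comp3_def
  using comp_compose[of "\<lambda>z. G (pfst (pfst z)) (psnd (pfst z)) (psnd z)" "\<lambda>x. pair (pair (f x) (g x)) (h x)"]
  by (simp add: comp_pair)

text \<open>The graph is Sigma, since it asks for a course of values ending in y, and recursion is
  total, so \<open>comp_graph\<close> applies uniformly in the parameter x.\<close>

lemma comp_prec [eff]:
  assumes G: "comp (\<lambda>z. G (pfst (pfst z)) (psnd (pfst z)) (psnd z))" and "comp a" "comp n"
  shows "comp (\<lambda>x. prec (a x) (\<lambda>i d. G i d x) (n x))"
proof (rule comp_graph)
  note G3 = G[folded comp3_def]
  have "comp2 (\<lambda>i d. G i d x)" for x
    unfolding comp2_def by (intro comp3_compose[OF G3] eff)
  note ex = rec_seq_exists[OF this]
  have eq: "psnd z = prec (a (pfst z)) (\<lambda>i d. G i d (pfst z)) (n (pfst z)) \<longleftrightarrow>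
    (\<exists>u. rec_seq (a (pfst z)) (\<lambda>i d. G i d (pfst z)) (n (pfst z)) u \<and> psnd z = at u (n (pfst z)))"
    (is "_ = prec ?a ?G ?n \<longleftrightarrow> _") for z
  proof -
    obtain u where "rec_seq ?a ?G ?n u" using ex by blast
    moreover have "prec ?a ?G ?n = at v ?n" if "rec_seq ?a ?G ?n v" for v
      by (rule prec_eq[OF that order_refl])
    ultimately show ?thesis by metis
  qed
  show "sig (\<lambda>z. psnd z = prec (a (pfst z)) (\<lambda>i d. G i d (pfst z)) (n (pfst z)))"
    unfolding eq rec_seq_def
    by (intro sig_ex sig_dec eff comp3_compose[OF G3] comp_compose[OF assms(2)] comp_compose[OF assms(3)])
qed

section \<open>Counting and the pigeonhole principle\<close>

definition count :: "('a \<Rightarrow> bool) \<Rightarrow> 'a \<Rightarrow> 'a" where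
  "count P n = prec 0 (\<lambda>i c. if P i then c + 1 else c) n"

lemma comp_count [eff]:
  assumes "dec (\<lambda>z. P (pfst z) (psnd z))" "comp n"
  shows "comp (\<lambda>x. count (\<lambda>i. P i x) (n x))"
  unfolding count_def
  by (intro eff dec2_compose[OF assms(1)[folded dec2_def]] comp_compose[OF assms(2)])

lemma count:
  assumes "dec P"
  shows "count P 0 = 0" "count P (n + 1) = (if P n then count P n + 1 else count P n)"
proof -
  have *: "comp2 (\<lambda>i c. if P i then c + 1 else c)"
    unfolding comp2_def by (intro eff dec_compose[OF assms])
  show "count P 0 = 0" "count P (n + 1) = (if P n then count P n + 1 else count P n)"
    unfolding count_def prec[OF *] by simp_all
qed

lemma count_cong:
  assumes "dec P" "dec Q" "\<And>i. i < n \<Longrightarrow> P i \<longleftrightarrow> Q i"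
  shows "count P n = count Q n"
proof -
  have "dec (\<lambda>m. m \<le> n \<longrightarrow> count P m = count Q m)"
    by (intro eff dec_compose[OF assms(1)] dec_compose[OF assms(2)])
  then have "n \<le> n \<longrightarrow> count P n = count Q n"
  proof (induction n rule: dec_induct)
    case (succ m)
    then show ?case using assms(3) by (auto simp: count[OF assms(1)] count[OF assms(2)])
  qed (simp add: count assms)
  then show ?thesis by simp
qed

lemma count_mono:
  assumes "dec P" "m \<le> n" shows "count P m \<le> count P n"
proof -
  have "dec (\<lambda>n. m \<le> n \<longrightarrow> count P m \<le> count P n)" by (intro eff dec_compose[OF assms(1)])
  then have "m \<le> n \<longrightarrow> count P m \<le> count P n"
  proof (induction n rule: dec_induct)
    case (succ n)
    show ?case
    proof
      assume "m \<le> n + 1"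
      then consider "m = n + 1" | "m \<le> n" by (auto simp: le_less)
      then show "count P m \<le> count P (n + 1)"
        using succ by cases (auto simp: count[OF assms(1)] add_increasing2)
    qed
  qed simp
  then show ?thesis using assms(2) by blast
qed

lemma count_le:
  assumes "dec P" shows "count P n \<le> n"
proof -
  have "dec (\<lambda>n. count P n \<le> n)" by (intro eff dec_compose[OF assms(1)])
  then show ?thesis
    by (induction n rule: dec_induct) (simp_all add: count[OF assms(1)] add_increasing2)
qed

lemma count_less:
  assumes "dec P" "P x" "x < y" shows "count P x < count P y"
  using count_mono[OF assms(1), of "x + 1" y] assms by (simp add: count)

lemma count_eqD:
  assumes "dec P" "P x" "P y" "count P x = count P y" shows "x = y"
  using count_less[OF assms(1)] assms(2-4) by (metis linorder_neqE less_irrefl)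

lemma count_attains:
  assumes "dec P" "i < count P n" shows "\<exists>x<n. P x \<and> count P x = i"
proof -
  have "dec (\<lambda>n. i < count P n \<longrightarrow> (\<exists>x<n. P x \<and> count P x = i))"
    by (intro eff dec_compose[OF assms(1)])
  then have "i < count P n \<longrightarrow> (\<exists>x<n. P x \<and> count P x = i)"
  proof (induction n rule: dec_induct)
    case (succ n)
    show ?case
    proof
      assume i: "i < count P (n + 1)"
      show "\<exists>x<n + 1. P x \<and> count P x = i"
      proof (cases "i < count P n")
        case True
        then show ?thesis using succ less_imp_le by (metis less_succ_iff)
      next
        case False
        then have "P n" "i = count P n" using i by (auto simp: count[OF assms(1)] split: if_splits)
        then show ?thesis by auto
      qed
    qed
  qed (simp add: count assms)
  then show ?thesis using assms(2) by blast
qed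

lemma count_insert:
  assumes "dec P" "dec Q" "\<And>i. Q i \<longleftrightarrow> P i \<or> i = x" "\<not> P x" "x < n"
  shows "count Q n = count P n + 1"
proof -
  have "dec (\<lambda>n. count Q n = (if x < n then count P n + 1 else count P n))"
    by (intro eff dec_compose[OF assms(1)] dec_compose[OF assms(2)])
  then have "count Q n = (if x < n then count P n + 1 else count P n)"
  proof (induction n rule: dec_induct)
    case (succ n)
    consider "n < x" | "n = x" | "x < n" by (rule linorder_cases)
    then show ?case
      using succ assms(3)[of n] assms(4) by cases (auto simp: count assms(1,2))
  qed (simp add: count assms)
  then show ?thesis using assms(5) by simp
qed

text \<open>Each further value f k is new and lies below n, so it raises the count of the image by
  one.\<close>

lemma count_image:
  assumes "comp f" "\<And>i j. i < j \<Longrightarrow> j < m \<Longrightarrow> f i \<noteq> f j" "\<And>i. i < m \<Longrightarrow> f i < n"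
  shows "count (\<lambda>x. \<exists>i<m. x = f i) n = m"
proof -
  note F = comp_compose[OF assms(1)]
  have D: "dec (\<lambda>x. \<exists>i<k. x = f i)" for k by (intro eff F)
  have "dec (\<lambda>k. k \<le> m \<longrightarrow> count (\<lambda>x. \<exists>i<k. x = f i) n = k)" by (intro eff F)
  then have "m \<le> m \<longrightarrow> count (\<lambda>x. \<exists>i<m. x = f i) n = m"
  proof (induction m rule: dec_induct)
    case zero
    have "dec (\<lambda>k. count (\<lambda>x. \<exists>i<0. x = f i) k = 0)" by (intro eff F)
    then have "count (\<lambda>x. \<exists>i<0. x = f i) n = 0"
      by (induction n rule: dec_induct) (simp_all only: count[OF D], simp_all)
    then show ?case by simp
  next
    case (succ k)
    show ?case
    proof
      assume "k + 1 \<le> m"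
      then have k: "k < m" by simp
      have "count (\<lambda>x. \<exists>i<k + 1. x = f i) n = count (\<lambda>x. \<exists>i<k. x = f i) n + 1"
      proof (rule count_insert[OF D D])
        show "(\<exists>i<k + 1. x = f i) \<longleftrightarrow> (\<exists>i<k. x = f i) \<or> x = f k" for x
          by (auto simp: le_less)
        show "\<not> (\<exists>i<k. f k = f i)" using assms(2) k by metis
        show "f k < n" using assms(3) k .
      qed
      then show "count (\<lambda>x. \<exists>i<k + 1. x = f i) n = k + 1" using succ k by (simp add: less_imp_le)
    qed
  qed
  then show ?thesis by simp
qed

text \<open>If the values were distinct, n + 1 of them would be counted below n, against
  \<open>count_le\<close>.\<close>

lemma pigeonhole:
  assumes "comp f" "\<And>i. i \<le> n \<Longrightarrow> f i < n"
  obtains i j where "i < j" "j \<le> n" "f i = f j"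
proof -
  have "\<exists>i j. i < j \<and> j \<le> n \<and> f i = f j"
  proof (rule ccontr)
    assume neg: "\<not> ?thesis"
    have "count (\<lambda>x. \<exists>i<n + 1. x = f i) n = n + 1"
      by (rule count_image[OF assms(1)]) (use neg assms(2) in auto)
    moreover have "dec (\<lambda>x. \<exists>i<n + 1. x = f i)" by (intro eff comp_compose[OF assms(1)])
    ultimately show False using count_le[of "\<lambda>x. \<exists>i<n + 1. x = f i" n] by simp
  qed
  then show ?thesis using that by blast
qed


section \<open>Finite sequences and cardinality\<close>

definition seq :: "'a \<Rightarrow> 'a \<Rightarrow> bool" where
  "seq s l \<longleftrightarrow> fin s \<and>
    (\<forall>z. fmem z s \<longrightarrow> (\<exists>i v. z = pair i v \<and> i < l)) \<and>
    (\<forall>i. i < l \<longrightarrow> (\<exists>v. fmem (pair i v) s \<and> (\<forall>w. fmem (pair i w) s \<longrightarrow> w = v)))"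

definition card_is :: "'a \<Rightarrow> 'a \<Rightarrow> bool" where
  "card_is s l \<longleftrightarrow> (\<exists>f. seq f l \<and> (\<forall>i v. fmem (pair i v) f \<longrightarrow> fmem v s) \<and>
    (\<forall>v. fmem v s \<longrightarrow> (\<exists>i. fmem (pair i v) f \<and> (\<forall>j. fmem (pair j v) f \<longrightarrow> j = i))))"

definition size :: "'a \<Rightarrow> 'a" where
  "size s = count (\<lambda>x. fmem x s) s"

text \<open>The increasing enumeration of s, starting at position 0. The default s keeps the search
  total and exceeds every element.\<close>

definition el :: "'a \<Rightarrow> 'a \<Rightarrow> 'a" where
  "el s i = (LEAST x. fmem x s \<and> count (\<lambda>x. fmem x s) x = i \<or> x = s)"

lemma dec_seq [eff]: "comp f \<Longrightarrow> comp g \<Longrightarrow> dec (\<lambda>x. seq (f x) (g x))"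
proof (rule dec2_compose[of seq])
  have *: "seq = (\<lambda>s l. fin s \<and>
    (\<forall>z<s. fmem z s \<longrightarrow> (\<exists>i\<le>z. \<exists>v\<le>z. z = pair i v \<and> i < l)) \<and>
    (\<forall>i<l. \<exists>v<s. fmem (pair i v) s \<and> (\<forall>w<s. fmem (pair i w) s \<longrightarrow> w = v)))"
  proof (intro ext)
    fix s l
    have "(\<forall>z. fmem z s \<longrightarrow> (\<exists>i v. z = pair i v \<and> i < l)) \<longleftrightarrow>
        (\<forall>z<s. fmem z s \<longrightarrow> (\<exists>i\<le>z. \<exists>v\<le>z. z = pair i v \<and> i < l))"
      using fmem_less pair_ge by metis
    moreover have "(\<exists>v. fmem (pair i v) s \<and> (\<forall>w. fmem (pair i w) s \<longrightarrow> w = v)) \<longleftrightarrow>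
        (\<exists>v<s. fmem (pair i v) s \<and> (\<forall>w<s. fmem (pair i w) s \<longrightarrow> w = v))" for i
      using fmem_pair_less(2) by blast
    ultimately show "seq s l \<longleftrightarrow> fin s \<and>
        (\<forall>z<s. fmem z s \<longrightarrow> (\<exists>i\<le>z. \<exists>v\<le>z. z = pair i v \<and> i < l)) \<and>
        (\<forall>i<l. \<exists>v<s. fmem (pair i v) s \<and> (\<forall>w<s. fmem (pair i w) s \<longrightarrow> w = v))"
      unfolding seq_def by simp
  qed
  show "dec2 seq" unfolding dec2_def * by (intro eff)
qed

lemma comp_size [eff]: "comp f \<Longrightarrow> comp (\<lambda>x. size (f x))"
  by (rule comp_compose[of size]) (unfold size_def, intro eff)

lemma comp_el [eff]: "comp f \<Longrightarrow> comp g \<Longrightarrow> comp (\<lambda>x. el (f x) (g x))"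
  by (rule comp2_compose[of el]) (unfold comp2_def el_def, intro eff, blast)

lemma dec_fmem_set: "dec (\<lambda>x. fmem x s)"
  by (intro eff)

lemma seq_at:
  assumes "seq s l" shows "fmem (pair i v) s \<longleftrightarrow> i < l \<and> v = at s i"
proof -
  have *: "at s i = v" if v: "fmem (pair i v) s" for i v
  proof -
    have "i < l" using assms v unfolding seq_def by (metis pair_inject)
    then have u: "w = v" if "fmem (pair i w) s" for w
      using assms v that unfolding seq_def by metis
    show ?thesis
      unfolding at_def
    proof (rule Least_equality)
      show "fmem (pair i v) s \<or> v = s" using v ..
      show "v \<le> w" if "fmem (pair i w) s \<or> w = s" for w
        using that u less_imp_le[OF fmem_pair_less(2)[OF v]] by blast
    qed
  qed
  show ?thesis
  proof
    assume "fmem (pair i v) s"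
    then show "i < l \<and> v = at s i"
      using * assms unfolding seq_def by (metis pair_inject)
  next
    assume r: "i < l \<and> v = at s i"
    then obtain w where "fmem (pair i w) s" using assms unfolding seq_def by blast
    then show "fmem (pair i v) s" using * r by metis
  qed
qed

lemma card_is_range:
  assumes "comp f" "\<And>i j. i < j \<Longrightarrow> j < l \<Longrightarrow> f i \<noteq> f j" "\<And>x. fmem x s \<longleftrightarrow> (\<exists>i<l. x = f i)"
  shows "card_is s l"
proof -
  obtain u where u: "fin u" "\<forall>z. fmem z u \<longleftrightarrow> (\<exists>i<l. z = pair i (f i))"
    using code_seq_exists[OF assms(1)] by blast
  have m: "fmem (pair i v) u \<longleftrightarrow> i < l \<and> v = f i" for i v using u(2) by auto
  have inj: "i = j" if "i < l" "j < l" "f i = f j" for i j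
    using assms(2) that by (metis linorder_neqE)
  have "seq u l" unfolding seq_def m using u by auto
  moreover have "\<forall>i v. fmem (pair i v) u \<longrightarrow> fmem v s" unfolding m assms(3) by blast
  moreover have "\<forall>v. fmem v s \<longrightarrow> (\<exists>i. fmem (pair i v) u \<and> (\<forall>j. fmem (pair j v) u \<longrightarrow> j = i))"
    unfolding m assms(3) using inj by blast
  ultimately show ?thesis unfolding card_is_def by blast
qed

lemma size_range:
  assumes "comp f" "\<And>i j. i < j \<Longrightarrow> j < l \<Longrightarrow> f i \<noteq> f j" "\<And>x. fmem x s \<longleftrightarrow> (\<exists>i<l. x = f i)"
  shows "size s = l"
proof -
  have "count (\<lambda>x. \<exists>i<l. x = f i) s = l"
    by (rule count_image[OF assms(1,2)]) (use assms(3) fmem_less in auto)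
  then show ?thesis unfolding size_def assms(3) .
qed

lemma el:
  assumes "i < size s" shows "fmem (el s i) s" "count (\<lambda>x. fmem x s) (el s i) = i"
proof -
  let ?P = "\<lambda>x. fmem x s \<and> count (\<lambda>x. fmem x s) x = i \<or> x = s"
  obtain x where x: "x < s" "fmem x s" "count (\<lambda>x. fmem x s) x = i"
    using count_attains[OF dec_fmem_set] assms unfolding size_def by blast
  have "dec ?P" by (intro eff)
  from Least_dec[OF this, of x, folded el_def] have "?P (el s i)" "el s i \<le> x" using x by auto
  then show "fmem (el s i) s" "count (\<lambda>x. fmem x s) (el s i) = i" using x(1) by auto
qed

text \<open>Replaces the unbounded search for an enumeration by a computable count, which makes
  exact largeness decidable. Conversely, \<open>el s\<close> is such an enumeration.\<close>

lemma card_is_iff: "card_is s l \<longleftrightarrow> l = size s"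
proof
  assume "card_is s l"
  then obtain f where f: "seq f l" "\<And>i v. fmem (pair i v) f \<Longrightarrow> fmem v s"
    "\<And>v. fmem v s \<Longrightarrow> \<exists>i. fmem (pair i v) f \<and> (\<forall>j. fmem (pair j v) f \<longrightarrow> j = i)"
    unfolding card_is_def by blast
  note m = f(2,3)[unfolded seq_at[OF f(1)]]
  have "comp (at f)" by (intro comp_at eff)
  moreover have "at f i \<noteq> at f j" if "i < j" "j < l" for i j
    using m that by (metis less_irrefl less_trans)
  moreover have "fmem x s \<longleftrightarrow> (\<exists>i<l. x = at f i)" for x using m by blast
  ultimately show "l = size s" using size_range by metis
next
  assume l: "l = size s"
  have "comp (el s)" by (intro comp_el eff)
  moreover have "el s i \<noteq> el s j" if "i < j" "j < size s" for i j
    using el(2) that by (metis less_irrefl less_trans)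
  moreover have "fmem x s \<longleftrightarrow> (\<exists>i<size s. x = el s i)" for x
  proof
    assume x: "fmem x s"
    let ?i = "count (\<lambda>x. fmem x s) x"
    have i: "?i < size s"
      unfolding size_def using count_less[OF dec_fmem_set x fmem_less[OF x]] .
    then have "x = el s ?i" using count_eqD[OF dec_fmem_set x el(1)[OF i]] el(2)[OF i] by simp
    then show "\<exists>i<size s. x = el s i" using i by blast
  qed (use el in blast)
  ultimately show "card_is s l" unfolding l by (rule card_is_range)
qed

text \<open>\<open>el\<close> recovers f because the members below f i are exactly the values f j
  with j < i.\<close>

lemma increasing_set:
  assumes "comp f" and inc: "\<And>i j. i < j \<Longrightarrow> j < l \<Longrightarrow> f i < f j"
  obtains s where "fin s" "\<And>x. fmem x s \<longleftrightarrow> (\<exists>i<l. x = f i)" "size s = l"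
    "\<And>i. i < l \<Longrightarrow> el s i = f i"
proof -
  note F = comp_compose[OF assms(1)]
  obtain b where b: "\<forall>i<l. f i < b" using comp_bounded[OF assms(1)] by blast
  have D: "dec (\<lambda>x. \<exists>i<k. x = f i)" for k by (intro eff F)
  let ?s = "code b (\<lambda>x. \<exists>i<l. x = f i)"
  have m: "fmem x ?s \<longleftrightarrow> (\<exists>i<l. x = f i)" for x using code(1)[OF D] b by blast
  have neq: "f i \<noteq> f j" if "i < j" "j < l" for i j using inc[OF that] by simp
  have size: "size ?s = l" by (rule size_range[OF assms(1) neq m])
  have "el ?s i = f i" if i: "i < l" for i
  proof -
    have "count (\<lambda>x. fmem x ?s) (f i) = count (\<lambda>x. \<exists>j<i. x = f j) (f i)"
    proof (rule count_cong[OF dec_fmem_set D])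
      show "fmem x ?s \<longleftrightarrow> (\<exists>j<i. x = f j)" if "x < f i" for x
        unfolding m using that i inc by (metis less_asym less_trans linorder_neqE)
    qed
    also have "\<dots> = i"
      by (rule count_image[OF assms(1)]) (use neq inc i less_trans in blast)+
    finally have "count (\<lambda>x. fmem x ?s) (f i) = i" .
    moreover have "fmem (f i) ?s" using m i by blast
    ultimately show ?thesis
      using count_eqD[OF dec_fmem_set, of "el ?s i" ?s "f i"] el[of i ?s] i size by simp
  qed
  then show ?thesis using that[of ?s] code(2)[OF D] m size by blast
qed


section \<open>Exactly large sets\<close>

definition min_is :: "'a \<Rightarrow> 'a \<Rightarrow> bool" where
  "min_is s x \<longleftrightarrow> fmem x s \<and> (\<forall>y. fmem y s \<longrightarrow> x \<le> y)"

definition exl :: "'a \<Rightarrow> bool" where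
  "exl s \<longleftrightarrow> fin s \<and> (\<exists>x. min_is s x \<and> card_is s (x + 3))"

lemma dec_exl [eff]: "comp f \<Longrightarrow> dec (\<lambda>x. exl (f x))"
proof (rule dec_compose[of exl])
  have *: "exl = (\<lambda>s. fin s \<and> (\<exists>x<s. (fmem x s \<and> (\<forall>y<s. fmem y s \<longrightarrow> x \<le> y)) \<and> x + 3 = size s))"
    unfolding exl_def card_is_iff min_is_def by (intro ext) (use fmem_less in blast)
  show "dec exl" unfolding * by (intro eff)
qed

lemma increasing_exl:
  assumes "comp f" and inc: "\<And>i j. i < j \<Longrightarrow> j < f 0 + 3 \<Longrightarrow> f i < f j"
  obtains s where "exl s" "\<And>x. fmem x s \<longleftrightarrow> (\<exists>i<f 0 + 3. x = f i)"
    "\<And>i. i < f 0 + 3 \<Longrightarrow> el s i = f i"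
proof -
  obtain s where s: "fin s" "\<And>x. fmem x s \<longleftrightarrow> (\<exists>i<f 0 + 3. x = f i)" "size s = f 0 + 3"
    "\<And>i. i < f 0 + 3 \<Longrightarrow> el s i = f i"
    using increasing_set[OF assms] by blast
  have pos: "0 < f 0 + 3" by (simp add: zero_less_iff_neq_zero)
  have "f 0 \<le> f i" if "i < f 0 + 3" for i
    using inc[of 0 i] that by (cases "i = 0") (auto simp: zero_less_iff_neq_zero)
  then have "min_is s (f 0)" unfolding min_is_def s(2) using pos by blast
  then have "exl s" unfolding exl_def card_is_iff using s by metis
  then show ?thesis using that s by blast
qed

section \<open>Register machines\<close>

definition regv :: "'a \<Rightarrow> 'a \<Rightarrow> 'a \<Rightarrow> bool" where
  "regv r a v \<longleftrightarrow> fmem (pair a v) r \<or> v = 0 \<and> \<not> (\<exists>w. fmem (pair a w) r)"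

definition regup :: "'a \<Rightarrow> 'a \<Rightarrow> 'a \<Rightarrow> 'a \<Rightarrow> bool" where
  "regup r a v r' \<longleftrightarrow> (\<forall>b w. regv r' b w \<longleftrightarrow> b = a \<and> w = v \<or> b \<noteq> a \<and> regv r b w)"

definition reginit :: "'a \<Rightarrow> 'a \<Rightarrow> bool" where
  "reginit x r \<longleftrightarrow> (\<forall>b w. regv r b w \<longleftrightarrow> b = 0 \<and> w = x \<or> b \<noteq> 0 \<and> w = 0)"

definition step :: "('a \<Rightarrow> bool) \<Rightarrow> 'a \<Rightarrow> 'a \<Rightarrow> 'a \<Rightarrow> 'a \<Rightarrow> 'a \<Rightarrow> bool" where
  "step A e q r q' r' \<longleftrightarrow>
    (\<exists>a. fmem (pair q (pair 0 a)) e \<and> q' = q + 1 \<and> regup r a 0 r') \<or>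
    (\<exists>a v. fmem (pair q (pair 1 a)) e \<and> regv r a v \<and> q' = q + 1 \<and> regup r a (v + 1) r') \<or>
    (\<exists>a b v. fmem (pair q (pair 2 (pair a b))) e \<and> regv r a v \<and> q' = q + 1 \<and> regup r b v r') \<or>
    (\<exists>a b p v w. fmem (pair q (pair 3 (pair a (pair b p)))) e \<and> regv r a v \<and> regv r b w \<and>
      (v = w \<and> q' = p \<or> v \<noteq> w \<and> q' = q + 1) \<and> r' = r) \<or>
    (\<exists>a v. fmem (pair q (pair 4 a)) e \<and> regv r a v \<and> q' = q + 1 \<and>
      (A v \<and> regup r a 1 r' \<or> \<not> A v \<and> regup r a 0 r'))"

definition run :: "('a \<Rightarrow> bool) \<Rightarrow> 'a \<Rightarrow> 'a \<Rightarrow> 'a \<Rightarrow> 'a \<Rightarrow> 'a \<Rightarrow> bool" where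
  "run A e x l c n \<longleftrightarrow> seq c (n + 1) \<and>
    (\<exists>r. fmem (pair 0 (pair 0 r)) c \<and> reginit x r) \<and>
    (\<forall>t. t < n \<longrightarrow> (\<exists>q r q' r'. fmem (pair t (pair q r)) c \<and> fmem (pair (t + 1) (pair q' r')) c \<and>
      step A e q r q' r')) \<and>
    (\<exists>q r. fmem (pair n (pair q r)) c \<and> l \<le> q)"

definition halts :: "('a \<Rightarrow> bool) \<Rightarrow> 'a \<Rightarrow> 'a \<Rightarrow> bool" where
  "halts A e x \<longleftrightarrow> (\<exists>l. seq e l \<and> (\<exists>c n. run A e x l c n))"

text \<open>Program length, computation and number of steps are packed into one number, so that a
  single bound on w controls the whole computation.\<close>

definition halting_code :: "('a \<Rightarrow> bool) \<Rightarrow> 'a \<Rightarrow> 'a \<Rightarrow> bool" where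
  "halting_code A e w \<longleftrightarrow> (\<exists>l c n. w = pair l (pair c n) \<and> seq e l \<and> run A e e l c n)"

lemma halts_iff: "halts A e e \<longleftrightarrow> (\<exists>w. halting_code A e w)"
  unfolding halts_def halting_code_def by blast

lemma fmem_pair_le:
  "fmem (pair i j) s \<Longrightarrow> i \<le> s" "fmem (pair i j) s \<Longrightarrow> j \<le> s"
  "fmem (pair i (pair j k)) s \<Longrightarrow> j \<le> s" "fmem (pair i (pair j k)) s \<Longrightarrow> k \<le> s"
  using fmem_pair_less[of i j s] fmem_pair_less[of i "pair j k" s] pair_ge[of j k] pair_ge[of k j]
  by auto

lemma fmem_quad_le:
  "fmem (pair i (pair j (pair k m))) s \<Longrightarrow> k \<le> s" "fmem (pair i (pair j (pair k m))) s \<Longrightarrow> m \<le> s"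
  using fmem_pair_le(4)[of i j "pair k m" s] pair_ge(1)[of k m] pair_ge(2)[of m k] by auto

lemma fmem_quint_le:
  "fmem (pair i (pair j (pair k (pair m n)))) s \<Longrightarrow> m \<le> s"
  "fmem (pair i (pair j (pair k (pair m n)))) s \<Longrightarrow> n \<le> s"
  using fmem_quad_le(2)[of i j k "pair m n" s] pair_ge(1)[of m n] pair_ge(2)[of n m] by auto

lemma regv_le: "regv r a v \<Longrightarrow> v \<le> r"
  unfolding regv_def using fmem_pair_le by auto

lemma regv_beyond: "r \<le> a \<Longrightarrow> regv r a v \<longleftrightarrow> v = 0"
  unfolding regv_def using fmem_pair_less(1) by (metis not_le)

lemma dec_regv [eff]:
  assumes "comp r" "comp a" "comp v" shows "dec (\<lambda>x. regv (r x) (a x) (v x))"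
proof -
  have *: "regv r a v \<longleftrightarrow> fmem (pair a v) r \<or> v = 0 \<and> \<not> (\<exists>w\<le>r. fmem (pair a w) r)" for r a v
    unfolding regv_def using fmem_pair_le(2) by blast
  show ?thesis unfolding * by (intro eff assms comp_compose[OF assms(1)] comp_compose[OF assms(2)])
qed

lemma dec_regup [eff]:
  assumes "comp r" "comp a" "comp v" "comp r'" shows "dec (\<lambda>x. regup (r x) (a x) (v x) (r' x))"
proof -
  \<comment> \<open>Outside the box the two sides agree on their own: registers beyond r + r' + a
    contain 0 before and after, and no register contains a value beyond r + r' + v.\<close>
  have *: "regup r a v r' \<longleftrightarrow> (\<forall>b\<le>r + r' + a. \<forall>w\<le>r + r' + v.
      regv r' b w \<longleftrightarrow> b = a \<and> w = v \<or> b \<noteq> a \<and> regv r b w)" (is "_ \<longleftrightarrow> ?B") for r a v r'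
  proof
    assume B: ?B
    show "regup r a v r'"
      unfolding regup_def
    proof (intro allI)
      fix b w
      consider "b \<le> r + r' + a" "w \<le> r + r' + v" | "r + r' + a < b" | "r + r' + v < w"
        using not_le by blast
      then show "regv r' b w \<longleftrightarrow> b = a \<and> w = v \<or> b \<noteq> a \<and> regv r b w"
      proof cases
        case 2
        have "r \<le> r + r' + a" "r' \<le> r + r' + a" "a \<le> r + r' + a"
          by (simp_all add: add_increasing add_increasing2)
        then have "r \<le> b" "r' \<le> b" "a < b" using 2 by (meson le_less_trans less_imp_le)+
        then show ?thesis by (auto simp: regv_beyond)
      next
        case 3
        have "r \<le> r + r' + v" "r' \<le> r + r' + v" "v \<le> r + r' + v"
          by (simp_all add: add_increasing add_increasing2)
        then have "r < w" "r' < w" "v < w" using 3 by (meson le_less_trans)+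
        then show ?thesis using regv_le by (metis not_le less_irrefl)
      qed (use B in blast)
    qed
  qed (simp add: regup_def)
  show ?thesis
    unfolding * by (intro eff comp_compose[OF assms(1)] comp_compose[OF assms(2)]
        comp_compose[OF assms(3)] comp_compose[OF assms(4)] assms)
qed

lemma dec_reginit [eff]:
  assumes "comp r" "comp y" shows "dec (\<lambda>x. reginit (y x) (r x))"
proof -
  have *: "reginit y r \<longleftrightarrow> (\<forall>b\<le>r. \<forall>w\<le>r + y. regv r b w \<longleftrightarrow> b = 0 \<and> w = y \<or> b \<noteq> 0 \<and> w = 0)"
    (is "_ \<longleftrightarrow> ?B") for y r
  proof
    assume B: ?B
    show "reginit y r"
      unfolding reginit_def
    proof (intro allI)
      fix b w
      consider "b \<le> r" "w \<le> r + y" | "r < b" | "r + y < w"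
        using not_le by blast
      then show "regv r b w \<longleftrightarrow> b = 0 \<and> w = y \<or> b \<noteq> 0 \<and> w = 0"
      proof cases
        case 2
        then show ?thesis by (auto simp: regv_beyond less_imp_le)
      next
        case 3
        have "r \<le> r + y" "y \<le> r + y" "0 \<le> r + y"
          by (simp_all add: add_increasing add_increasing2)
        then have "r < w" "y < w" "0 < w" using 3 by (meson le_less_trans)+
        then show ?thesis using regv_le by (metis not_le less_irrefl)
      qed (use B in blast)
    qed
  qed (simp add: reginit_def)
  show ?thesis
    unfolding * by (intro eff comp_compose[OF assms(1)] comp_compose[OF assms(2)] assms)
qed

lemma dec_step [eff]:
  assumes A: "dec (\<lambda>z. A (pfst z) (psnd z))" and c: "comp e" "comp q" "comp r" "comp q'" "comp r'"
  shows "dec (\<lambda>x. step (\<lambda>v. A v x) (e x) (q x) (r x) (q' x) (r' x))"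
proof -
  note f = c[THEN comp_compose]
  note A2 = dec2_compose[OF A[folded dec2_def]]
  have 1: "(\<exists>a. fmem (pair q (pair 0 a)) e \<and> q' = q + 1 \<and> regup r a 0 r') \<longleftrightarrow>
      (\<exists>a\<le>e. fmem (pair q (pair 0 a)) e \<and> q' = q + 1 \<and> regup r a 0 r')" for e q r q' r'
    using fmem_pair_le(4) by blast
  have 2: "(\<exists>a v. fmem (pair q (pair 1 a)) e \<and> regv r a v \<and> q' = q + 1 \<and> regup r a (v + 1) r') \<longleftrightarrow>
      (\<exists>a\<le>e. \<exists>v\<le>r. fmem (pair q (pair 1 a)) e \<and> regv r a v \<and> q' = q + 1 \<and> regup r a (v + 1) r')"
    for e q r q' r'
    using fmem_pair_le(4) regv_le by blast
  have 3: "(\<exists>a b v. fmem (pair q (pair 2 (pair a b))) e \<and> regv r a v \<and> q' = q + 1 \<and> regup r b v r') \<longleftrightarrow>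
      (\<exists>a\<le>e. \<exists>b\<le>e. \<exists>v\<le>r. fmem (pair q (pair 2 (pair a b))) e \<and> regv r a v \<and> q' = q + 1 \<and>
        regup r b v r')" for e q r q' r'
    using fmem_quad_le regv_le by blast
  have 4: "(\<exists>a b p v w. fmem (pair q (pair 3 (pair a (pair b p)))) e \<and> regv r a v \<and> regv r b w \<and>
      (v = w \<and> q' = p \<or> v \<noteq> w \<and> q' = q + 1) \<and> r' = r) \<longleftrightarrow>
      (\<exists>a\<le>e. \<exists>b\<le>e. \<exists>p\<le>e. \<exists>v\<le>r. \<exists>w\<le>r. fmem (pair q (pair 3 (pair a (pair b p)))) e \<and> regv r a v \<and>
      regv r b w \<and> (v = w \<and> q' = p \<or> v \<noteq> w \<and> q' = q + 1) \<and> r' = r)" (is "?l \<longleftrightarrow> ?r") for e q r q' r'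
  proof
    assume ?l
    then obtain a b p v w where *: "fmem (pair q (pair 3 (pair a (pair b p)))) e" "regv r a v"
      "regv r b w" "(v = w \<and> q' = p \<or> v \<noteq> w \<and> q' = q + 1) \<and> r' = r" by blast
    with fmem_quad_le(1)[OF *(1)] fmem_quint_le[OF *(1)] regv_le[OF *(2)] regv_le[OF *(3)]
    show ?r by blast
  qed blast
  have 5: "(\<exists>a v. fmem (pair q (pair 4 a)) e \<and> regv r a v \<and> q' = q + 1 \<and>
      (A v \<and> regup r a 1 r' \<or> \<not> A v \<and> regup r a 0 r')) \<longleftrightarrow>
      (\<exists>a\<le>e. \<exists>v\<le>r. fmem (pair q (pair 4 a)) e \<and> regv r a v \<and> q' = q + 1 \<and>
      (A v \<and> regup r a 1 r' \<or> \<not> A v \<and> regup r a 0 r'))" for A e q r q' r'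
    using fmem_pair_le(4) regv_le by blast
  have d1: "dec (\<lambda>x. \<exists>a\<le>e x. fmem (pair (q x) (pair 0 a)) (e x) \<and> q' x = q x + 1 \<and>
      regup (r x) a 0 (r' x))"
    by (intro eff f c)
  have d2: "dec (\<lambda>x. \<exists>a\<le>e x. \<exists>v\<le>r x. fmem (pair (q x) (pair 1 a)) (e x) \<and> regv (r x) a v \<and>
      q' x = q x + 1 \<and> regup (r x) a (v + 1) (r' x))"
    by (intro eff f c)
  have d3: "dec (\<lambda>x. \<exists>a\<le>e x. \<exists>b\<le>e x. \<exists>v\<le>r x. fmem (pair (q x) (pair 2 (pair a b))) (e x) \<and>
      regv (r x) a v \<and> q' x = q x + 1 \<and> regup (r x) b v (r' x))"
    by (intro eff f c)
  have d4: "dec (\<lambda>x. \<exists>a\<le>e x. \<exists>b\<le>e x. \<exists>p\<le>e x. \<exists>v\<le>r x. \<exists>w\<le>r x.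
      fmem (pair (q x) (pair 3 (pair a (pair b p)))) (e x) \<and> regv (r x) a v \<and>
      regv (r x) b w \<and> (v = w \<and> q' x = p \<or> v \<noteq> w \<and> q' x = q x + 1) \<and> r' x = r x)"
    by (intro eff f c)
  have d5: "dec (\<lambda>x. \<exists>a\<le>e x. \<exists>v\<le>r x. fmem (pair (q x) (pair 4 a)) (e x) \<and> regv (r x) a v \<and>
      q' x = q x + 1 \<and> (A v x \<and> regup (r x) a 1 (r' x) \<or> \<not> A v x \<and> regup (r x) a 0 (r' x)))"
    by (intro eff f c A2)
  show ?thesis
    unfolding step_def 1 2 3 4 5 by (intro dec_disj d1 d2 d3 d4 d5)
qed

lemma run_bounded:
  "run A e x l c n \<longleftrightarrow> seq c (n + 1) \<and>
    (\<exists>r\<le>c. fmem (pair 0 (pair 0 r)) c \<and> reginit x r) \<and>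
    (\<forall>t<n. \<exists>q\<le>c. \<exists>r\<le>c. \<exists>q'\<le>c. \<exists>r'\<le>c. fmem (pair t (pair q r)) c \<and>
      fmem (pair (t + 1) (pair q' r')) c \<and> step A e q r q' r') \<and>
    (\<exists>q\<le>c. \<exists>r\<le>c. fmem (pair n (pair q r)) c \<and> l \<le> q)"
proof -
  have "(\<exists>r. fmem (pair 0 (pair 0 r)) c \<and> reginit x r) \<longleftrightarrow>
      (\<exists>r\<le>c. fmem (pair 0 (pair 0 r)) c \<and> reginit x r)"
    using fmem_pair_le(4) by blast
  moreover have "(\<exists>q r q' r'. fmem (pair t (pair q r)) c \<and> fmem (pair (t + 1) (pair q' r')) c \<and>
        step A e q r q' r') \<longleftrightarrow>
      (\<exists>q\<le>c. \<exists>r\<le>c. \<exists>q'\<le>c. \<exists>r'\<le>c. fmem (pair t (pair q r)) c \<and>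
        fmem (pair (t + 1) (pair q' r')) c \<and> step A e q r q' r')" for t
    using fmem_pair_le(3,4) by blast
  moreover have "(\<exists>q r. fmem (pair n (pair q r)) c \<and> l \<le> q) \<longleftrightarrow>
      (\<exists>q\<le>c. \<exists>r\<le>c. fmem (pair n (pair q r)) c \<and> l \<le> q)"
    using fmem_pair_le(3,4) by blast
  ultimately show ?thesis unfolding run_def by simp
qed

lemma dec_halting_code [eff]:
  assumes A: "dec (\<lambda>z. A (pfst z) (psnd z))" and c: "comp e" "comp w"
  shows "dec (\<lambda>x. halting_code (\<lambda>v. A v x) (e x) (w x))"
proof -
  note f = c[THEN comp_compose]
  note A2 = dec2_compose[OF A[folded dec2_def]]
  have *: "halting_code A e w \<longleftrightarrow> w = pair (pfst w) (pair (pfst (psnd w)) (psnd (psnd w))) \<and>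
      seq e (pfst w) \<and> run A e e (pfst w) (pfst (psnd w)) (psnd (psnd w))" for A e w
    unfolding halting_code_def by (metis pfst_pair psnd_pair)
  show ?thesis
    unfolding * run_bounded by (intro eff f c A2)
qed

lemma step_local:
  assumes "step A e q r q' r'" "\<And>v. v \<le> r \<Longrightarrow> A v \<longleftrightarrow> B v"
  shows "step B e q r q' r'"
proof -
  have "(\<exists>a v. fmem (pair q (pair 4 a)) e \<and> regv r a v \<and> q' = q + 1 \<and>
      (A v \<and> regup r a 1 r' \<or> \<not> A v \<and> regup r a 0 r')) \<longleftrightarrow>
    (\<exists>a v. fmem (pair q (pair 4 a)) e \<and> regv r a v \<and> q' = q + 1 \<and>
      (B v \<and> regup r a 1 r' \<or> \<not> B v \<and> regup r a 0 r'))"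
    using assms(2) regv_le by meson
  then show ?thesis using assms(1) unfolding step_def by simp
qed

text \<open>The use principle: a queried number is the content of a register, hence bounded by the
  code of the memory and so by w.\<close>

lemma halting_code_local:
  assumes "halting_code A e w" "\<And>v. v \<le> w \<Longrightarrow> A v \<longleftrightarrow> B v"
  shows "halting_code B e w"
proof -
  obtain l c n where w: "w = pair l (pair c n)" "seq e l" and run: "run A e e l c n"
    using assms(1) unfolding halting_code_def by blast
  have "c \<le> w" using w(1) pair_ge(1)[of c n] pair_ge(2)[of "pair c n" l] by simp
  then have AB: "A v \<longleftrightarrow> B v" if "v \<le> c" for v using assms(2) that by simp
  have "\<exists>q r q' r'. fmem (pair t (pair q r)) c \<and> fmem (pair (t + 1) (pair q' r')) c \<and>
      step B e q r q' r'" if t: "t < n" for t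
  proof -
    obtain q r q' r' where s: "fmem (pair t (pair q r)) c" "fmem (pair (t + 1) (pair q' r')) c"
      "step A e q r q' r'"
      using run t unfolding run_def by blast
    have "step B e q r q' r'"
      by (rule step_local[OF s(3)]) (use AB fmem_pair_le(4)[OF s(1)] in auto)
    then show ?thesis using s by blast
  qed
  then have "run B e e l c n" using run unfolding run_def by simp
  then show ?thesis using w unfolding halting_code_def by blast
qed

text \<open>The input e sits in register 0 of the initial memory, which is recorded in the
  computation. Hence an approximation that bounds computations may be cut off at arguments below the
  same bound without loss.\<close>

lemma halting_code_le: "halting_code A e w \<Longrightarrow> e \<le> w"
proof -
  assume "halting_code A e w"
  then obtain l c n r where w: "w = pair l (pair c n)" and r: "fmem (pair 0 (pair 0 r)) c" "reginit e r"
    unfolding halting_code_def run_def by blast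
  have "e \<le> r" using r(2) regv_le unfolding reginit_def by blast
  also have "r \<le> c" using fmem_pair_le(4)[OF r(1)] .
  also have "c \<le> w" using w pair_ge(1)[of c n] pair_ge(2)[of "pair c n" l] by simp
  finally show ?thesis .
qed


section \<open>Approximations of iterated jumps\<close>

text \<open>Stage 0 consults the set X, which in general no number codes; later stages consult the
  finite set coded by d.\<close>

definition query :: "'a set \<Rightarrow> 'a \<Rightarrow> 'a \<Rightarrow> 'a \<Rightarrow> bool" where
  "query X j d v \<longleftrightarrow> j = 0 \<and> v \<in> X \<or> j \<noteq> 0 \<and> fmem v d"

text \<open>All stages arise as codes of finite sets in one recursion of the model, so i may be
  nonstandard. At stage j + 1 arguments and computations are cut off at the same bound g j.\<close>

definition jumps :: "'a set \<Rightarrow> ('a \<Rightarrow> 'a) \<Rightarrow> 'a \<Rightarrow> 'a" where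
  "jumps X g i = prec 0 (\<lambda>j d. code (g j) (\<lambda>p. \<exists>w<g j. halting_code (query X j d) p w)) i"

text \<open>
  \<open>approx X f m i\<close> approximates the \<open>i\<close>-th jump of \<open>X\<close>: the \<open>j\<close>-th quantifier over computations is
  bounded by \<open>f (m + j)\<close>, where the outermost one has number 1.
\<close>

definition approx :: "'a set \<Rightarrow> ('a \<Rightarrow> 'a) \<Rightarrow> 'a \<Rightarrow> 'a \<Rightarrow> 'a \<Rightarrow> bool" where
  "approx X f m i = query X i (jumps X (\<lambda>l. f (m + i - l)) i)"

context
  fixes X assumes X: "X \<in> range S"
begin

lemma dec_query [eff]:
  "comp f \<Longrightarrow> comp g \<Longrightarrow> comp h \<Longrightarrow> dec (\<lambda>x. query X (f x) (g x) (h x))"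
  unfolding query_def by (intro eff X)

lemma comp_jumps [eff]:
  assumes g: "comp (\<lambda>z. g (pfst z) (psnd z))" and i: "comp i"
  shows "comp (\<lambda>x. jumps X (\<lambda>j. g j x) (i x))"
  unfolding jumps_def by (intro eff comp2_compose[OF g[folded comp2_def]] i)

lemma dec_approx [eff]:
  assumes f: "comp (\<lambda>z. f (pfst z) (psnd z))" and c: "comp m" "comp i" "comp p"
  shows "dec (\<lambda>x. approx X (\<lambda>l. f l x) (m x) (i x) (p x))"
  unfolding approx_def
  by (intro eff comp2_compose[OF f[folded comp2_def]] c c[THEN comp_compose])

lemma fmem_jumps_succ:
  assumes g: "comp g"
  shows "fmem p (jumps X g (j + 1)) \<longleftrightarrow> (\<exists>w<g j. halting_code (query X j (jumps X g j)) p w)"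
proof -
  let ?G = "\<lambda>j d. code (g j) (\<lambda>p. \<exists>w<g j. halting_code (query X j d) p w)"
  have "comp2 ?G" unfolding comp2_def by (intro eff comp_compose[OF g])
  from prec(2)[OF this, of 0 j]
  have *: "jumps X g (j + 1) = ?G j (jumps X g j)" unfolding jumps_def .
  have "dec (\<lambda>p. \<exists>w<g j. halting_code (query X j (jumps X g j)) p w)" by (intro eff)
  from code(1)[OF this, of p "g j"] show ?thesis
    unfolding * using halting_code_le le_less_trans by blast
qed

lemma jumps_cong:
  assumes "comp g" "comp h" "\<And>j. j < i \<Longrightarrow> g j = h j"
  shows "jumps X g i = jumps X h i"
proof -
  let ?G = "\<lambda>g j d. code (g j) (\<lambda>p. \<exists>w<g j. halting_code (query X j d) p w)"
  have G: "comp2 (?G g)" "comp2 (?G h)"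
    unfolding comp2_def by (intro eff comp_compose[OF assms(1)] comp_compose[OF assms(2)])+
  have "dec (\<lambda>k. k \<le> i \<longrightarrow> jumps X g k = jumps X h k)"
    by (intro eff comp_compose[OF assms(1)] comp_compose[OF assms(2)])
  then have "i \<le> i \<longrightarrow> jumps X g i = jumps X h i"
  proof (induction i rule: dec_induct)
    case zero
    then show ?case unfolding jumps_def prec(1)[OF G(1)] prec(1)[OF G(2)] by simp
  next
    case (succ k)
    show ?case
    proof
      assume "k + 1 \<le> i"
      then have "k < i" by simp
      then show "jumps X g (k + 1) = jumps X h (k + 1)"
        using succ assms(3)[of k] unfolding jumps_def prec(2)[OF G(1)] prec(2)[OF G(2)] by simp
    qed
  qed
  then show ?thesis by simp
qed

lemma approx_0: "approx X f m 0 p \<longleftrightarrow> p \<in> X"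
  by (simp add: approx_def query_def)

text \<open>Peeling off the outermost quantifier shifts the start by one: its bound is f (m + 1),
  and the remaining bounds begin after position m + 1.\<close>

lemma approx_succ:
  assumes "comp f"
  shows "approx X f m (i + 1) p \<longleftrightarrow> (\<exists>w<f (m + 1). halting_code (approx X f (m + 1) i) p w)"
proof -
  have "comp (\<lambda>l. f (m + 1 + i - l))" by (intro eff comp_compose[OF assms])
  from fmem_jumps_succ[OF this, of p i]
  have "fmem p (jumps X (\<lambda>l. f (m + 1 + i - l)) (i + 1)) \<longleftrightarrow>
      (\<exists>w<f (m + 1). halting_code (approx X f (m + 1) i) p w)"
    unfolding approx_def by simp
  moreover have "m + (i + 1) = m + 1 + i" by (simp add: ac_simps)
  ultimately show ?thesis by (simp only: approx_def[of X f m] query_def[of X "i + 1"]) simp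
qed

text \<open>Only the positions m + 1 to m + i enter, so an approximation along the enumeration of an
  infinite set can be read off from a finite subset.\<close>

lemma approx_cong:
  assumes "comp f" "comp g" "\<And>l. l \<noteq> 0 \<Longrightarrow> l \<le> i \<Longrightarrow> f (m + l) = g (n + l)"
  shows "approx X f m i p \<longleftrightarrow> approx X g n i p"
proof -
  have "jumps X (\<lambda>l. f (m + i - l)) i = jumps X (\<lambda>l. g (n + i - l)) i"
  proof (rule jumps_cong)
    fix l assume "l < i"
    then obtain d where d: "i = l + d" "d \<noteq> 0" by (metis add.right_neutral le_iff_add less_imp_le less_irrefl)
    have "m + i - l = m + d" "n + i - l = n + d" by (simp_all add: d add.left_commute)
    then show "f (m + i - l) = g (n + i - l)" using assms(3)[of d] d by (simp add: add_increasing)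
  qed (intro eff comp_compose[OF assms(1)] comp_compose[OF assms(2)])+
  then show ?thesis by (simp add: approx_def)
qed

end

section \<open>Binary numbers\<close>

text \<open>Packs a pattern of n truth values into one number below \<open>pow2 n\<close>, so that
  the pigeonhole principle applies to patterns.\<close>

definition bin :: "('a \<Rightarrow> bool) \<Rightarrow> 'a \<Rightarrow> 'a" where
  "bin P n = prec 0 (\<lambda>i b. if P i then 2 * b + 1 else 2 * b) n"

definition pow2 :: "'a \<Rightarrow> 'a" where
  "pow2 n = prec 1 (\<lambda>i b. 2 * b) n"

lemma comp_bin [eff]:
  assumes P: "dec (\<lambda>z. P (pfst z) (psnd z))" and n: "comp n"
  shows "comp (\<lambda>x. bin (\<lambda>i. P i x) (n x))"
  unfolding bin_def by (intro eff dec2_compose[OF P[folded dec2_def]] comp_compose[OF n] n)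

lemma bin:
  assumes P: "dec P"
  shows "bin P 0 = 0" "bin P (n + 1) = (if P n then 2 * bin P n + 1 else 2 * bin P n)"
proof -
  have *: "comp2 (\<lambda>i b. if P i then 2 * b + 1 else 2 * b)"
    unfolding comp2_def by (intro eff dec_compose[OF P])
  show "bin P 0 = 0" "bin P (n + 1) = (if P n then 2 * bin P n + 1 else 2 * bin P n)"
    unfolding bin_def prec[OF *] by simp_all
qed

lemma pow2: "pow2 0 = 1" "pow2 (n + 1) = 2 * pow2 n"
proof -
  have *: "comp2 (\<lambda>i b. 2 * b)" unfolding comp2_def by (intro eff)
  show "pow2 0 = 1" "pow2 (n + 1) = 2 * pow2 n" unfolding pow2_def prec[OF *] by simp_all
qed

lemma bin_less:
  assumes P: "dec P" shows "bin P n < pow2 n"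
proof -
  have "comp pow2" unfolding pow2_def by (intro eff)
  then have "dec (\<lambda>n. bin P n < pow2 n)" by (intro eff dec_compose[OF P])
  then show ?thesis
  proof (induction n rule: dec_induct)
    case (succ n)
    then have "2 * (bin P n + 1) \<le> 2 * pow2 n" by (intro mult_left_mono) auto
    moreover have "2 * (bin P n + 1) = 2 * bin P n + 1 + 1" 
      by (simp only: distrib_left mult_1_right add.assoc one_add_one)
    ultimately have "2 * bin P n + 1 + 1 \<le> pow2 (n + 1)" unfolding pow2 by simp
    then have "2 * bin P n + 1 < pow2 (n + 1)" unfolding succ_le_iff .
    moreover from this have "2 * bin P n < pow2 (n + 1)" by (rule less_trans[rotated]) simp
    ultimately show ?case unfolding bin[OF P] by simp
  qed (simp add: bin[OF P] pow2)
qed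

lemma bin_inject:
  assumes P: "dec P" and Q: "dec Q" and "bin P n = bin Q n" "i < n"
  shows "P i \<longleftrightarrow> Q i"
proof -
  have "dec (\<lambda>n. bin P n = bin Q n \<longrightarrow> (\<forall>i<n. P i \<longleftrightarrow> Q i))"
    by (intro eff dec_compose[OF P] dec_compose[OF Q])
  then have "bin P n = bin Q n \<longrightarrow> (\<forall>i<n. P i \<longleftrightarrow> Q i)"
  proof (induction n rule: dec_induct)
    case (succ n)
    show ?case
    proof
      assume eq: "bin P (n + 1) = bin Q (n + 1)"
      have "(P n \<longleftrightarrow> Q n) \<and> bin P n = bin Q n"
        using eq arith_parity[of "bin P n" "bin Q n"] arith_parity[of "bin Q n" "bin P n"]
        by (auto simp: bin[OF P] bin[OF Q] split: if_splits)
      then show "\<forall>i<n + 1. P i \<longleftrightarrow> Q i" using succ by (auto simp: le_less)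
    qed
  qed simp
  then show ?thesis using assms(3,4) by blast
qed


section \<open>The colouring\<close>

definition infinite_in :: "'a set \<Rightarrow> bool" where
  "infinite_in X \<longleftrightarrow> (\<forall>x. \<exists>y. x < y \<and> y \<in> X)"

definition colouring :: "'a set \<Rightarrow> bool" where
  "colouring C \<longleftrightarrow>
    (\<forall>z. z \<in> C \<longrightarrow> (\<exists>s c. z = pair s c \<and> exl s \<and> c < 2)) \<and>
    (\<forall>s. exl s \<longrightarrow> (\<exists>c. pair s c \<in> C \<and> (\<forall>d. pair s d \<in> C \<longrightarrow> d = c)))"

definition omega_jump :: "'a set \<Rightarrow> 'a set \<Rightarrow> bool" where
  "omega_jump X Y \<longleftrightarrow>
    (\<forall>z. z \<in> Y \<longrightarrow> (\<exists>x i. z = pair x i)) \<and>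
    (\<forall>x. pair x 0 \<in> Y \<longleftrightarrow> x \<in> X) \<and>
    (\<forall>i x. pair x (i + 1) \<in> Y \<longleftrightarrow> halts (\<lambda>y. pair y i \<in> Y) x x)"

text \<open>An exactly large set with minimum \<open>2 j\<close> has two blocks of \<open>level (2 j) = j + 1\<close> further elements.\<close>

definition level :: "'a \<Rightarrow> 'a" where
  "level x = (LEAST k. x \<le> 2 * k) + 1"

lemma level_even [simp]: "level (2 * j) = j + 1"
proof -
  have "(LEAST k. 2 * j \<le> 2 * k) = j" by (rule Least_equality) simp_all
  then show ?thesis by (simp add: level_def)
qed

lemma comp_level [eff]: "comp f \<Longrightarrow> comp (\<lambda>x. level (f x))"
proof (rule comp_compose[of level])
  have "\<exists>k. x \<le> 2 * k" for x :: 'a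
    by (intro exI[of _ x]) (use mult_le_self[of 2 x] in \<open>simp add: mult.commute\<close>)
  then show "comp level" unfolding level_def by (intro comp_add comp_Least eff)
qed

text \<open>\<open>approx\<close> reads from the position after its start, so the starts 0 and
  \<open>level (el s 0)\<close> belong to adjacent blocks without overlap.\<close>

definition stable :: "'a set \<Rightarrow> 'a \<Rightarrow> bool" where
  "stable X s \<longleftrightarrow> (\<forall>i\<le>level (el s 0). \<forall>p<el s 0.
    approx X (el s) 0 i p \<longleftrightarrow> approx X (el s) (level (el s 0)) i p)"

lemma dec_stable [eff]: "X \<in> range S \<Longrightarrow> comp f \<Longrightarrow> dec (\<lambda>x. stable X (f x))"
  by (rule dec_compose[of "stable X"]) (unfold stable_def, intro eff dec_approx)

text \<open>Recursion on the next element of L. The bound i <= f i will turn a large position into a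
  large element.\<close>

lemma increasing_enumeration:
  assumes L: "L \<in> range S" "infinite_in L"
  obtains f where "comp f" "\<And>i. f i \<in> L" "\<And>i j. i < j \<Longrightarrow> f i < f j" "\<And>i. i \<le> f i"
proof -
  let ?next = "\<lambda>x. LEAST y. x < y \<and> y \<in> L"
  have ex: "\<exists>y. x < y \<and> y \<in> L" for x using L(2) by (auto simp: infinite_in_def)
  have D: "dec (\<lambda>y. x < y \<and> y \<in> L)" for x by (intro eff L)
  have nxt: "x < ?next x \<and> ?next x \<in> L" for x
    using Least_dec(1)[OF D] ex[of x] by blast
  have G: "comp2 (\<lambda>_ y. ?next y)" unfolding comp2_def by (intro eff L ex)
  define f where "f = prec (?next 0) (\<lambda>_ y. ?next y)"
  have f: "f 0 = ?next 0" "f (n + 1) = ?next (f n)" for n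
    unfolding f_def using prec[OF G] by blast+
  have cf: "comp f" unfolding f_def by (intro eff L ex)
  have inc1: "f n < f (n + 1)" for n using nxt by (simp add: f(2))
  have "f n \<in> L" for n
  proof -
    have "dec (\<lambda>n. f n \<in> L)" by (intro eff L comp_compose[OF cf])
    then show ?thesis by (induction n rule: dec_induct) (simp_all add: f nxt)
  qed
  moreover have "f i < f j" if "i < j" for i j
  proof -
    have "dec (\<lambda>j. i < j \<longrightarrow> f i < f j)" by (intro eff comp_compose[OF cf])
    then have "i < j \<longrightarrow> f i < f j"
      by (induction j rule: dec_induct) (use inc1 less_trans in \<open>auto simp: le_less\<close>)
    then show ?thesis using that by blast
  qed
  moreover have "i \<le> f i" for i
  proof -
    have "dec (\<lambda>i. i \<le> f i)" by (intro eff comp_compose[OF cf])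
    then show ?thesis
      by (induction i rule: dec_induct) (use inc1 le_less_trans in auto)
  qed
  ultimately show ?thesis using that cf by blast
qed

section \<open>Consequences of homogeneity\<close>

context
  fixes X f and homogeneous :: bool
  assumes X: "X \<in> range S" and f: "comp f" and inc: "\<And>i j. i < j \<Longrightarrow> f i < f j"
    and ge: "\<And>i. i \<le> f i" and even: "\<And>i. \<exists>j. f i = 2 * j"
    and hom: "\<And>s. exl s \<Longrightarrow> (\<And>x. fmem x s \<Longrightarrow> x \<in> range f) \<Longrightarrow> stable X s \<longleftrightarrow> homogeneous"
begin

text \<open>Joining f m with the blocks after positions q and r gives an exactly large subset of the
  range of f, to which homogeneity applies. The minimum is chosen independently of the blocks, as
  long as they come later and do not overlap.\<close>

lemma two_blocks:
  assumes q: "m \<le> q" "q + level (f m) \<le> r"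
  shows "homogeneous \<longleftrightarrow>
    (\<forall>i\<le>level (f m). \<forall>p<f m. approx X f q i p \<longleftrightarrow> approx X f r i p)"
proof -
  define k where "k = level (f m)"
  have k: "f m + 3 = 2 * k + 1"
  proof -
    obtain j where j: "f m = 2 * j" using even by blast
    have "(3::'a) = 2 + 1" by simp
    then show ?thesis unfolding k_def j level_even by (simp only: distrib_left mult_1_right add.assoc)
  qed
  have qk: "q + k \<le> r" using q(2) by (simp add: k_def)
  \<comment> \<open>h lists the intended set in increasing order: the minimum at 0, the block after
    q at 1 to k, the block after r at k + 1 to 2 * k.\<close>
  define h where "h i = (if i = 0 then f m else if i \<le> k then f (q + i) else f (r + (i - k)))" for i
  have ch: "comp h" unfolding h_def by (intro eff comp_compose[OF f])
  have h1: "h i = f (q + i)" if "i \<noteq> 0" "i \<le> k" for i using that by (simp add: h_def)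
  have h2: "h (k + i) = f (r + i)" if "i \<noteq> 0" for i
    using that by (simp add: h_def zero_less_iff_neq_zero not_le)
  have "h i < h j" if ij: "i < j" for i j
  proof -
    have j0: "j \<noteq> 0" using ij by auto
    consider "i = 0" "j \<le> k" | "i \<noteq> 0" "j \<le> k"
      | b where "i = 0" "j = k + b" "b \<noteq> 0" | b where "i \<noteq> 0" "i \<le> k" "j = k + b" "b \<noteq> 0"
      | a b where "i = k + a" "j = k + b" "a \<noteq> 0" "b \<noteq> 0"
    proof -
      have split: "x \<le> k \<or> (\<exists>a. x = k + a \<and> a \<noteq> 0)" for x
        using le_iff_add[of k x] linear[of x k] by auto
      show ?thesis using split[of i] split[of j] that ij by (metis less_imp_le order_trans)
    qed
    then show ?thesis
    proof cases
      case 1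
      then show ?thesis using j0 inc[OF less_add_nonzero[OF q(1) j0]] by (simp add: h_def)
    next
      case 2
      then show ?thesis using ij j0 inc by (simp add: h1 less_imp_le order_trans[of i j k])
    next
      case 3
      have "q \<le> q + k" by simp
      then have "m \<le> r" using q(1) qk by (meson order_trans)
      then have "m < r + b" using 3 by (intro less_add_nonzero)
      then show ?thesis using 3 inc h2[of b] by (simp add: h_def[of 0])
    next
      case 4
      have "q + i \<le> r" using 4 qk by (meson add_left_mono order_trans)
      then have "q + i < r + b" using 4 by (intro less_add_nonzero)
      then show ?thesis using 4 inc by (simp add: h1 h2)
    next
      case 5
      then show ?thesis using ij inc by (simp add: h2)
    qed
  qed
  moreover have h0: "h 0 = f m" by (simp add: h_def)
  ultimately obtain s where s: "exl s" "\<And>x. fmem x s \<longleftrightarrow> (\<exists>i<f m + 3. x = h i)"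
    "\<And>i. i < f m + 3 \<Longrightarrow> el s i = h i"
    using increasing_exl[OF ch] by metis
  have el0: "el s 0 = f m" using s(3)[of 0] h0 by (simp add: zero_less_iff_neq_zero)
  have cel: "comp (el s)" by (intro comp_el eff)
  have kk: "i + j \<le> 2 * k" if "i \<le> k" "j \<le> k" for i j
    using add_mono[OF that] by (simp add: mult_2)
  have "stable X s \<longleftrightarrow> homogeneous"
    by (rule hom[OF s(1)]) (auto simp: s(2) h_def)
  moreover have "approx X (el s) 0 i p \<longleftrightarrow> approx X f q i p" if "i \<le> k" for i p
  proof (rule approx_cong[OF X cel f])
    fix l assume "l \<noteq> 0" "l \<le> i"
    then show "el s (0 + l) = f (q + l)"
      using s(3)[of l] h1[of l] kk[of l 0] that by (simp add: k)
  qed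
  moreover have "approx X (el s) k i p \<longleftrightarrow> approx X f r i p" if "i \<le> k" for i p
  proof (rule approx_cong[OF X cel f])
    fix l assume "l \<noteq> 0" "l \<le> i"
    then show "el s (k + l) = f (r + l)"
      using s(3)[of "k + l"] h2[of l] kk[of k l] that by (simp add: k)
  qed
  ultimately show ?thesis unfolding stable_def el0 k_def[symmetric] by simp
qed

text \<open>With the minimum f 0 kept fixed there are at most \<open>pow2 B\<close> patterns, so two
  of \<open>pow2 B + 1\<close> blocks agree. By \<open>two_blocks\<close> this one agreement decides
  the common colour.\<close>

lemma homogeneous_stable: homogeneous
proof -
  define k where "k = level (f 0)"
  \<comment> \<open>By \<open>pair_sum_less\<close> every pair of a stage i <= k and an argument p <
    f 0 has a code below B, so the first B truth values contain the whole pattern.\<close>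
  define B where "B = pair k (f 0)"
  \<comment> \<open>Starting the blocks at multiples of k keeps distinct blocks disjoint.\<close>
  let ?P = "\<lambda>a z. approx X f (a * k) (pfst z) (psnd z)"
  have D: "dec (?P a)" for a by (intro eff X comp_compose[OF f])
  have c: "comp (\<lambda>a. bin (?P a) B)" by (intro eff X comp_compose[OF f])
  obtain a b where ab: "a < b" "bin (?P a) B = bin (?P b) B"
    using pigeonhole[OF c, of "pow2 B"] bin_less[OF D] by metis
  have "a * k + k = (a + 1) * k" by (simp add: algebra_simps)
  also have "\<dots> \<le> b * k" using ab(1) by (intro mult_right_mono) auto
  finally have "a * k + level (f 0) \<le> b * k" by (simp add: k_def)
  note two_blocks[OF _ this]
  moreover have "approx X f (a * k) i p \<longleftrightarrow> approx X f (b * k) i p" if "i \<le> k" "p < f 0" for i p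
  proof -
    have "pair i p < B" unfolding B_def using that by (intro pair_sum_less add_le_less_mono)
    from bin_inject[OF D D ab(2) this] show ?thesis by simp
  qed
  ultimately show ?thesis unfolding k_def by simp
qed

text \<open>The blocks after m and n may overlap and belong to minima of different levels, so both
  are compared with a third block beyond them.\<close>

lemma approx_stable:
  assumes "p < f m" "2 * i \<le> f m" "p < f n" "2 * i \<le> f n"
  shows "approx X f m i p \<longleftrightarrow> approx X f n i p"
proof -
  define r where "r = (m + level (f m)) + (n + level (f n))"
  have l: "i \<le> level (f m)" if "2 * i \<le> f m" for m
  proof -
    obtain j where "f m = 2 * j" using even by blast
    then show ?thesis using that by (simp add: add_increasing2)
  qed
  have "m + level (f m) \<le> r" "n + level (f n) \<le> r"
    by (simp_all add: r_def add_increasing add_increasing2 del: add.assoc)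
  then show ?thesis
    using two_blocks[of m m r] two_blocks[of n n r] homogeneous_stable assms l by simp
qed

lemma omega_jump_exists: "\<exists>Y\<in>range S. omega_jump X Y"
proof -
  \<comment> \<open>As every x is at most f x, the start p + 2 * i + 1 satisfies both size
    conditions of \<open>approx_stable\<close>. Fixing it makes membership in the limit
    decidable.\<close>
  define J where "J i p \<longleftrightarrow> approx X f (p + 2 * i + 1) i p" for i p
  define Y where "Y = {z. (\<exists>x\<le>z. \<exists>i\<le>z. z = pair x i) \<and> J (psnd z) (pfst z)}"
  have "dec (\<lambda>z. (\<exists>x\<le>z. \<exists>i\<le>z. z = pair x i) \<and> J (psnd z) (pfst z))"
    unfolding J_def by (intro eff X comp_compose[OF f])
  then have "Y \<in> range S" unfolding Y_def dec_def .
  moreover have Y: "pair x i \<in> Y \<longleftrightarrow> J i x" for x i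
    using pair_ge by (auto simp: Y_def)
  have J: "approx X f m i p \<longleftrightarrow> J i p" if m: "p < f m" "2 * i \<le> f m" for m i p
    unfolding J_def
  proof (rule approx_stable[OF m])
    have "p < p + 2 * i + 1" "2 * i \<le> p + 2 * i + 1" by (simp_all add: add_increasing add_increasing2)
    then show "p < f (p + 2 * i + 1)" "2 * i \<le> f (p + 2 * i + 1)"
      using ge by (meson less_le_trans order_trans)+
  qed
  have "J (i + 1) p \<longleftrightarrow> (\<exists>w. halting_code (J i) p w)" for i p
  proof -
    define m where "m = p + 2 * (i + 1) + 1"
    have le_m: "p < m" "2 * (i + 1) \<le> m" by (simp_all add: m_def add_increasing add_increasing2)
    have i2: "2 * i \<le> 2 * (i + 1)" by (intro mult_left_mono) simp_all
    \<comment> \<open>A computation coded by w < f (n + 1) queries only numbers up to w, and below f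
      (n + 1) the approximation from n + 1 agrees with \<open>J i\<close>. This is exactly the range
      of the bounded quantifier in \<open>approx_succ\<close>.\<close>
    have loc: "halting_code (approx X f (n + 1) i) p w \<longleftrightarrow> halting_code (J i) p w"
      if "m \<le> n" "w < f (n + 1)" for n w
    proof -
      have "2 * i \<le> n + 1" using i2 le_m(2) that(1) by (meson add_increasing2 order_trans zero_le_one)
      then have "2 * i \<le> f (n + 1)" using ge order_trans by blast
      then have "approx X f (n + 1) i v \<longleftrightarrow> J i v" if "v \<le> w" for v
        using J that \<open>w < f (n + 1)\<close> by (meson le_less_trans)
      then show ?thesis using halting_code_local by blast
    qed
    have big: "approx X f n (i + 1) p \<longleftrightarrow> J (i + 1) p" if "m \<le> n" for n
    proof (rule J)
      have "m \<le> f n" using that ge order_trans by blast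
      then show "p < f n" "2 * (i + 1) \<le> f n" using le_m by auto
    qed
    show ?thesis
    proof
      assume "J (i + 1) p"
      then have "approx X f m (i + 1) p" using big by blast
      then show "\<exists>w. halting_code (J i) p w" unfolding approx_succ[OF X f] using loc by blast
    next
      assume "\<exists>w. halting_code (J i) p w"
      then obtain w where w: "halting_code (J i) p w" ..
      \<comment> \<open>The start m + w makes the bound f (m + w + 1) exceed w, so the given
        computation is found; stability then transfers the result to
        \<open>J (i + 1)\<close>.\<close>
      have m: "m \<le> m + w" by simp
      have "w < f (m + w + 1)" using ge[of "m + w + 1"]
        by (rule less_le_trans[rotated]) (simp add: add_increasing)
      then have "approx X f (m + w) (i + 1) p"
        unfolding approx_succ[OF X f] using loc[OF m] w by blast
      then show "J (i + 1) p" using big[OF m] by blast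
    qed
  qed
  then have "pair x (i + 1) \<in> Y \<longleftrightarrow> halts (\<lambda>y. pair y i \<in> Y) x x" for x i
    unfolding Y halts_iff .
  moreover have "pair x 0 \<in> Y \<longleftrightarrow> x \<in> X" for x unfolding Y J_def by (rule approx_0[OF X])
  moreover have "\<exists>x i. z = pair x i" if "z \<in> Y" for z using that by (auto simp: Y_def)
  ultimately show ?thesis unfolding omega_jump_def by blast
qed

end

theorem omega_jump_if_homogeneous_sets:
  assumes RT: "\<And>M C. M \<in> range S \<Longrightarrow> C \<in> range S \<Longrightarrow> infinite_in M \<Longrightarrow> colouring C \<Longrightarrow>
      \<exists>L\<in>range S. infinite_in L \<and> L \<subseteq> M \<and>
        (\<exists>c<2. \<forall>s. exl s \<and> (\<forall>x. fmem x s \<longrightarrow> x \<in> L) \<longrightarrow> pair s c \<in> C)"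
    and X: "X \<in> range S"
  shows "\<exists>Y\<in>range S. omega_jump X Y"
proof -
  define M where "M = {x::'a. \<exists>j\<le>x. x = 2 * j}"
  define C where "C = {z. (\<exists>s\<le>z. \<exists>c\<le>z. z = pair s c) \<and> exl (pfst z) \<and>
    (stable X (pfst z) \<and> psnd z = 0 \<or> \<not> stable X (pfst z) \<and> psnd z = 1)}"
  have M: "M \<in> range S" unfolding M_def dec_def[symmetric] by (intro eff)
  have C: "C \<in> range S" unfolding C_def dec_def[symmetric] by (intro eff X)
  have mem_C: "pair s c \<in> C \<longleftrightarrow> exl s \<and> (stable X s \<and> c = 0 \<or> \<not> stable X s \<and> c = 1)" for s c
    unfolding C_def using pair_ge by auto
  have "infinite_in M"
    unfolding infinite_in_def
  proof
    fix x :: 'a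
    have "x < x + 1" by simp
    also have "\<dots> \<le> 2 * (x + 1)" using mult_le_self[of 2 "x + 1"] by (simp add: mult.commute)
    finally have "x < 2 * (x + 1)" .
    moreover have "x + 1 \<le> 2 * (x + 1)" by fact
    ultimately show "\<exists>y. x < y \<and> y \<in> M" unfolding M_def by blast
  qed
  moreover have "colouring C"
    unfolding colouring_def
  proof (intro conjI allI impI)
    fix z assume "z \<in> C"
    then show "\<exists>s c. z = pair s c \<and> exl s \<and> c < 2" unfolding C_def by auto
  next
    fix s assume "exl s"
    then show "\<exists>c. pair s c \<in> C \<and> (\<forall>d. pair s d \<in> C \<longrightarrow> d = c)" unfolding mem_C by metis
  qed
  ultimately obtain L c where L: "L \<in> range S" "infinite_in L" "L \<subseteq> M"
    and hom: "\<And>s. exl s \<Longrightarrow> (\<And>x. fmem x s \<Longrightarrow> x \<in> L) \<Longrightarrow> pair s c \<in> C"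
    using RT[OF M C] by blast
  obtain f where f: "comp f" "\<And>i. f i \<in> L" "\<And>i j. i < j \<Longrightarrow> f i < f j" "\<And>i. i \<le> f i"
    using increasing_enumeration[OF L(1,2)] by blast
  show ?thesis
  \<comment> \<open>Colour 0 is the colour of agreement between the two blocks.\<close>
  proof (rule omega_jump_exists[OF X f(1,3,4), where homogeneous = "c = 0"])
    show "\<exists>j. f i = 2 * j" for i using f(2)[of i] L(3) by (auto simp: M_def)
    show "stable X s \<longleftrightarrow> c = 0" if "exl s" "\<And>x. fmem x s \<Longrightarrow> x \<in> range f" for s
      using hom[OF that(1)] that(2) f(2) unfolding mem_C by (metis rangeE zero_neq_one)
  qed
qed

end

section \<open>Interpretation of named formulas\<close>

text \<open>
  A context consists of the numbers of enclosing quantifiers and of the values of the variables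
  they bind, outermost first. Denotations are required to persist in all extensions of the context.
\<close>

type_synonym 'a ctx = "nat \<times> nat \<times> (nat \<Rightarrow> 'a) \<times> (nat \<Rightarrow> nat)"

definition ext :: "'a ctx \<Rightarrow> 'a ctx \<Rightarrow> bool" where
  "ext = (\<lambda>(n, m, v, w) (n', m', v', w').
    n \<le> n' \<and> m \<le> m' \<and> (\<forall>i<n. v' i = v i) \<and> (\<forall>i<m. w' i = w i))"

lemma ext_refl: "ext c c"
  by (auto simp: ext_def)

lemma ext_trans: "ext c d \<Longrightarrow> ext d e \<Longrightarrow> ext c e"
  by (auto simp: ext_def)

text \<open>Translates positions counted from the outside into de Bruijn indices counted from the
  inside; indices from n on are free and read from e. Positions, unlike indices, do not change when
  a further quantifier is entered.\<close>

definition env :: "(nat \<Rightarrow> 'b) \<Rightarrow> nat \<Rightarrow> (nat \<Rightarrow> 'b) \<Rightarrow> nat \<Rightarrow> 'b" where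
  "env e n v i = (if i < n then v (n - Suc i) else e (i - n))"

lemma env_Suc: "env e (Suc n) (v(n := x)) = case_nat x (env e n v)"
  by (rule ext) (auto simp: env_def split: nat.split)

context rca
begin

context
  fixes e0 :: "nat \<Rightarrow> 'a" and w0 :: "nat \<Rightarrow> nat"
begin

definition den :: "'a ctx \<Rightarrow> ntm \<Rightarrow> 'a \<Rightarrow> bool" where
  "den c t x \<longleftrightarrow> (\<forall>n m v w. ext c (n, m, v, w) \<longrightarrow> tval (arith_str S) (env e0 n v) (t n m) = x)"

definition sden :: "'a ctx \<Rightarrow> nset \<Rightarrow> nat \<Rightarrow> bool" where
  "sden c X k \<longleftrightarrow> (\<forall>n m v w. ext c (n, m, v, w) \<longrightarrow> env w0 m w (X n m) = k)"

definition means :: "'a ctx \<Rightarrow> nfm \<Rightarrow> bool \<Rightarrow> bool" where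
  "means c p b \<longleftrightarrow> (\<forall>n m v w. ext c (n, m, v, w) \<longrightarrow>
    sat (arith_str S) (env e0 n v) (env w0 m w) (p n m) = b)"

text \<open>
  Every context has one direct predecessor, so these rules climb a chain of extensions
  deterministically.
\<close>

lemma ext_backs:
  "ext c d \<Longrightarrow> den c t x \<Longrightarrow> den d t x"
  "ext c d \<Longrightarrow> sden c X k \<Longrightarrow> sden d X k"
  "ext c d \<Longrightarrow> ext b c \<Longrightarrow> ext b d"
  unfolding den_def sden_def using ext_trans by blast+

lemma den_base:
  "den c \<^bold>0 0"
  "den c \<^bold>1 1"
  "den c s x \<Longrightarrow> den c t y \<Longrightarrow> den c (s \<^bold>+ t) (x + y)"
  "den c s x \<Longrightarrow> den c t y \<Longrightarrow> den c (s \<^bold>* t) (x * y)"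
  by (auto simp: den_def nzero_def nunit_def nadd_def nmul_def arith_str_def)

lemma den_pair: "den c s x \<Longrightarrow> den c t y \<Longrightarrow> den c \<^bold>\<langle>s, t\<^bold>\<rangle> (pair x y)"
  unfolding npair_def pair_def by (intro den_base)

lemma den_num: "den c (nnum 0) 0" "den c (nnum 1) 1" "den c (nnum 2) 2" "den c (nnum 3) 3" "den c (nnum 4) 4"
proof -
  have *: "den c (nnum k) (of_nat k)" for k
  proof (induction k)
    case (Suc k)
    then show ?case using den_base(3)[OF Suc den_base(2)] by (simp add: add.commute)
  qed (simp add: den_base)
  show "den c (nnum 0) 0" "den c (nnum 1) 1" "den c (nnum 2) 2" "den c (nnum 3) 3" "den c (nnum 4) 4"
    using *[of 0] *[of 1] *[of 2] *[of 3] *[of 4] by (simp_all only: of_nat_0 of_nat_1 of_nat_numeral)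
qed

lemmas dens = den_base den_pair den_num

lemma means_atoms:
  "den c s x \<Longrightarrow> den c t y \<Longrightarrow> means c (s \<^bold>= t) (x = y)"
  "den c s x \<Longrightarrow> den c t y \<Longrightarrow> means c (s \<^bold>< t) (x < y)"
  "den c s x \<Longrightarrow> sden c X k \<Longrightarrow> means c (s \<^bold>\<in> X) (x \<in> S k)"
  by (auto simp: den_def sden_def means_def neq_def nless_def nmem_def arith_str_def)

lemma means_connectives:
  "means c p a \<Longrightarrow> means c (\<^bold>\<not> p) (\<not> a)"
  "means c p a \<Longrightarrow> means c q b \<Longrightarrow> means c (p \<^bold>\<and> q) (a \<and> b)"
  "means c p a \<Longrightarrow> means c q b \<Longrightarrow> means c (p \<^bold>\<or> q) (a \<or> b)"
  "means c p a \<Longrightarrow> means c q b \<Longrightarrow> means c (p \<^bold>\<longrightarrow> q) (a \<longrightarrow> b)"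
  "means c p a \<Longrightarrow> means c q b \<Longrightarrow> means c (p \<^bold>\<longleftrightarrow> q) (a \<longleftrightarrow> b)"
  by (auto simp: means_def nneg_def ncon_def ndis_def nimp_def niff_def)

lemma means_le: "den c s x \<Longrightarrow> den c t y \<Longrightarrow> means c (s \<^bold>\<le> t) (x \<le> y)"
  unfolding nle_def le_less by (intro means_connectives means_atoms)

text \<open>A binder feeds its body the variable bound at depth n; recording x at position n gives
  this variable the denotation x in every extension.\<close>

lemma means_body:
  assumes "\<And>d t x. ext c d \<Longrightarrow> den d t x \<Longrightarrow> means d (F t) (P x)" and c: "ext c (n, m, v, w)"
  shows "sat (arith_str S) (case_nat x (env e0 n v)) (env w0 m w)
    (F (\<lambda>n' m'. Var (n' - Suc n)) (Suc n) m) = P x"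
proof -
  let ?d = "(Suc n, m, v(n := x), w)"
  have "ext c ?d" using c by (auto simp: ext_def)
  moreover have "den ?d (\<lambda>n' m'. Var (n' - Suc n)) x"
    unfolding den_def
  proof (intro allI impI)
    fix n' m' v' w' assume "ext ?d (n', m', v', w')"
    then have "Suc n \<le> n'" "v' n = x" by (auto simp: ext_def)
    then show "tval (arith_str S) (env e0 n' v') (Var (n' - Suc n)) = x" by (simp add: env_def)
  qed
  ultimately have "means ?d (F (\<lambda>n' m'. Var (n' - Suc n))) (P x)" by (rule assms(1))
  then have "sat (arith_str S) (env e0 (Suc n) (v(n := x))) (env w0 m w)
      (F (\<lambda>n' m'. Var (n' - Suc n)) (Suc n) m) = P x"
    unfolding means_def using ext_refl by blast
  then show ?thesis unfolding env_Suc .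
qed

lemma means_bodyS:
  assumes "\<And>d X k. ext c d \<Longrightarrow> sden d X k \<Longrightarrow> means d (F X) (P k)" and c: "ext c (n, m, v, w)"
  shows "sat (arith_str S) (env e0 n v) (case_nat k (env w0 m w))
    (F (\<lambda>n' m'. m' - Suc m) n (Suc m)) = P k"
proof -
  let ?d = "(n, Suc m, v, w(m := k))"
  have "ext c ?d" using c by (auto simp: ext_def)
  moreover have "sden ?d (\<lambda>n' m'. m' - Suc m) k"
    unfolding sden_def
  proof (intro allI impI)
    fix n' m' v' w' assume "ext ?d (n', m', v', w')"
    then have "Suc m \<le> m'" "w' m = k" by (auto simp: ext_def)
    then show "env w0 m' w' (m' - Suc m) = k" by (simp add: env_def)
  qed
  ultimately have "means ?d (F (\<lambda>n' m'. m' - Suc m)) (P k)" by (rule assms(1))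
  then have "sat (arith_str S) (env e0 n v) (env w0 (Suc m) (w(m := k)))
      (F (\<lambda>n' m'. m' - Suc m) n (Suc m)) = P k"
    unfolding means_def using ext_refl by blast
  then show ?thesis unfolding env_Suc .
qed

lemma means_quantifiers:
  assumes "\<And>d t x. ext c d \<Longrightarrow> den d t x \<Longrightarrow> means d (F t) (P x)"
  shows "means c (nallN F) (\<forall>x. P x)" "means c (nexN F) (\<exists>x. P x)"
  using means_body[of c F P, OF assms] by (simp_all add: means_def nallN_def nexN_def)

lemma means_quantifiersS:
  assumes "\<And>d X k. ext c d \<Longrightarrow> sden d X k \<Longrightarrow> means d (F X) (P k)"
  shows "means c (nallS F) (\<forall>k. P k)" "means c (nexS F) (\<exists>k. P k)"
  using means_bodyS[of c F P, OF assms] by (simp_all add: means_def nallS_def nexS_def)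

lemma means_ex1N:
  assumes "\<And>d t x. ext c d \<Longrightarrow> den d t x \<Longrightarrow> means d (F t) (P x)"
  shows "means c (nex1N F) (\<exists>x. P x \<and> (\<forall>y. P y \<longrightarrow> y = x))"
  unfolding nex1N_def
proof (intro means_quantifiers means_connectives means_atoms)
  show "means d (F t) (P x)" if "ext c d" "den d t x" for d t x by (rule assms[OF that])
  \<comment> \<open>In a unique existence formula the body occurs below one quantifier and again
    below two, which takes two extensions of the context.\<close>
  show "means d (F t) (P x)" if "ext c b" "ext b d" "den d t x" for b d t x
    by (rule assms[OF ext_trans[OF that(1,2)] that(3)])
qed (assumption | erule ext_backs)+

lemmas means_intros = means_atoms means_connectives means_le means_ex1N means_quantifiers means_quantifiersS

text \<open>The semantic predicate repeats the quantifier structure of its formula, so unfolding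
  both and following the syntax proves the correspondence. The translations below work in the same
  way.\<close>

lemma means_finmem: "den c i x \<Longrightarrow> den c s y \<Longrightarrow> means c (i \<^bold>\<in>\<^sub>f s) (fmem x y)"
  unfolding finmem_def fmem_def ndvd_def dvd_def
  by (intro means_intros dens; (assumption | erule ext_backs)+)

lemma means_triple: "den c s y \<Longrightarrow> means c (is_triple s) (triple y)"
  unfolding is_triple_def triple_def
  by (intro means_intros dens; (assumption | erule ext_backs)+)

lemma means_fin: "den c s y \<Longrightarrow> means c (is_fin s) (fin y)"
  unfolding is_fin_def fin_def
  by (intro means_intros means_triple means_finmem dens; (assumption | erule ext_backs)+)

lemma means_seq: "den c s x \<Longrightarrow> den c l y \<Longrightarrow> means c (is_seq s l) (seq x y)"
  unfolding is_seq_def seq_def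
  by (intro means_intros means_fin means_finmem dens; (assumption | erule ext_backs)+)

lemma means_card: "den c s x \<Longrightarrow> den c l y \<Longrightarrow> means c (has_card s l) (card_is x y)"
  unfolding has_card_def card_is_def
  by (intro means_intros means_seq means_finmem dens; (assumption | erule ext_backs)+)

lemma means_min: "den c s x \<Longrightarrow> den c l y \<Longrightarrow> means c (is_min s l) (min_is x y)"
  unfolding is_min_def min_is_def
  by (intro means_intros means_finmem dens; (assumption | erule ext_backs)+)

lemma means_exl: "den c s x \<Longrightarrow> means c (exactly_large s) (exl x)"
  unfolding exactly_large_def exl_def
  by (intro means_intros means_fin means_min means_card dens; (assumption | erule ext_backs)+)

lemma means_infinite: "sden c X k \<Longrightarrow> means c (infinite_set X) (infinite_in (S k))"
  unfolding infinite_set_def infinite_in_def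
  by (intro means_intros dens; (assumption | erule ext_backs)+)

lemma means_colouring: "sden c X k \<Longrightarrow> means c (is_colouring X) (colouring (S k))"
  unfolding is_colouring_def colouring_def
  by (intro means_intros means_exl dens; (assumption | erule ext_backs)+)

lemma means_RT:
  "means c RT_exactly_large
    (\<forall>M C. infinite_in (S M) \<and> colouring (S C) \<longrightarrow>
      (\<exists>L. infinite_in (S L) \<and> (\<forall>x. x \<in> S L \<longrightarrow> x \<in> S M) \<and>
        (\<exists>c. c < 2 \<and> (\<forall>s. exl s \<and> (\<forall>x. fmem x s \<longrightarrow> x \<in> S L) \<longrightarrow> pair s c \<in> S C))))"
  unfolding RT_exactly_large_def subset_of_def fin_subset_of_def
  by (intro means_intros means_exl means_infinite means_colouring means_finmem dens;
      (assumption | erule ext_backs)+)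

lemma means_reg: "den c r x \<Longrightarrow> den c a y \<Longrightarrow> den c v z \<Longrightarrow> means c (reg r a v) (regv x y z)"
  unfolding reg_def regv_def
  by (intro means_intros means_finmem dens; (assumption | erule ext_backs)+)

lemma means_reg_update:
  "den c r x \<Longrightarrow> den c a y \<Longrightarrow> den c v z \<Longrightarrow> den c r' x' \<Longrightarrow>
    means c (reg_update r a v r') (regup x y z x')"
  unfolding reg_update_def regup_def
  by (intro means_intros means_reg dens; (assumption | erule ext_backs)+)

lemma means_reg_init: "den c r x \<Longrightarrow> den c v z \<Longrightarrow> means c (reg_init v r) (reginit z x)"
  unfolding reg_init_def reginit_def
  by (intro means_intros means_reg dens; (assumption | erule ext_backs)+)

lemma means_step:
  assumes A: "\<And>d t x. ext c d \<Longrightarrow> den d t x \<Longrightarrow> means d (A t) (P x)"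
    and "den c e xe" "den c q xq" "den c r xr" "den c q' xq'" "den c r' xr'"
  shows "means c (urm_step A e q r q' r') (step P xe xq xr xq' xr')"
  unfolding urm_step_def step_def
  by (insert assms(2-), intro means_intros means_reg means_reg_update means_finmem dens A;
      (assumption | erule ext_backs)+)

lemma means_halts:
  assumes A: "\<And>d t x. ext c d \<Longrightarrow> den d t x \<Longrightarrow> means d (A t) (P x)"
    and "den c e xe" "den c x xx"
  shows "means c (urm_halts A e x) (halts P xe xx)"
  unfolding urm_halts_def halts_def run_def
  by (insert assms(2-), intro means_intros means_seq means_reg_init means_finmem dens means_step A;
      (assumption | erule ext_backs)+)

lemma means_omega_jumps_exist:
  "means c omega_jumps_exist (\<forall>X. \<exists>Y. omega_jump (S X) (S Y))"
  unfolding omega_jumps_exist_def is_omega_jump_def omega_jump_def in_jump_def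
  by (intro means_intros means_halts dens;
      (assumption | erule ext_backs)+)

end

lemma sat_corollary:
  "sat (arith_str S) e w (sentence (RT_exactly_large \<^bold>\<longrightarrow> omega_jumps_exist))"
proof -
  let ?c = "(0, 0, \<lambda>_. 0, \<lambda>_. 0)"
  let ?R = "\<forall>M C. infinite_in (S M) \<and> colouring (S C) \<longrightarrow>
      (\<exists>L. infinite_in (S L) \<and> (\<forall>x. x \<in> S L \<longrightarrow> x \<in> S M) \<and>
        (\<exists>c. c < 2 \<and> (\<forall>s. exl s \<and> (\<forall>x. fmem x s \<longrightarrow> x \<in> S L) \<longrightarrow> pair s c \<in> S C)))"
  have "\<forall>X. \<exists>Y. omega_jump (S X) (S Y)" if R: ?R
  proof
    fix X
    have "\<exists>Y\<in>range S. omega_jump (S X) Y"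
    proof (rule omega_jump_if_homogeneous_sets)
      fix M C assume "M \<in> range S" "C \<in> range S" and MC: "infinite_in M" "colouring C"
      then obtain i j where ij: "M = S i" "C = S j" by blast
      from R[rule_format, of i j] MC ij show "\<exists>L\<in>range S. infinite_in L \<and> L \<subseteq> M \<and>
          (\<exists>c<2. \<forall>s. exl s \<and> (\<forall>x. fmem x s \<longrightarrow> x \<in> L) \<longrightarrow> pair s c \<in> C)"
        by blast
    qed simp
    then show "\<exists>Y. omega_jump (S X) (S Y)" by blast
  qed
  moreover have "means e w ?c (RT_exactly_large \<^bold>\<longrightarrow> omega_jumps_exist)
      (?R \<longrightarrow> (\<forall>X. \<exists>Y. omega_jump (S X) (S Y)))"
    by (intro means_connectives means_RT means_omega_jumps_exist)
  then have "sat (arith_str S) (env e 0 (\<lambda>_. 0)) (env w 0 (\<lambda>_. 0))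
      (sentence (RT_exactly_large \<^bold>\<longrightarrow> omega_jumps_exist)) =
      (?R \<longrightarrow> (\<forall>X. \<exists>Y. omega_jump (S X) (S Y)))"
    unfolding means_def sentence_def using ext_refl by blast
  moreover have "env e 0 (\<lambda>_. 0) = e" "env w 0 (\<lambda>_. 0) = w" by (simp_all add: env_def fun_eq_iff)
  ultimately show ?thesis by simp
qed

end


section \<open>Countermodels of underivable formulas\<close>

lemma RCA0_closed:
  assumes "p \<in> RCA0" shows "boundN p = 0" "boundS p = 0"
proof -
  have "boundN p = 0 \<and> boundS p = 0" if "p \<in> basic_axioms"
    using that unfolding basic_axioms_def sentence_def
    by (auto simp: nallN_def nneg_def neq_def nadd_def nmul_def nzero_def nunit_def nimp_def
        niff_def ndis_def nless_def Neg_def Iff_def Con_def Dis_def)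
  then show "boundN p = 0" "boundS p = 0"
    using assms unfolding RCA0_def by auto
qed

primrec numeral_tm :: "nat \<Rightarrow> tm" where
  "numeral_tm 0 = Zero"
| "numeral_tm (Suc k) = Add (numeral_tm k) One"

text \<open>Distinct numerals have distinct classes, so the term model is infinite; being countable
  as well, it can be carried over to \<open>mnum\<close>.\<close>

lemma (in henkin) numeral_tm_inject:
  assumes "RCA0 \<subseteq> H"
  shows "Eq (numeral_tm i) (numeral_tm j) \<in> H \<Longrightarrow> i = j"
proof (induction i arbitrary: j)
  have ax: "sentence (\<^bold>\<forall>x. \<^bold>\<not> x \<^bold>+ \<^bold>1 \<^bold>= \<^bold>0) \<in> H"
    "sentence (\<^bold>\<forall>x. \<^bold>\<forall>y. x \<^bold>+ \<^bold>1 \<^bold>= y \<^bold>+ \<^bold>1 \<^bold>\<longrightarrow> x \<^bold>= y) \<in> H"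
    using assms by (auto simp: RCA0_def basic_axioms_def)
  have succ: "Eq (Add s One) Zero \<notin> H" for s
    using ax(1) by (simp add: sentence_def nallN_def nneg_def neq_def nadd_def nunit_def nzero_def
        mem_AllN mem_Neg instN_def)
  have inj: "Eq s t \<in> H" if "Eq (Add s One) (Add t One) \<in> H" for s t
    using ax(2) that by (simp add: sentence_def nallN_def nimp_def neq_def nadd_def nunit_def
        mem_AllN mem_Imp instN_def)
  {
    case 0
    then show ?case using succ mem_sym by (cases j) auto
  next
    case (Suc i)
    then show ?case using succ inj by (cases j) auto
  }
qed

lemma countermodel_exists:
  assumes "\<not> RCA0 \<turnstile> q" shows "\<exists>M. countermodel q M"
proof -
  have "\<not> insert (Neg q) RCA0 \<turnstile> Fls" using assms derives.Contr by blast
  moreover have "bdd_free (max (boundN (Neg q)) (boundS (Neg q))) (insert (Neg q) RCA0)"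
    using RCA0_closed by (simp add: bdd_free_def)
  ultimately obtain H where H: "insert (Neg q) RCA0 \<subseteq> H" "henkin H" by (rule henkin_extension)
  interpret henkin H by (rule H(2))
  define cls where "cls t = {s. Eq t s \<in> H}" for t
  have cls: "cls s = cls t \<longleftrightarrow> Eq s t \<in> H" for s t
    unfolding cls_def using mem_refl mem_sym mem_trans by blast
  have "inj (\<lambda>k. cls (numeral_tm k))"
    using numeral_tm_inject H(1) cls by (auto intro!: injI)
  then have "infinite (range (\<lambda>k. cls (numeral_tm k)))" by (rule range_inj_infinite)
  then have inf: "infinite (range cls)" by (rule infinite_super[rotated]) auto
  have bij: "bij_betw (to_nat_on (range cls)) (range cls) UNIV"
    by (rule to_nat_on_infinite[OF _ inf]) simp
  define h where "h t = Abs_mnum (to_nat_on (range cls) (cls t))" for t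
  have h: "h s = h t \<longleftrightarrow> Eq s t \<in> H" for s t
    unfolding h_def Abs_mnum_inject[OF UNIV_I UNIV_I] cls[symmetric]
    using bij by (auto simp: bij_betw_def dest: inj_onD)
  have surj: "surj h"
    unfolding surj_def
  proof
    fix x
    obtain t where "to_nat_on (range cls) (cls t) = Rep_mnum x"
      using bij unfolding bij_betw_def by (metis UNIV_I imageE rangeE)
    then show "\<exists>t. x = h t" by (metis h_def Rep_mnum_inverse)
  qed
  have "sat (term_model h) e w p" if p: "p \<in> RCA0" for p e w
  proof -
    have "e = (\<lambda>i. h (inv h (e i)))" by (simp add: surj_f_inv_f[OF surj])
    moreover have "sub (\<lambda>i. inv h (e i)) w p = sub Var (\<lambda>X. X) p"
      using RCA0_closed[OF p] by (intro sub_cong) auto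
    ultimately show ?thesis
      using sat_term_model[OF h surj, of "\<lambda>i. inv h (e i)" w p] p H(1) by auto
  qed
  moreover have "\<not> sat (term_model h) (\<lambda>i. h (Var i)) (\<lambda>X. X) q"
    using sat_term_model[OF h surj, of Var "\<lambda>X. X" q] H(1) mem_Neg[of q] by auto
  ultimately show ?thesis unfolding countermodel_def models_RCA0_def by blast
qed

theorem corollary3:
  shows "RCA0 \<turnstile> sentence (RT_exactly_large \<^bold>\<longrightarrow> omega_jumps_exist)"
proof (rule ccontr)
  assume "\<not> ?thesis"
  \<comment> \<open>Any countermodel may be exchanged for \<open>the_model\<close>, the structure
    for which the type class instance was made.\<close>
  then have c: "countermodel (sentence (RT_exactly_large \<^bold>\<longrightarrow> omega_jumps_exist)) the_model"
    using countermodel_exists the_model(2) by blast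
  interpret rca "sets the_model"
    by standard (use c the_model_eq in \<open>simp add: countermodel_def\<close>)
  show False using c sat_corollary the_model_eq by (simp add: countermodel_def)
qed

end
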